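(* Suppose that Assumptions C, Z and Q (stated in the context) hold. Then the unconstrained least squares estimator $\widehat\theta=(\widehat\alpha',\widehat\gamma)'$ satisfies, as $n\to\infty$, $$\widehat\alpha-\alpha_0=O_p(n^{-1/2})\quad\text{and}\quad \widehat\gamma-\gamma_0=O_p(n^{-1/3}).$$
   Context: Model. For $t=1,\dots,n$ one observes $(y_t,x_t)$ with $y_t=\beta_0'x_t+\delta_0'x_t\mathbf 1\{q_t>\gamma_0\}+\varepsilon_t$, where $x_t=(1,x_{t2}',q_t)'$ is a $k$-dimensional regressor (the threshold variable $q_t$ is an element of $x_t$) and $\delta_0=(\delta_{10},\delta_{20}',\delta_{30})'$ is partitioned conformably with $x_t$. Write $\alpha=(\beta',\delta')'$, $\theta=(\alpha',\gamma)'$, $x_t(\gamma)=(x_t',x_t'\mathbf 1\{q_t>\gamma\})'$, so that $y_t=\alpha_0'x_t(\gamma_0)+\varepsilon_t$; the subscript $0$ denotes true values. The parameter space is a compact set $\Theta=\Lambda\times\Gamma\subset\mathbb R^{2k+1}$ ($\alpha\in\Lambda$, $\gamma\in\Gamma$), with $\Gamma$ a compact subset of the interior of the domain of $q_t$. Notation. $f$ is the density of $q_t$ (assumed to exist); $D(\gamma)=E(x_tx_t'\mid q_t=\gamma)$, $V(\gamma)=E(x_tx_t'\varepsilon_t^2\mid q_t=\gamma)$; $\mathbf{x}_t=x_t(\gamma_0)$, $M=E(\mathbf x_t\mathbf x_t')$, $\Omega=E(\mathbf x_t\mathbf x_t'\varepsilon_t^2)$. Estimator. $\widehat\theta=(\widehat\alpha',\widehat\gamma)'=\arg\min_{\theta\in\Theta}\mathbb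 S_n(\theta)$, $\mathbb S_n(\theta)=\frac1n\sum_{t=1}^n(y_t-\alpha'x_t(\gamma))^2$. Equivalently, $\widehat\alpha(\gamma)=\arg\min_{\alpha\in\Lambda}\mathbb S_n(\alpha,\gamma)$, $\widehat\gamma=\arg\min_{\gamma\in\Gamma\cap\{q_1,\dots,q_n\}}\mathbb S_n(\widehat\alpha(\gamma),\gamma)$ (if the minimizer is not unique, the maximal minimizer is taken), $\widehat\alpha=\widehat\alpha(\widehat\gamma)$. The continuity restriction in Assumption C is not imposed in the estimation. Assumption Z. $\{x_t,\varepsilon_t\}_{t\in\mathbb Z}$ is strictly stationary and ergodic, its $\rho$-mixing coefficients satisfy $\sum_{m=1}^\infty\rho_m^{1/2}<\infty$, and $E(\varepsilon_t\mid\mathcal F_{t-1})=0$, where $\mathcal F_t$ is the filtration up to time $t$. Furthermore $M,\Omega>0$ (positive definite), $E\|x_t\|^4<\infty$, $E\|x_t\varepsilon_t\|^4<\infty$ and $E|\varepsilon_t|^{4+\eta}<\infty$ for some $\eta>0$. Assumption Q. The functions $f(\gamma)$, $V(\gamma)$ and $D(\gamma)$ are continuous at $\gamma=\gamma_0$. For all $\gamma\in\Gamma$, the functions $f(\gamma)$, $E(x_tx_t'\mathbf 1\{q_t\le\gamma\})$ and $E(x_{t2}x_{t2}'\mid q_t=\gamma)$ are positive (positive definite for matrices) and continuous, and $f(\gamma)$, $E(|x_t|^4\mid q_t=\gamma)$ and $E(|x_t\varepsilon_t|^4\mid q_t=\gamma)$ are bounded by some $C<\infty$. Assumption C (kink).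 $\delta_{30}\ne0$, $\delta_{10}+\delta_{30}\gamma_0=0$ and $\delta_{20}=0$.
   Formalization: The regressors x_t are assumed known at time t−1 (F_{t−1}-measurable) in E(ε_t|F_{t−1})=0; with F_t generated only by (x_s,ε_s), s≤t, the claim fails, e.g. for iid data with x_{t2}=ε_t. *)

theory Defs
  imports "HOL-Probability.Probability"
begin

definition stack :: "real^'k \<Rightarrow> real^'k \<Rightarrow> real^('k + 'k)" where
  "stack b d = (\<chi> s. case s of Inl i \<Rightarrow> b $ i | Inr i \<Rightarrow> d $ i)"

definition outer_square :: "real^'n \<Rightarrow> real^'n^'n" where
  "outer_square v = (\<chi> i l. v $ i * v $ l)"

text \<open>Positive definiteness of the principal submatrix of \<open>A\<close> with index set \<open>S\<close>
  (vacuous for \<open>S = {}\<close>).\<close>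

definition pos_def_block :: "'n set \<Rightarrow> real^'n^'n \<Rightarrow> bool" where
  "pos_def_block S A \<longleftrightarrow>
     (\<forall>i\<in>S. \<forall>l\<in>S. A $ i $ l = A $ l $ i) \<and>
     (\<forall>v. v \<noteq> 0 \<and> (\<forall>i. i \<notin> S \<longrightarrow> v $ i = 0) \<longrightarrow> 0 < v \<bullet> (A *v v))"

abbreviation pos_def :: "real^'n^'n \<Rightarrow> bool" where
  "pos_def \<equiv> pos_def_block UNIV"

definition strictly_stationary ::
  "'w measure \<Rightarrow> (int \<Rightarrow> 'w \<Rightarrow> 'b::topological_space) \<Rightarrow> bool" where
  "strictly_stationary P Z \<longleftrightarrow>
     (\<forall>h. distr P (PiM UNIV (\<lambda>_. borel)) (\<lambda>\<omega> t. Z (t + h) \<omega>) =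
          distr P (PiM UNIV (\<lambda>_. borel)) (\<lambda>\<omega> t. Z t \<omega>))"

definition ergodic_process ::
  "'w measure \<Rightarrow> (int \<Rightarrow> 'w \<Rightarrow> 'b::topological_space) \<Rightarrow> bool" where
  "ergodic_process P Z \<longleftrightarrow>
     (\<forall>A \<in> sets (PiM UNIV (\<lambda>_. borel)).
        (\<lambda>p t. p (t + 1)) -` A = A \<longrightarrow>
        measure P {\<omega> \<in> space P. (\<lambda>t. Z t \<omega>) \<in> A} \<in> {0, 1})"

definition sigma_of ::
  "'w measure \<Rightarrow> (int \<Rightarrow> 'w \<Rightarrow> 'b::topological_space) \<Rightarrow> int set \<Rightarrow> 'w measure" where
  "sigma_of P Z I = sigma (space P) {Z s -` A \<inter> space P | s A. s \<in> I \<and> A \<in> sets borel}"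

definition correlation :: "'w measure \<Rightarrow> ('w \<Rightarrow> real) \<Rightarrow> ('w \<Rightarrow> real) \<Rightarrow> real" where
  "correlation P f g =
     (let \<mu> = integral\<^sup>L P f; \<nu> = integral\<^sup>L P g in
        (\<integral>\<omega>. (f \<omega> - \<mu>) * (g \<omega> - \<nu>) \<partial>P) /
        sqrt ((\<integral>\<omega>. (f \<omega> - \<mu>)\<^sup>2 \<partial>P) * (\<integral>\<omega>. (g \<omega> - \<nu>)\<^sup>2 \<partial>P)))"

text \<open>Degenerate
  \<open>f\<close> or \<open>g\<close> contribute \<open>0\<close>, since division by zero yields \<open>0\<close>; so the set is nonempty,
  and by Cauchy-Schwarz it is bounded by \<open>1\<close>.\<close>

definition rho_mixing ::
  "'w measure \<Rightarrow> (int \<Rightarrow> 'w \<Rightarrow> 'b::topological_space) \<Rightarrow> nat \<Rightarrow> real" where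
  "rho_mixing P Z m =
     Sup {\<bar>correlation P f g\<bar> | t f g.
            f \<in> borel_measurable (sigma_of P Z {..t}) \<and> integrable P (\<lambda>\<omega>. (f \<omega>)\<^sup>2) \<and>
            g \<in> borel_measurable (sigma_of P Z {t + int m..}) \<and> integrable P (\<lambda>\<omega>. (g \<omega>)\<^sup>2)}"

text \<open>\<open>m\<close> is a version of \<open>r \<mapsto> E(X | q = r)\<close>, i.e. \<open>E(X | q) = m(q)\<close> almost surely.\<close>

definition cond_exp_given ::
  "'w measure \<Rightarrow> ('w \<Rightarrow> real) \<Rightarrow> ('w \<Rightarrow> real) \<Rightarrow> (real \<Rightarrow> real) \<Rightarrow> bool" where
  "cond_exp_given P q X m \<longleftrightarrow>
     m \<in> borel_measurable borel \<and>
     (AE \<omega> in P. real_cond_exp P (vimage_algebra (space P) q borel) X \<omega> = m (q \<omega>))"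

definition cond_exp_given_mat ::
  "'w measure \<Rightarrow> ('w \<Rightarrow> real) \<Rightarrow> ('w \<Rightarrow> real^'n^'m) \<Rightarrow> (real \<Rightarrow> real^'n^'m) \<Rightarrow> bool" where
  "cond_exp_given_mat P q X m \<longleftrightarrow>
     (\<forall>i l. cond_exp_given P q (\<lambda>\<omega>. X \<omega> $ i $ l) (\<lambda>r. m r $ i $ l))"

definition rv_support :: "'w measure \<Rightarrow> ('w \<Rightarrow> real) \<Rightarrow> real set" where
  "rv_support P q = {r. \<forall>U. open U \<and> r \<in> U \<longrightarrow> 0 < measure P (q -` U \<inter> space P)}"

definition bounded_in_prob ::
  "'w measure \<Rightarrow> (nat \<Rightarrow> 'w \<Rightarrow> 'b::real_normed_vector) \<Rightarrow> (nat \<Rightarrow> real) \<Rightarrow> bool" where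
  "bounded_in_prob P X r \<longleftrightarrow>
     (\<forall>e>0. \<exists>K. \<forall>\<^sub>F n in sequentially.
        measure P {\<omega> \<in> space P. norm (X n \<omega>) > K * r n} < e)"

text \<open>
  The regressor is \<open>x\<^sub>t :: real^'k\<close>. Two distinct coordinates are distinguished: \<open>c\<close> carries the
  constant \<open>1\<close>, and \<open>j\<close> carries the threshold variable \<open>q\<^sub>t = x\<^sub>t $ j\<close>. The
  coordinates outside \<open>{c, j}\<close> form \<open>x\<^sub>t\<^sub>2\<close>, which may be empty (\<open>CARD('k) = 2\<close>).
  Likewise \<open>\<delta> $ c\<close>, \<open>\<delta> $ i\<close> for \<open>i \<notin> {c, j}\<close>, and \<open>\<delta> $ j\<close> are \<open>\<delta>\<^sub>1\<close>, \<open>\<delta>\<^sub>2\<close> and \<open>\<delta>\<^sub>3\<close>.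
\<close>

definition thr_regressor :: "'k \<Rightarrow> real^'k \<Rightarrow> real \<Rightarrow> real^('k + 'k)" where
  "thr_regressor j x \<gamma> = stack x (of_bool (x $ j > \<gamma>) *\<^sub>R x)"

definition threshold_model ::
  "'w measure \<Rightarrow> 'k \<Rightarrow> 'k \<Rightarrow> (int \<Rightarrow> 'w \<Rightarrow> real) \<Rightarrow> (int \<Rightarrow> 'w \<Rightarrow> real^'k) \<Rightarrow> (int \<Rightarrow> 'w \<Rightarrow> real) \<Rightarrow>
    real^'k \<Rightarrow> real^'k \<Rightarrow> real \<Rightarrow> bool" where
  "threshold_model P c j y x \<epsilon> \<beta>\<^sub>0 \<delta>\<^sub>0 \<gamma>\<^sub>0 \<longleftrightarrow>
     c \<noteq> j \<and>
     (\<forall>t. x t \<in> borel_measurable P \<and> \<epsilon> t \<in> borel_measurable P) \<and>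
     (\<forall>t. \<forall>\<omega>\<in>space P. x t \<omega> $ c = 1 \<and>
        y t \<omega> = \<beta>\<^sub>0 \<bullet> x t \<omega> + (\<delta>\<^sub>0 \<bullet> x t \<omega>) * of_bool (x t \<omega> $ j > \<gamma>\<^sub>0) + \<epsilon> t \<omega>)"

definition ls_criterion ::
  "'k \<Rightarrow> (int \<Rightarrow> 'w \<Rightarrow> real) \<Rightarrow> (int \<Rightarrow> 'w \<Rightarrow> real^'k) \<Rightarrow> nat \<Rightarrow> 'w \<Rightarrow> (real^('k + 'k)) \<times> real \<Rightarrow> real" where
  "ls_criterion j y x n \<omega> = (\<lambda>(\<alpha>, \<gamma>).
     (1 / real n) * (\<Sum>t\<in>{1..int n}. (y t \<omega> - \<alpha> \<bullet> thr_regressor j (x t \<omega>) \<gamma>)\<^sup>2))"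

definition assumption_C :: "'k \<Rightarrow> 'k \<Rightarrow> real^'k \<Rightarrow> real \<Rightarrow> bool" where
  "assumption_C c j \<delta>\<^sub>0 \<gamma>\<^sub>0 \<longleftrightarrow>
     \<delta>\<^sub>0 $ j \<noteq> 0 \<and> \<delta>\<^sub>0 $ c + \<delta>\<^sub>0 $ j * \<gamma>\<^sub>0 = 0 \<and> (\<forall>i. i \<notin> {c, j} \<longrightarrow> \<delta>\<^sub>0 $ i = 0)"

text \<open>
  The filtration must make \<open>x\<^sub>t\<close> known at time \<open>t - 1\<close> (predetermined regressors); for a filtration
  generated by \<open>(x\<^sub>s, \<epsilon>\<^sub>s)\<close>, \<open>s \<le> t\<close>, alone the martingale difference property would not even imply
  \<open>E(x\<^sub>t \<epsilon>\<^sub>t) = 0\<close>. By the tower property the condition below holds for some such \<open>F\<close> iff it holds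
  for \<open>F\<^sub>t = \<sigma>(x\<^sub>s, s \<le> t + 1; \<epsilon>\<^sub>s, s \<le> t)\<close>. Moments are taken at time \<open>0\<close>, which is
  immaterial by stationarity.
\<close>

definition assumption_Z ::
  "'w measure \<Rightarrow> (int \<Rightarrow> 'w measure) \<Rightarrow> 'k \<Rightarrow> (int \<Rightarrow> 'w \<Rightarrow> real^'k) \<Rightarrow> (int \<Rightarrow> 'w \<Rightarrow> real) \<Rightarrow> real \<Rightarrow> bool" where
  "assumption_Z P F j x \<epsilon> \<gamma>\<^sub>0 \<longleftrightarrow>
     (let Z = (\<lambda>t \<omega>. (x t \<omega>, \<epsilon> t \<omega>)); X = (\<lambda>\<omega>. thr_regressor j (x 0 \<omega>) \<gamma>\<^sub>0) in
        strictly_stationary P Z \<and> ergodic_process P Z \<and>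
        summable (\<lambda>m. sqrt (rho_mixing P Z (Suc m))) \<and>
        filtration (space P) F \<and>
        (\<forall>t. subalgebra P (F t) \<and> \<epsilon> t \<in> borel_measurable (F t) \<and> x t \<in> borel_measurable (F (t - 1))) \<and>
        (\<forall>t. AE \<omega> in P. real_cond_exp P (F (t - 1)) (\<epsilon> t) \<omega> = 0) \<and>
        pos_def (\<integral>\<omega>. outer_square (X \<omega>) \<partial>P) \<and>
        pos_def (\<integral>\<omega>. (\<epsilon> 0 \<omega>)\<^sup>2 *\<^sub>R outer_square (X \<omega>) \<partial>P) \<and>
        integrable P (\<lambda>\<omega>. norm (x 0 \<omega>) ^ 4) \<and>
        integrable P (\<lambda>\<omega>. norm (\<epsilon> 0 \<omega> *\<^sub>R x 0 \<omega>) ^ 4) \<and>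
        (\<exists>\<eta>>0. integrable P (\<lambda>\<omega>. \<bar>\<epsilon> 0 \<omega>\<bar> powr (4 + \<eta>))))"

text \<open>
  \<open>f\<close> is the density of \<open>q\<^sub>t\<close>, and \<open>D\<close>, \<open>V\<close>, \<open>m\<^sub>4\<close>, \<open>w\<^sub>4\<close> are versions of the
  conditional expectations given \<open>q\<^sub>t = \<gamma>\<close> of \<open>x\<^sub>t x\<^sub>t'\<close>, \<open>x\<^sub>t x\<^sub>t' \<epsilon>\<^sub>t\<^sup>2\<close>, \<open>\<bar>x\<^sub>t\<bar>\<^sup>4\<close> and
  \<open>\<bar>x\<^sub>t \<epsilon>\<^sub>t\<bar>\<^sup>4\<close>. The conditional second moment of \<open>x\<^sub>t\<^sub>2\<close> is the block of \<open>D\<close> with indices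
  outside \<open>{c, j}\<close>.
\<close>

definition assumption_Q ::
  "'w measure \<Rightarrow> 'k \<Rightarrow> 'k \<Rightarrow> (int \<Rightarrow> 'w \<Rightarrow> real^'k) \<Rightarrow> (int \<Rightarrow> 'w \<Rightarrow> real) \<Rightarrow> real \<Rightarrow> real set \<Rightarrow>
    (real \<Rightarrow> real) \<Rightarrow> (real \<Rightarrow> real^'k^'k) \<Rightarrow> (real \<Rightarrow> real^'k^'k) \<Rightarrow> (real \<Rightarrow> real) \<Rightarrow> (real \<Rightarrow> real) \<Rightarrow> bool" where
  "assumption_Q P c j x \<epsilon> \<gamma>\<^sub>0 \<Gamma> f D V m\<^sub>4 w\<^sub>4 \<longleftrightarrow>
     (let q = (\<lambda>\<omega>. x 0 \<omega> $ j);
          L = (\<lambda>\<gamma>. \<integral>\<omega>. of_bool (q \<omega> \<le> \<gamma>) *\<^sub>R outer_square (x 0 \<omega>) \<partial>P) in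
        (\<forall>r. 0 \<le> f r) \<and> distributed P lborel q (\<lambda>r. ennreal (f r)) \<and>
        cond_exp_given_mat P q (\<lambda>\<omega>. outer_square (x 0 \<omega>)) D \<and>
        cond_exp_given_mat P q (\<lambda>\<omega>. (\<epsilon> 0 \<omega>)\<^sup>2 *\<^sub>R outer_square (x 0 \<omega>)) V \<and>
        cond_exp_given P q (\<lambda>\<omega>. norm (x 0 \<omega>) ^ 4) m\<^sub>4 \<and>
        cond_exp_given P q (\<lambda>\<omega>. norm (\<epsilon> 0 \<omega> *\<^sub>R x 0 \<omega>) ^ 4) w\<^sub>4 \<and>
        isCont f \<gamma>\<^sub>0 \<and> isCont V \<gamma>\<^sub>0 \<and> isCont D \<gamma>\<^sub>0 \<and>
        (\<forall>\<gamma>\<in>\<Gamma>. 0 < f \<gamma> \<and> pos_def (L \<gamma>) \<and> pos_def_block (- {c, j}) (D \<gamma>)) \<and>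
        continuous_on \<Gamma> f \<and> continuous_on \<Gamma> L \<and>
        (\<forall>i\<in>- {c, j}. \<forall>l\<in>- {c, j}. continuous_on \<Gamma> (\<lambda>\<gamma>. D \<gamma> $ i $ l)) \<and>
        (\<exists>C. \<forall>\<gamma>\<in>\<Gamma>. f \<gamma> \<le> C \<and> m\<^sub>4 \<gamma> \<le> C \<and> w\<^sub>4 \<gamma> \<le> C))"

end

theory Submission
  imports Defs
begin

text \<open>
  Let \<open>h\<^sub>t\<close> be the fitted minus the true regression function at observation \<open>t\<close>. As the fit minimizes the sum
  of squares, \<open>\<Sum> h\<^sub>t\<^sup>2 \<le> 2 \<Sum> \<epsilon>\<^sub>t h\<^sub>t\<close> (\<open>basic_inequality\<close>): the signal is at most twice the noise. Both
  sides are computed in terms of \<open>s = |\<gamma> - \<gamma>\<^sub>0|\<close> and of the errors \<open>p\<close>, \<open>r\<close> of the coefficient vectors in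
  the two regimes. Away from the band between \<open>\<gamma>\<^sub>0\<close> and \<open>\<gamma>\<close> one has \<open>h = p \<bullet> x\<close> or \<open>h = r \<bullet> x\<close>. On the
  band, the kink restriction turns the regime change \<open>\<delta>\<^sub>0 \<bullet> x\<close> into \<open>\<delta>\<^sub>3\<^sub>0 (q - \<gamma>\<^sub>0)\<close>, so that
  \<open>h = p \<bullet> x - \<tau> (q - \<gamma>\<^sub>0)\<close> with \<open>\<tau> = \<plusminus>\<delta>\<^sub>3\<^sub>0\<close>.

  The signal is therefore of order \<open>n (|p|\<^sup>2 + |r|\<^sup>2 + s\<^sup>3)\<close>: the band holds about \<open>n s\<close> observations, and
  the error on it is of size \<open>s\<close> only, since the true function does not jump. The noise is of order
  \<open>\<surd>n (|p| + |r|) + \<surd>(n s\<^sup>3)\<close>. Balancing the two gives \<open>|p|, |r| = O(n\<^sup>-\<^sup>1\<^sup>/\<^sup>2)\<close> and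
  \<open>n s\<^sup>3 = O(1)\<close>, that is \<open>s = O(n\<^sup>-\<^sup>1\<^sup>/\<^sup>3)\<close> (\<open>regular_near\<close>). Only the threshold has to be located
  roughly before this argument applies, and \<open>regular_not_far\<close> does so by comparing signal and noise on one
  fixed band.

  The probabilistic work is to make the two orders of magnitude uniform in \<open>\<gamma>\<close>. Since the observations are
  dependent, the noise over a growing band is no martingale in the band width, and its supremum is
  bounded by chaining (\<open>chaining\<close>). The input is a fourth moment bound for sums of martingale differences
  (\<open>martingale_fourth_moment\<close>) whose sums of squares stay close to their means thanks to mixing
  (\<open>variance_sum_le\<close>). Applied on all dyadic scales above \<open>n\<^sup>-\<^sup>1\<^sup>/\<^sup>3\<close>, it shows that the noise of
  the kink term is a small fraction of the signal simultaneously for all \<open>s\<close> (\<open>noise_kink_peeling\<close>,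
  \<open>band_occupation\<close>).
\<close>

section \<open>Events of high probability\<close>

text \<open>Outer probability: the exceptional set \<open>B\<close> is a measurable superset of the failures of \<open>\<Phi>\<close>, so
  that \<open>\<Phi>\<close> may involve suprema over uncountably many thresholds.\<close>

definition likely :: "'w measure \<Rightarrow> real \<Rightarrow> ('w \<Rightarrow> bool) \<Rightarrow> bool" where
  "likely M e \<Phi> \<longleftrightarrow> (\<exists>B\<in>sets M. measure M B \<le> e \<and> (\<forall>\<omega>\<in>space M - B. \<Phi> \<omega>))"

lemma likely_mono:
  assumes "likely M e \<Phi>" "e \<le> e'" "\<And>\<omega>. \<omega> \<in> space M \<Longrightarrow> \<Phi> \<omega> \<Longrightarrow> \<Psi> \<omega>"
  shows "likely M e' \<Psi>"
  using assms unfolding likely_def by (meson DiffD1 order.trans)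

lemma (in prob_space) likely_ball:
  assumes "finite I" "\<And>i. i \<in> I \<Longrightarrow> likely M (e i) (\<Phi> i)"
  shows "likely M (\<Sum>i\<in>I. e i) (\<lambda>\<omega>. \<forall>i\<in>I. \<Phi> i \<omega>)"
proof -
  from assms(2) have "\<forall>i\<in>I. \<exists>B. B \<in> sets M \<and> measure M B \<le> e i \<and> (\<forall>\<omega>\<in>space M - B. \<Phi> i \<omega>)"
    unfolding likely_def by blast
  then obtain B where B: "\<And>i. i \<in> I \<Longrightarrow> B i \<in> sets M" "\<And>i. i \<in> I \<Longrightarrow> measure M (B i) \<le> e i"
     "\<And>i \<omega>. i \<in> I \<Longrightarrow> \<omega> \<in> space M - B i \<Longrightarrow> \<Phi> i \<omega>"
    by metis
  have "measure M (\<Union>i\<in>I. B i) \<le> (\<Sum>i\<in>I. measure M (B i))"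
    by (rule finite_measure_subadditive_finite) (use assms B in auto)
  also have "\<dots> \<le> (\<Sum>i\<in>I. e i)"
    by (rule sum_mono) (use B in auto)
  finally show ?thesis
    unfolding likely_def using B assms(1) by (intro bexI[of _ "\<Union>i\<in>I. B i"]) auto
qed

lemma (in prob_space) likely_conj:
  assumes "likely M e \<Phi>" "likely M e' \<Psi>"
  shows "likely M (e + e') (\<lambda>\<omega>. \<Phi> \<omega> \<and> \<Psi> \<omega>)"
  using likely_ball[of "{0, 1 :: nat}" "\<lambda>b. if b = 0 then e else e'" "\<lambda>b. if b = 0 then \<Phi> else \<Psi>"] assms
  by simp

lemma (in prob_space) likely_markov:
  fixes Y :: "'a \<Rightarrow> real"
  assumes "integrable M Y" "\<And>\<omega>. 0 \<le> Y \<omega>" "expectation Y \<le> m" "0 < a"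
  shows "likely M (m / a) (\<lambda>\<omega>. Y \<omega> < a)"
proof -
  have [measurable]: "Y \<in> borel_measurable M" using assms by auto
  have "prob {\<omega>\<in>space M. Y \<omega> \<ge> a} \<le> expectation Y / a"
    by (rule integral_Markov_inequality_measure[of M Y "{}"]) (use assms in auto)
  also have "\<dots> \<le> m / a" using assms by (simp add: divide_right_mono)
  finally show ?thesis
    unfolding likely_def by (intro bexI[of _ "{\<omega>\<in>space M. Y \<omega> \<ge> a}"]) auto
qed

lemma (in prob_space) prob_le_of_likely:
  assumes "likely M e \<Phi>" "\<And>\<omega>. \<omega> \<in> space M \<Longrightarrow> \<Phi> \<omega> \<Longrightarrow> \<not> \<Psi> \<omega>"
  shows "measure M {\<omega>\<in>space M. \<Psi> \<omega>} \<le> e"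
proof -
  obtain B where B: "B \<in> sets M" "measure M B \<le> e" "\<forall>\<omega>\<in>space M - B. \<Phi> \<omega>"
    using assms(1) unfolding likely_def by blast
  have "measure M {\<omega>\<in>space M. \<Psi> \<omega>} \<le> measure M B"
    by (rule finite_measure_mono) (use B assms(2) in auto)
  then show ?thesis using B by simp
qed

section \<open>Moment inequalities\<close>

lemma Cauchy_Schwarz_integral:
  fixes f g :: "'a \<Rightarrow> real"
  assumes "integrable M (\<lambda>x. (f x)\<^sup>2)" "integrable M (\<lambda>x. (g x)\<^sup>2)" "integrable M (\<lambda>x. f x * g x)"
    and [measurable]: "g \<in> borel_measurable M"
  shows "\<bar>\<integral>x. f x * g x \<partial>M\<bar> \<le> sqrt ((\<integral>x. (f x)\<^sup>2 \<partial>M) * (\<integral>x. (g x)\<^sup>2 \<partial>M))"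
proof (cases "(\<integral>x. (g x)\<^sup>2 \<partial>M) = 0")
  case True
  then have "AE x in M. (g x)\<^sup>2 = 0"
    by (simp add: integral_nonneg_eq_0_iff_AE[OF assms(2)])
  then have "AE x in M. f x * g x = 0" by auto
  then have "(\<integral>x. f x * g x \<partial>M) = 0" by (rule integral_eq_zero_AE)
  then show ?thesis using True by simp
next
  case False
  define G where "G = (\<integral>x. (g x)\<^sup>2 \<partial>M)"
  define C where "C = (\<integral>x. f x * g x \<partial>M)"
  have G: "G > 0" using False by (simp add: G_def less_le)
  have "0 \<le> (\<integral>x. (f x - C / G * g x)\<^sup>2 \<partial>M)" by simp
  also have "\<dots> = (\<integral>x. (f x)\<^sup>2 - 2 * (C / G) * (f x * g x) + (C / G)\<^sup>2 * (g x)\<^sup>2 \<partial>M)"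
    by (rule Bochner_Integration.integral_cong) (auto simp: power2_eq_square algebra_simps)
  also have "\<dots> = (\<integral>x. (f x)\<^sup>2 \<partial>M) - 2 * (C / G) * C + (C / G)\<^sup>2 * G"
    using assms by (simp add: C_def G_def)
  also have "\<dots> = (\<integral>x. (f x)\<^sup>2 \<partial>M) - C\<^sup>2 / G"
    using G by (simp add: field_simps power2_eq_square)
  finally have "C\<^sup>2 \<le> (\<integral>x. (f x)\<^sup>2 \<partial>M) * G" using G by (simp add: field_simps)
  then show ?thesis unfolding C_def[symmetric] G_def[symmetric]
    using real_le_rsqrt by force
qed

subsection \<open>Fourth moments of martingales\<close>

text \<open>The bracket is \<open>24 e\<^sub>4(d)\<close>, with \<open>e\<^sub>4\<close> the elementary symmetric polynomial, written through power sums
  by Newton's identities. The cross terms \<open>8 S C\<close> and \<open>10 S\<^sup>2 Q\<close> are absorbed by two completions of the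
  square, the second of which costs half of \<open>S\<^sup>4\<close>.\<close>

lemma fourth_power_le_square:
  fixes d :: "nat \<Rightarrow> real"
  defines "S \<equiv> \<lambda>n. \<Sum>i<n. d i" and "Q \<equiv> \<lambda>n. \<Sum>i<n. d i ^ 2"
    and "C \<equiv> \<lambda>n. \<Sum>i<n. d i ^ 3" and "R \<equiv> \<lambda>n. \<Sum>i<n. d i ^ 4"
  shows "S n ^ 4 \<le> 2 * (S n ^ 4 - 6 * S n ^ 2 * Q n + 8 * S n * C n + 3 * Q n ^ 2 - 6 * R n)
           + 114 * Q n ^ 2"
proof -
  have Q0: "0 \<le> Q n" unfolding Q_def by (simp add: sum_nonneg)
  have RQ: "R n \<le> Q n ^ 2"
  proof -
    have "R n = (\<Sum>i<n. d i ^ 2 * d i ^ 2)" unfolding R_def by (simp flip: power_add)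
    also have "\<dots> \<le> (\<Sum>i<n. d i ^ 2 * Q n)"
      by (intro sum_mono mult_left_mono) (auto simp: Q_def intro!: member_le_sum)
    also have "\<dots> = Q n ^ 2" by (simp add: Q_def power2_eq_square sum_distrib_right)
    finally show ?thesis .
  qed
  have "- (8 * S n * C n) = (\<Sum>i<n. - 8 * (d i ^ 2 * (S n * d i)))"
    unfolding C_def by (simp add: sum_distrib_left power2_eq_square power3_eq_cube mult_ac sum_negf)
  also have "\<dots> \<le> (\<Sum>i<n. 4 * (d i ^ 2 * (S n ^ 2 + d i ^ 2)))"
  proof (rule sum_mono)
    fix i
    have "0 \<le> d i ^ 2 * (S n + d i) ^ 2" by simp
    then show "- 8 * (d i ^ 2 * (S n * d i)) \<le> 4 * (d i ^ 2 * (S n ^ 2 + d i ^ 2))"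
      by (simp add: power2_eq_square algebra_simps)
  qed
  also have "\<dots> = 4 * S n ^ 2 * Q n + 4 * R n"
    unfolding Q_def R_def
    by (simp add: sum_distrib_left sum.distrib algebra_simps flip: power_add)
  finally have *: "- (8 * S n * C n) \<le> 4 * S n ^ 2 * Q n + 4 * R n" .
  have "0 \<le> (S n ^ 2 - 10 * Q n) ^ 2" by simp
  then have "20 * (S n ^ 2 * Q n) \<le> S n ^ 4 + 100 * Q n ^ 2"
    by (simp add: power2_diff algebra_simps flip: power_mult)
  with * RQ show ?thesis by (simp add: algebra_simps)
qed

text \<open>A Burkholder inequality for exponent 4, with no maximal function: each monomial of \<open>e\<^sub>4\<close> is a product
  of distinct increments and has mean zero, as conditioning on the past of the latest one shows. So the
  polynomial inequality above survives integration with its \<open>e\<^sub>4\<close> term dropped.\<close>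

lemma (in prob_space) martingale_fourth_moment:
  fixes d :: "nat \<Rightarrow> 'a \<Rightarrow> real" and G :: "nat \<Rightarrow> 'a measure"
  assumes sub: "\<And>i. subalgebra M (G i)" and mono: "\<And>i j. i \<le> j \<Longrightarrow> sets (G i) \<subseteq> sets (G j)"
    and adapted: "\<And>i. d i \<in> borel_measurable (G (Suc i))"
    and mds: "\<And>i. AE \<omega> in M. real_cond_exp M (G i) (d i) \<omega> = 0"
    and int: "\<And>i. integrable M (\<lambda>\<omega>. d i \<omega> ^ 4)"
  shows "integrable M (\<lambda>\<omega>. (\<Sum>i<n. d i \<omega>) ^ 4)"
    and "integrable M (\<lambda>\<omega>. (\<Sum>i<n. d i \<omega> ^ 2) ^ 2)"
    and "expectation (\<lambda>\<omega>. (\<Sum>i<n. d i \<omega>) ^ 4) \<le> 114 * expectation (\<lambda>\<omega>. (\<Sum>i<n. d i \<omega> ^ 2) ^ 2)"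
proof -
  have meas[measurable]: "d i \<in> borel_measurable M" for i
    using measurable_from_subalg[OF sub adapted] .
  define S where "S n \<omega> = (\<Sum>i<n. d i \<omega>)" for n \<omega>
  define Q where "Q n \<omega> = (\<Sum>i<n. d i \<omega> ^ 2)" for n \<omega>
  define C where "C n \<omega> = (\<Sum>i<n. d i \<omega> ^ 3)" for n \<omega>
  define R where "R n \<omega> = (\<Sum>i<n. d i \<omega> ^ 4)" for n \<omega>
  define U where "U n \<omega> = (\<Sum>i<n. \<bar>d i \<omega>\<bar>)" for n \<omega>
  note [measurable] = S_def[abs_def] Q_def[abs_def] C_def[abs_def] R_def[abs_def] U_def[abs_def]
  have mS[measurable]: "S n \<in> borel_measurable M" "Q n \<in> borel_measurable M" "C n \<in> borel_measurable M"
    "R n \<in> borel_measurable M" "U n \<in> borel_measurable M" for n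
    unfolding S_def Q_def C_def R_def U_def by measurable
  have U0: "0 \<le> U n \<omega>" for n \<omega> unfolding U_def by (simp add: sum_nonneg)
  \<comment> \<open>\<open>U\<^sup>4\<close> dominates every monomial of degree 4 in the increments, which settles
    integrability throughout.\<close>
  have U_int: "integrable M (\<lambda>\<omega>. U n \<omega> ^ 4)" for n
  proof (rule Bochner_Integration.integrable_bound)
    show "integrable M (\<lambda>\<omega>. real n ^ 3 * R n \<omega>)" unfolding R_def using int by auto
    show "AE x in M. norm (U n x ^ 4) \<le> norm (real n ^ 3 * R n x)"
    proof (rule AE_I2)
      fix x
      have "U n x ^ 4 = ((\<Sum>i<n. \<bar>d i x\<bar>)\<^sup>2)\<^sup>2" unfolding U_def by simp
      also have "\<dots> \<le> (real n * (\<Sum>i<n. \<bar>d i x\<bar>\<^sup>2))\<^sup>2"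
        using sum_squared_le_sum_of_squares[of "\<lambda>i. \<bar>d i x\<bar>" "{..<n}"]
        by (intro power_mono) (auto simp: mult.commute)
      also have "\<dots> = real n ^ 2 * (\<Sum>i<n. \<bar>d i x\<bar>\<^sup>2)\<^sup>2" by (simp add: power_mult_distrib)
      also have "\<dots> \<le> real n ^ 2 * (real n * (\<Sum>i<n. (\<bar>d i x\<bar>\<^sup>2)\<^sup>2))"
        using sum_squared_le_sum_of_squares[of "\<lambda>i. \<bar>d i x\<bar>\<^sup>2" "{..<n}"]
        by (intro mult_left_mono) (auto simp: mult.commute)
      also have "\<dots> = real n ^ 3 * R n x" unfolding R_def by (simp add: power3_eq_cube power2_eq_square mult_ac power4_eq_xxxx)
      finally show "norm (U n x ^ 4) \<le> norm (real n ^ 3 * R n x)"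
        by (simp add: R_def sum_nonneg)
    qed
  qed measurable
  have SU: "\<bar>S n \<omega>\<bar> \<le> U n \<omega>" for n \<omega> unfolding S_def U_def by (rule sum_abs)
  have dU: "i < n \<Longrightarrow> \<bar>d i \<omega>\<bar> \<le> U n \<omega>" for i n \<omega>
    unfolding U_def by (intro member_le_sum[where f="\<lambda>i. \<bar>d i \<omega>\<bar>"]) auto
  have QU: "\<bar>Q n \<omega>\<bar> \<le> U n \<omega> ^ 2" for n \<omega>
  proof -
    have "\<bar>Q n \<omega>\<bar> = (\<Sum>i<n. \<bar>d i \<omega>\<bar> * \<bar>d i \<omega>\<bar>)" unfolding Q_def by (simp add: sum_nonneg power2_eq_square)
    also have "\<dots> \<le> (\<Sum>i<n. \<bar>d i \<omega>\<bar> * U n \<omega>)" by (intro sum_mono mult_left_mono) (auto simp: dU)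
    finally show ?thesis by (simp add: U_def power2_eq_square sum_distrib_right)
  qed
  have CU: "\<bar>C n \<omega>\<bar> \<le> U n \<omega> ^ 3" for n \<omega>
  proof -
    have "\<bar>C n \<omega>\<bar> \<le> (\<Sum>i<n. \<bar>d i \<omega>\<bar> * \<bar>d i \<omega>\<bar>\<^sup>2)" unfolding C_def
      by (rule order_trans[OF sum_abs]) (simp add: power3_eq_cube power2_eq_square abs_mult mult_ac)
    also have "\<dots> \<le> (\<Sum>i<n. \<bar>d i \<omega>\<bar> * (U n \<omega>)\<^sup>2)"
      by (intro sum_mono mult_left_mono power_mono) (auto simp: dU)
    finally show ?thesis by (simp add: U_def power2_eq_square power3_eq_cube sum_distrib_right mult_ac)
  qed
  have RU: "\<bar>R n \<omega>\<bar> \<le> U n \<omega> ^ 4" for n \<omega>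
  proof -
    have "\<bar>R n \<omega>\<bar> = (\<Sum>i<n. \<bar>d i \<omega>\<bar> * \<bar>d i \<omega>\<bar> ^ 3)" unfolding R_def
      by (simp add: sum_nonneg flip: power_Suc)
    also have "\<dots> \<le> (\<Sum>i<n. \<bar>d i \<omega>\<bar> * (U n \<omega>)^3)"
      by (intro sum_mono mult_left_mono power_mono) (auto simp: dU)
    also have "\<dots> = U n \<omega> * U n \<omega> ^ 3" unfolding U_def by (simp add: sum_distrib_right)
    also have "\<dots> = U n \<omega> ^ 4" by (simp flip: power_Suc)
    finally show ?thesis .
  qed
  \<comment> \<open>\<open>E4\<close> and \<open>E3\<close> are 24 times \<open>e\<^sub>4\<close> and 6 times
    \<open>e\<^sub>3\<close> of the first n increments; hence the recursion \<open>step\<close>.\<close>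
  define E4 where "E4 n \<omega> = S n \<omega> ^ 4 - 6 * S n \<omega> ^ 2 * Q n \<omega> + 8 * S n \<omega> * C n \<omega> + 3 * Q n \<omega> ^ 2 - 6 * R n \<omega>" for n \<omega>
  define E3 where "E3 n \<omega> = S n \<omega> ^ 3 - 3 * S n \<omega> * Q n \<omega> + 2 * C n \<omega>" for n \<omega>
  have step: "E4 (Suc n) \<omega> = E4 n \<omega> + 4 * (E3 n \<omega> * d n \<omega>)" for n \<omega>
  proof -
    have *: "S (Suc n) \<omega> = S n \<omega> + d n \<omega>" "Q (Suc n) \<omega> = Q n \<omega> + d n \<omega> ^ 2"
      "C (Suc n) \<omega> = C n \<omega> + d n \<omega> ^ 3" "R (Suc n) \<omega> = R n \<omega> + d n \<omega> ^ 4"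
      by (auto simp: S_def Q_def C_def R_def)
    show ?thesis unfolding E4_def E3_def * by algebra
  qed
  have E3_F: "E3 n \<in> borel_measurable (G n)" for n
  proof -
    have sub': "subalgebra (G n) (G (Suc i))" if "i < n" for i
      using sub[of n] sub[of "Suc i"] mono[of "Suc i" n] that unfolding subalgebra_def by auto
    have [measurable]: "d i \<in> borel_measurable (G n)" if "i < n" for i
      using measurable_from_subalg[OF sub'[OF that] adapted] .
    show ?thesis unfolding E3_def S_def Q_def C_def by (measurable; simp)
  qed
  have E3_d: "\<bar>E3 n \<omega> * d n \<omega>\<bar> \<le> 6 * U (Suc n) \<omega> ^ 4" for n \<omega>
  proof -
    let ?u = "U (Suc n) \<omega>"
    have Un: "U n \<omega> \<le> ?u" by (simp add: U_def)
    have S': "\<bar>S n \<omega>\<bar> \<le> ?u" using SU[of n \<omega>] Un by simp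
    have Q': "\<bar>Q n \<omega>\<bar> \<le> ?u ^ 2" using QU[of n \<omega>] power_mono[OF Un U0, of 2] by simp
    have C': "\<bar>C n \<omega>\<bar> \<le> ?u ^ 3" using CU[of n \<omega>] power_mono[OF Un U0, of 3] by simp
    have d': "\<bar>d n \<omega>\<bar> \<le> ?u" by (rule dU) simp
    have "\<bar>E3 n \<omega>\<bar> \<le> \<bar>S n \<omega> ^ 3\<bar> + 3 * \<bar>S n \<omega> * Q n \<omega>\<bar> + 2 * \<bar>C n \<omega>\<bar>"
      unfolding E3_def mult.assoc by linarith
    also have "\<dots> \<le> ?u ^ 3 + 3 * (?u * ?u ^ 2) + 2 * ?u ^ 3"
      using S' Q' C' U0[of "Suc n" \<omega>]
      by (intro add_mono mult_left_mono) (auto simp: abs_mult power_abs intro!: mult_mono power_mono)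
    also have "\<dots> = 6 * ?u ^ 3" by (simp add: power3_eq_cube power2_eq_square)
    finally have "\<bar>E3 n \<omega>\<bar> \<le> 6 * ?u ^ 3" .
    then have "\<bar>E3 n \<omega>\<bar> * \<bar>d n \<omega>\<bar> \<le> 6 * ?u ^ 3 * ?u"
      using d' by (intro mult_mono) (auto simp: U0)
    also have "\<dots> = 6 * ?u ^ 4" by (simp add: power4_eq_xxxx power3_eq_cube)
    finally show ?thesis by (simp add: abs_mult)
  qed
  have E3_meas[measurable]: "E3 n \<in> borel_measurable M" for n unfolding E3_def by measurable
  have int_step: "integrable M (\<lambda>\<omega>. E3 n \<omega> * d n \<omega>)" for n
    by (rule Bochner_Integration.integrable_bound[of M "\<lambda>\<omega>. 6 * U (Suc n) \<omega> ^ 4"])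
       (use U_int E3_d in \<open>auto intro!: AE_I2\<close>)
  have zero_step: "expectation (\<lambda>\<omega>. E3 n \<omega> * d n \<omega>) = 0" for n
  proof -
    interpret finite_measure_subalgebra M "G n" by unfold_locales (rule sub)
    have "expectation (\<lambda>\<omega>. E3 n \<omega> * d n \<omega>) = expectation (\<lambda>\<omega>. E3 n \<omega> * real_cond_exp M (G n) (d n) \<omega>)"
      by (rule real_cond_exp_intg(2)[symmetric]) (use int_step E3_F in auto)
    also have "\<dots> = expectation (\<lambda>\<omega>. 0)"
      by (rule integral_cong_AE) (use mds[of n] in auto)
    finally show ?thesis by simp
  qed
  have E4: "integrable M (E4 n) \<and> expectation (E4 n) = 0" for n
  proof (induction n)
    case 0
    then show ?case unfolding E4_def S_def Q_def C_def R_def by simp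
  next
    case (Suc n)
    have "E4 (Suc n) = (\<lambda>\<omega>. E4 n \<omega> + 4 * (E3 n \<omega> * d n \<omega>))" using step by auto
    then show ?case using Suc int_step[of n] zero_step[of n] by simp
  qed
  have intS: "integrable M (\<lambda>\<omega>. S n \<omega> ^ 4)"
    by (rule Bochner_Integration.integrable_bound[OF U_int[of n]])
       (use power_mono[OF SU abs_ge_zero, of n _ 4] in \<open>auto intro!: AE_I2\<close>)
  have intQ: "integrable M (\<lambda>\<omega>. Q n \<omega> ^ 2)"
  proof (rule Bochner_Integration.integrable_bound[OF U_int[of n]])
    show "AE x in M. norm ((Q n x)\<^sup>2) \<le> norm (U n x ^ 4)"
      using power_mono[OF QU abs_ge_zero, of n _ 2] by (auto intro!: AE_I2 simp flip: power_mult)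
  qed measurable
  have "expectation (\<lambda>\<omega>. S n \<omega> ^ 4) \<le> expectation (\<lambda>\<omega>. 2 * E4 n \<omega> + 114 * Q n \<omega> ^ 2)"
  proof (rule integral_mono[OF intS])
    show "integrable M (\<lambda>\<omega>. 2 * E4 n \<omega> + 114 * Q n \<omega> ^ 2)" using E4[of n] intQ by simp
    show "S n \<omega> ^ 4 \<le> 2 * E4 n \<omega> + 114 * Q n \<omega> ^ 2" for \<omega>
      unfolding E4_def S_def Q_def C_def R_def by (rule fourth_power_le_square)
  qed
  also have "\<dots> = 114 * expectation (\<lambda>\<omega>. Q n \<omega> ^ 2)"
    using E4[of n] intQ by simp
  finally show "expectation (\<lambda>\<omega>. (\<Sum>i<n. d i \<omega>) ^ 4) \<le> 114 * expectation (\<lambda>\<omega>. (\<Sum>i<n. d i \<omega> ^ 2) ^ 2)"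
    unfolding S_def Q_def .
  show "integrable M (\<lambda>\<omega>. (\<Sum>i<n. d i \<omega>) ^ 4)" "integrable M (\<lambda>\<omega>. (\<Sum>i<n. d i \<omega> ^ 2) ^ 2)"
    using intS intQ unfolding S_def Q_def by auto
qed

section \<open>Stationary mixing samples\<close>

lemma sum_over_window:
  fixes a :: "int \<Rightarrow> 'b::comm_monoid_add"
  shows "(\<Sum>t\<in>{1..int n}. a t) = (\<Sum>i<n. a (int i + 1))"
  by (rule sum.reindex_bij_witness[of _ "\<lambda>i. int i + 1" "\<lambda>t. nat (t - 1)"]) auto

lemma row_sum_le:
  fixes r :: "nat \<Rightarrow> real"
  assumes "summable r" "\<And>m. 0 \<le> r m"
  shows "(\<Sum>j<n. r (nat \<bar>int i - int j\<bar>)) \<le> 2 * suminf r"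
proof -
  let ?f = "\<lambda>j. r (nat \<bar>int i - int j\<bar>)"
  have A: "sum ?f A \<le> suminf r" if "finite A" "inj_on (\<lambda>j. nat \<bar>int i - int j\<bar>) A" for A
  proof -
    have "sum ?f A = sum r ((\<lambda>j. nat \<bar>int i - int j\<bar>) ` A)" using that by (simp add: sum.reindex)
    also have "\<dots> \<le> suminf r" by (rule sum_le_suminf) (use assms that in auto)
    finally show ?thesis .
  qed
  have "sum ?f {..<n} \<le> sum ?f ({..i} \<union> {i<..<n})"
    by (rule sum_mono2) (use assms in auto)
  also have "\<dots> = sum ?f {..i} + sum ?f {i<..<n}" by (rule sum.union_disjoint) auto
  also have "\<dots> \<le> suminf r + suminf r"
    by (intro add_mono A) (auto intro!: inj_onI)
  finally show ?thesis by simp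
qed

lemma integrable_mult_of_squares:
  fixes f g :: "'a \<Rightarrow> real"
  assumes "integrable M (\<lambda>x. (f x)\<^sup>2)" "integrable M (\<lambda>x. (g x)\<^sup>2)"
    and [measurable]: "f \<in> borel_measurable M" "g \<in> borel_measurable M"
  shows "integrable M (\<lambda>x. f x * g x)"
proof (rule Bochner_Integration.integrable_bound)
  show "integrable M (\<lambda>x. (f x)\<^sup>2 + (g x)\<^sup>2)" using assms by auto
  have "\<bar>a * b\<bar> \<le> a\<^sup>2 + b\<^sup>2" for a b :: real
  proof -
    have "2 * (\<bar>a\<bar> * \<bar>b\<bar>) \<le> a\<^sup>2 + b\<^sup>2" using sum_squares_bound[of "\<bar>a\<bar>" "\<bar>b\<bar>"] by (simp add: mult.assoc)
    moreover have "0 \<le> \<bar>a\<bar> * \<bar>b\<bar>" by simp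
    ultimately show ?thesis unfolding abs_mult by linarith
  qed
  then show "AE x in M. norm (f x * g x) \<le> norm ((f x)\<^sup>2 + (g x)\<^sup>2)" by (auto intro!: AE_I2)
qed measurable

lemma (in prob_space) integrable_centered_square:
  fixes f :: "'a \<Rightarrow> real"
  assumes "integrable M (\<lambda>x. (f x)\<^sup>2)" and [measurable]: "f \<in> borel_measurable M"
  shows "integrable M (\<lambda>x. (f x - a)\<^sup>2)"
proof -
  have "integrable M f" by (rule square_integrable_imp_integrable) (use assms in auto)
  then show ?thesis using assms by (simp add: power2_diff)
qed

lemma (in prob_space) centered_square_le:
  fixes f :: "'a \<Rightarrow> real"
  assumes "integrable M (\<lambda>x. (f x)\<^sup>2)" and [measurable]: "f \<in> borel_measurable M"
  shows "expectation (\<lambda>x. (f x - expectation f)\<^sup>2) \<le> expectation (\<lambda>x. (f x)\<^sup>2)"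
proof -
  have "integrable M f" by (rule square_integrable_imp_integrable) (use assms in auto)
  then show ?thesis using assms variance_eq[of f] by simp
qed

lemma (in prob_space) covariance_le:
  fixes f g :: "'a \<Rightarrow> real"
  assumes "integrable M (\<lambda>x. (f x)\<^sup>2)" "integrable M (\<lambda>x. (g x)\<^sup>2)"
    and [measurable]: "f \<in> borel_measurable M" "g \<in> borel_measurable M"
  shows "\<bar>expectation (\<lambda>x. (f x - a) * (g x - b))\<bar>
      \<le> sqrt (expectation (\<lambda>x. (f x - a)\<^sup>2) * expectation (\<lambda>x. (g x - b)\<^sup>2))"
proof -
  note sq = integrable_centered_square[OF assms(1), of a] integrable_centered_square[OF assms(2), of b]
  have "integrable M (\<lambda>x. (f x - a) * (g x - b))"
    by (rule integrable_mult_of_squares) (use sq in auto)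
  then show ?thesis using sq by (intro Cauchy_Schwarz_integral) auto
qed

lemma (in prob_space) correlation_le_1:
  fixes f g :: "'a \<Rightarrow> real"
  assumes "integrable M (\<lambda>x. (f x)\<^sup>2)" "integrable M (\<lambda>x. (g x)\<^sup>2)"
    and "f \<in> borel_measurable M" "g \<in> borel_measurable M"
  shows "\<bar>correlation M f g\<bar> \<le> 1"
proof -
  define A where "A = expectation (\<lambda>x. (f x - expectation f)\<^sup>2)"
  define B where "B = expectation (\<lambda>x. (g x - expectation g)\<^sup>2)"
  define c where "c = expectation (\<lambda>x. (f x - expectation f) * (g x - expectation g))"
  have AB: "0 \<le> A" "0 \<le> B" by (simp_all add: A_def B_def)
  have c: "\<bar>c\<bar> \<le> sqrt (A * B)"
    using covariance_le[OF assms, of "expectation f" "expectation g"] unfolding A_def B_def c_def .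
  have "\<bar>c / sqrt (A * B)\<bar> = \<bar>c\<bar> / sqrt (A * B)" using AB by simp
  also have "\<dots> \<le> 1"
  proof (cases "sqrt (A * B) = 0")
    case False
    then have "0 < sqrt (A * B)" using AB by (simp add: less_le)
    then show ?thesis using c by (simp only: divide_le_eq_1 simp_thms)
  next
    case True
    then show ?thesis by (simp only: div_by_0)
  qed
  finally show ?thesis unfolding correlation_def Let_def A_def B_def c_def .
qed

text \<open>The regressors are known one period ahead of the noise. The filtration condition is indexed by the
  nonnegative times, among which the sample \<open>t = 1, \<dots>, n\<close> lies.\<close>

locale mixing_noise = prob_space P for P :: "'w measure" +
  fixes F :: "int \<Rightarrow> 'w measure" and x :: "int \<Rightarrow> 'w \<Rightarrow> real^'k" and \<epsilon> :: "int \<Rightarrow> 'w \<Rightarrow> real"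
  assumes x_measurable[measurable]: "\<And>t. x t \<in> borel_measurable P"
    and eps_measurable[measurable]: "\<And>t. \<epsilon> t \<in> borel_measurable P"
    and stationary: "strictly_stationary P (\<lambda>t \<omega>. (x t \<omega>, \<epsilon> t \<omega>))"
    and mixing: "summable (\<lambda>m. sqrt (rho_mixing P (\<lambda>t \<omega>. (x t \<omega>, \<epsilon> t \<omega>)) (Suc m)))"
    and filtr: "filtration (space P) (\<lambda>i::nat. F (int i))"
    and sub: "\<And>t. subalgebra P (F t)"
    and eps_adapted: "\<And>t. \<epsilon> t \<in> borel_measurable (F t)"
    and x_predictable: "\<And>t. x t \<in> borel_measurable (F (t - 1))"
    and noise: "\<And>t. AE \<omega> in P. real_cond_exp P (F (t - 1)) (\<epsilon> t) \<omega> = 0"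
begin

abbreviation Z :: "int \<Rightarrow> 'w \<Rightarrow> (real^'k) \<times> real" where
  "Z t \<omega> \<equiv> (x t \<omega>, \<epsilon> t \<omega>)"

abbreviation \<rho> :: "nat \<Rightarrow> real" where "\<rho> \<equiv> rho_mixing P Z"

lemma Z_measurable[measurable]: "Z t \<in> borel_measurable P" by measurable

lemma identically_distributed: "distr P borel (Z t) = distr P borel (Z 0)"
proof -
  let ?\<Pi> = "PiM (UNIV :: int set) (\<lambda>_. borel :: ((real^'k) \<times> real) measure)"
  have meas: "(\<lambda>\<omega> s. Z (s + h) \<omega>) \<in> measurable P ?\<Pi>" for h
    by (rule measurable_PiM_single') (rule Z_measurable, auto simp: PiE_def)
  have proj: "(\<lambda>p. p 0) \<in> measurable ?\<Pi> borel"
    by (rule measurable_component_singleton) simp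
  have "distr P ?\<Pi> (\<lambda>\<omega> s. Z (s + t) \<omega>) = distr P ?\<Pi> (\<lambda>\<omega> s. Z (s + 0) \<omega>)"
    using stationary unfolding strictly_stationary_def by simp
  then have "distr (distr P ?\<Pi> (\<lambda>\<omega> s. Z (s + t) \<omega>)) borel (\<lambda>p. p 0)
     = distr (distr P ?\<Pi> (\<lambda>\<omega> s. Z (s + 0) \<omega>)) borel (\<lambda>p. p 0)" by simp
  then show ?thesis
    unfolding distr_distr[OF proj meas] by (simp add: comp_def)
qed

lemma integral_shift:
  fixes \<phi> :: "(real^'k) \<times> real \<Rightarrow> real"
  assumes "\<phi> \<in> borel_measurable borel"
  shows "(\<integral>\<omega>. \<phi> (Z t \<omega>) \<partial>P) = (\<integral>\<omega>. \<phi> (Z 0 \<omega>) \<partial>P)"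
  using integral_distr[OF Z_measurable[of t] assms] integral_distr[OF Z_measurable[of 0] assms]
  by (simp add: identically_distributed[of t])

lemma integrable_shift:
  fixes \<phi> :: "(real^'k) \<times> real \<Rightarrow> real"
  assumes "\<phi> \<in> borel_measurable borel" "integrable P (\<lambda>\<omega>. \<phi> (Z 0 \<omega>))"
  shows "integrable P (\<lambda>\<omega>. \<phi> (Z t \<omega>))"
  using integrable_distr_eq[OF Z_measurable[of t] assms(1)] integrable_distr_eq[OF Z_measurable[of 0] assms(1)] assms(2)
  by (simp add: identically_distributed[of t])

lemma sigma_of_measurable:
  fixes \<phi> :: "(real^'k) \<times> real \<Rightarrow> real"
  assumes [measurable]: "\<phi> \<in> borel_measurable borel" and "s \<in> I"
  shows "(\<lambda>\<omega>. \<phi> (Z s \<omega>)) \<in> borel_measurable (sigma_of P Z I)"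
proof -
  have sub: "{Z s -` A \<inter> space P | s A. s \<in> I \<and> A \<in> sets borel} \<subseteq> Pow (space P)" by blast
  have sp: "space (sigma_of P Z I) = space P" unfolding sigma_of_def by (simp add: sub)
  have "Z s \<in> measurable (sigma_of P Z I) borel"
  proof (rule measurableI)
    fix A :: "((real^'k) \<times> real) set" assume "A \<in> sets borel"
    then have "Z s -` A \<inter> space P \<in> {Z s -` A \<inter> space P | s A. s \<in> I \<and> A \<in> sets borel}"
      using assms(2) by blast
    then show "Z s -` A \<inter> space (sigma_of P Z I) \<in> sets (sigma_of P Z I)"
      unfolding sp unfolding sigma_of_def sets_measure_of[OF sub] by (rule sigma_sets.Basic)
  qed simp
  then show ?thesis using assms(1) by (rule measurable_compose)
qed

lemma sigma_of_sub: "f \<in> borel_measurable (sigma_of P Z I) \<Longrightarrow> f \<in> borel_measurable P"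
proof (erule measurable_from_subalg[rotated])
  have sub: "{Z s -` A \<inter> space P | s A. s \<in> I \<and> A \<in> sets borel} \<subseteq> Pow (space P)" by blast
  have "{Z s -` A \<inter> space P | s A. s \<in> I \<and> A \<in> sets borel} \<subseteq> sets P"
    using measurable_sets[OF Z_measurable] by blast
  then have "sets (sigma_of P Z I) \<subseteq> sets P"
    unfolding sigma_of_def sets_measure_of[OF sub] by (rule sets.sigma_sets_subset)
  moreover have "space (sigma_of P Z I) = space P" unfolding sigma_of_def by (simp add: sub)
  ultimately show "subalgebra P (sigma_of P Z I)" unfolding subalgebra_def by simp
qed

lemma rho_upper:
  assumes "f \<in> borel_measurable (sigma_of P Z {..t})" "integrable P (\<lambda>\<omega>. (f \<omega>)\<^sup>2)"
    "g \<in> borel_measurable (sigma_of P Z {t + int m..})" "integrable P (\<lambda>\<omega>. (g \<omega>)\<^sup>2)"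
  shows "\<bar>correlation P f g\<bar> \<le> \<rho> m"
  unfolding rho_mixing_def
proof (rule cSup_upper)
  show "bdd_above {\<bar>correlation P f g\<bar> | t f g.
            f \<in> borel_measurable (sigma_of P Z {..t}) \<and> integrable P (\<lambda>\<omega>. (f \<omega>)\<^sup>2) \<and>
            g \<in> borel_measurable (sigma_of P Z {t + int m..}) \<and> integrable P (\<lambda>\<omega>. (g \<omega>)\<^sup>2)}"
    by (rule bdd_aboveI[of _ 1]) (auto intro!: correlation_le_1 sigma_of_sub)
qed (use assms in blast)

lemma rho_nonneg: "0 \<le> \<rho> m"
proof -
  have "\<bar>correlation P (\<lambda>_. 0) (\<lambda>_. 0)\<bar> \<le> \<rho> m"
    by (rule rho_upper[where t = 0]) simp_all
  then show ?thesis by (rule order_trans[OF abs_ge_zero])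
qed

lemma rho_le_1: "\<rho> m \<le> 1"
  unfolding rho_mixing_def
proof (rule cSup_least)
  have "\<bar>correlation P (\<lambda>_. 0) (\<lambda>_. 0)\<bar> \<in> {\<bar>correlation P f g\<bar> | t f g.
            f \<in> borel_measurable (sigma_of P Z {..t}) \<and> integrable P (\<lambda>\<omega>. (f \<omega>)\<^sup>2) \<and>
            g \<in> borel_measurable (sigma_of P Z {t + int m..}) \<and> integrable P (\<lambda>\<omega>. (g \<omega>)\<^sup>2)}"
    by (intro CollectI exI[of _ "0 :: int"] exI[of _ "\<lambda>_. 0 :: real"] conjI) simp_all
  then show "{\<bar>correlation P f g\<bar> | t f g.
            f \<in> borel_measurable (sigma_of P Z {..t}) \<and> integrable P (\<lambda>\<omega>. (f \<omega>)\<^sup>2) \<and>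
            g \<in> borel_measurable (sigma_of P Z {t + int m..}) \<and> integrable P (\<lambda>\<omega>. (g \<omega>)\<^sup>2)} \<noteq> {}"
    by blast
next
  fix c assume "c \<in> {\<bar>correlation P f g\<bar> | t f g.
            f \<in> borel_measurable (sigma_of P Z {..t}) \<and> integrable P (\<lambda>\<omega>. (f \<omega>)\<^sup>2) \<and>
            g \<in> borel_measurable (sigma_of P Z {t + int m..}) \<and> integrable P (\<lambda>\<omega>. (g \<omega>)\<^sup>2)}"
  then show "c \<le> 1" by (elim CollectE exE conjE) (simp only: correlation_le_1 sigma_of_sub)
qed

lemma rho_summable: "summable (\<lambda>m. \<rho> (Suc m))"
proof (rule summable_comparison_test'[OF mixing])
  fix m
  have "(\<rho> (Suc m))\<^sup>2 \<le> \<rho> (Suc m)"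
    unfolding power2_eq_square by (rule mult_left_le[OF rho_le_1 rho_nonneg])
  then have "\<rho> (Suc m) \<le> sqrt (\<rho> (Suc m))" by (rule real_le_rsqrt)
  then show "norm (\<rho> (Suc m)) \<le> sqrt (\<rho> (Suc m))"
    unfolding real_norm_def abs_of_nonneg[OF rho_nonneg] .
qed

text \<open>Bounds the row sums of the correlation matrix of a stationary sequence: the 1 stands for the diagonal,
  the 2 for past and future.\<close>

definition mix_const :: real where "mix_const = 2 * (1 + (\<Sum>m. \<rho> (Suc m)))"

lemma mix_const_ge: "2 \<le> mix_const"
proof -
  have "0 \<le> (\<Sum>m. \<rho> (Suc m))" by (rule suminf_nonneg[OF rho_summable rho_nonneg])
  then show ?thesis unfolding mix_const_def by simp
qed

lemma covariance_mixing:
  fixes \<phi> :: "(real^'k) \<times> real \<Rightarrow> real"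
  assumes \<phi>[measurable]: "\<phi> \<in> borel_measurable borel" and int: "integrable P (\<lambda>\<omega>. (\<phi> (Z 0 \<omega>))\<^sup>2)"
  defines "\<mu> \<equiv> (\<integral>\<omega>. \<phi> (Z 0 \<omega>) \<partial>P)"
  shows "\<bar>\<integral>\<omega>. (\<phi> (Z s \<omega>) - \<mu>) * (\<phi> (Z (s + int m) \<omega>) - \<mu>) \<partial>P\<bar> \<le> \<rho> m * (\<integral>\<omega>. (\<phi> (Z 0 \<omega>))\<^sup>2 \<partial>P)"
proof -
  define v where "v = (\<integral>\<omega>. (\<phi> (Z 0 \<omega>) - \<mu>)\<^sup>2 \<partial>P)"
  let ?c = "\<integral>\<omega>. (\<phi> (Z s \<omega>) - \<mu>) * (\<phi> (Z (s + int m) \<omega>) - \<mu>) \<partial>P"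
  have int': "integrable P (\<lambda>\<omega>. (\<phi> (Z t \<omega>))\<^sup>2)" for t
    by (rule integrable_shift[of "\<lambda>z. (\<phi> z)\<^sup>2"]) (use int in auto)
  have mu: "(\<integral>\<omega>. \<phi> (Z t \<omega>) \<partial>P) = \<mu>" for t unfolding \<mu>_def by (rule integral_shift) simp
  have v: "(\<integral>\<omega>. (\<phi> (Z t \<omega>) - \<mu>)\<^sup>2 \<partial>P) = v" for t
    unfolding v_def by (rule integral_shift[of "\<lambda>z. (\<phi> z - \<mu>)\<^sup>2"]) simp
  have v0: "0 \<le> v" unfolding v_def by simp
  have corr: "\<bar>?c / v\<bar> \<le> \<rho> m"
    using rho_upper[of "\<lambda>\<omega>. \<phi> (Z s \<omega>)" s "\<lambda>\<omega>. \<phi> (Z (s + int m) \<omega>)" m]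
    by (simp add: sigma_of_measurable int' correlation_def mu v Let_def v0)
  have cs: "\<bar>?c\<bar> \<le> v"
    using covariance_le[of "\<lambda>\<omega>. \<phi> (Z s \<omega>)" "\<lambda>\<omega>. \<phi> (Z (s + int m) \<omega>)" \<mu> \<mu>] v0
    by (simp add: int' v)
  have "\<bar>?c\<bar> \<le> \<rho> m * v"
  proof (cases "v = 0")
    case True
    then show ?thesis using cs by simp
  next
    case False
    then show ?thesis using corr v0 by (simp add: abs_mult field_simps)
  qed
  also have "\<dots> \<le> \<rho> m * (\<integral>\<omega>. (\<phi> (Z 0 \<omega>))\<^sup>2 \<partial>P)"
    using centered_square_le[OF int] rho_nonneg
    by (intro mult_left_mono) (auto simp: v_def \<mu>_def)
  finally show ?thesis .
qed


text \<open>The mixing coefficients bound the correlations, so each row of the covariance matrix has a bounded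
  sum.\<close>

lemma variance_sum_le:
  fixes \<phi> :: "(real^'k) \<times> real \<Rightarrow> real"
  assumes \<phi>[measurable]: "\<phi> \<in> borel_measurable borel" and int: "integrable P (\<lambda>\<omega>. (\<phi> (Z 0 \<omega>))\<^sup>2)"
  defines "\<mu> \<equiv> (\<integral>\<omega>. \<phi> (Z 0 \<omega>) \<partial>P)"
  shows "integrable P (\<lambda>\<omega>. ((\<Sum>t\<in>{1..int n}. \<phi> (Z t \<omega>)) - n * \<mu>)\<^sup>2)"
    and "(\<integral>\<omega>. ((\<Sum>t\<in>{1..int n}. \<phi> (Z t \<omega>)) - n * \<mu>)\<^sup>2 \<partial>P) \<le> n * (mix_const * (\<integral>\<omega>. (\<phi> (Z 0 \<omega>))\<^sup>2 \<partial>P))"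
proof -
  define Y where "Y i \<omega> = \<phi> (Z (int i + 1) \<omega>) - \<mu>" for i \<omega>
  define v where "v = (\<integral>\<omega>. (\<phi> (Z 0 \<omega>))\<^sup>2 \<partial>P)"
  define r where "r m = (if m = 0 then 1 else \<rho> m)" for m
  have v0: "0 \<le> v" unfolding v_def by simp
  have [measurable]: "Y i \<in> borel_measurable P" for i unfolding Y_def by measurable
  have int': "integrable P (\<lambda>\<omega>. (\<phi> (Z t \<omega>))\<^sup>2)" for t
    by (rule integrable_shift[of "\<lambda>z. (\<phi> z)\<^sup>2"]) (use int in auto)
  have sq: "((\<Sum>t\<in>{1..int n}. \<phi> (Z t \<omega>)) - n * \<mu>)\<^sup>2 = (\<Sum>i<n. \<Sum>j<n. Y i \<omega> * Y j \<omega>)" for \<omega>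
  proof -
    have "(\<Sum>t\<in>{1..int n}. \<phi> (Z t \<omega>)) - n * \<mu> = (\<Sum>i<n. Y i \<omega>)"
      by (simp add: sum_over_window Y_def sum_subtractf)
    then show ?thesis by (simp only: power2_eq_square sum_product)
  qed
  have intY: "integrable P (\<lambda>\<omega>. Y i \<omega> * Y j \<omega>)" for i j
    unfolding Y_def
    by (rule integrable_mult_of_squares; (rule integrable_centered_square[OF int'])?) auto
  have le: "expectation (\<lambda>\<omega>. Y i \<omega> * Y j \<omega>) \<le> r (nat \<bar>int i - int j\<bar>) * v" if "i \<le> j" for i j
  proof (cases "i = j")
    case True
    have "expectation (\<lambda>\<omega>. Y j \<omega> * Y j \<omega>) = (\<integral>\<omega>. (\<phi> (Z 0 \<omega>) - \<mu>)\<^sup>2 \<partial>P)"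
      unfolding Y_def power2_eq_square[symmetric] by (rule integral_shift[of "\<lambda>z. (\<phi> z - \<mu>)\<^sup>2"]) simp
    also have "\<dots> \<le> v" unfolding v_def \<mu>_def by (rule centered_square_le[OF int]) simp
    finally show ?thesis using True by (simp add: r_def)
  next
    case False
    then have idx: "(int i + 1) + int (j - i) = int j + 1" "nat \<bar>int i - int j\<bar> = j - i" using that by auto
    then show ?thesis
      using abs_le_D1[OF covariance_mixing[OF \<phi> int, of "int i + 1" "j - i", unfolded idx]] idx(2) False that
      unfolding Y_def v_def \<mu>_def r_def by simp
  qed
  have le': "expectation (\<lambda>\<omega>. Y i \<omega> * Y j \<omega>) \<le> r (nat \<bar>int i - int j\<bar>) * v" for i j
  proof (cases "i \<le> j")
    case False
    then show ?thesis using le[of j i] by (simp add: mult.commute abs_minus_commute)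
  qed (rule le)
  have r_sum: "summable r" "suminf r = mix_const / 2"
  proof -
    have *: "(\<lambda>m. r (Suc m)) = (\<lambda>m. \<rho> (Suc m))" by (auto simp: r_def)
    show sr: "summable r" using rho_summable summable_Suc_iff[of r] unfolding * by (rule iffD1[rotated])
    show "suminf r = mix_const / 2"
      using suminf_split_head[OF sr] unfolding * mix_const_def by (simp add: r_def)
  qed
  have r0: "0 \<le> r m" for m by (simp add: r_def rho_nonneg)
  show "integrable P (\<lambda>\<omega>. ((\<Sum>t\<in>{1..int n}. \<phi> (Z t \<omega>)) - n * \<mu>)\<^sup>2)"
    unfolding sq using intY by simp
  have "(\<integral>\<omega>. ((\<Sum>t\<in>{1..int n}. \<phi> (Z t \<omega>)) - n * \<mu>)\<^sup>2 \<partial>P) = (\<Sum>i<n. \<Sum>j<n. expectation (\<lambda>\<omega>. Y i \<omega> * Y j \<omega>))"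
    unfolding sq using intY by simp
  also have "\<dots> \<le> (\<Sum>i<n. \<Sum>j<n. r (nat \<bar>int i - int j\<bar>) * v)"
    by (intro sum_mono le')
  also have "\<dots> = (\<Sum>i<n. (\<Sum>j<n. r (nat \<bar>int i - int j\<bar>))) * v"
    by (simp add: sum_distrib_right)
  also have "\<dots> \<le> (\<Sum>i<n. mix_const) * v"
    using row_sum_le[OF r_sum(1) r0] r_sum(2)
    by (intro mult_right_mono sum_mono v0) simp
  finally show "(\<integral>\<omega>. ((\<Sum>t\<in>{1..int n}. \<phi> (Z t \<omega>)) - n * \<mu>)\<^sup>2 \<partial>P) \<le> n * (mix_const * (\<integral>\<omega>. (\<phi> (Z 0 \<omega>))\<^sup>2 \<partial>P))"
    by (simp add: v_def)
qed

text \<open>The two tools combined: the martingale inequality reduces the fourth moment to the second moment of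
  \<open>\<Sum> (\<epsilon> w)\<^sup>2\<close>, whose fluctuation around its mean \<open>n v\<close> mixing controls. The term \<open>n f\<close> is
  additive over disjoint supports of \<open>w\<close>, and the chaining argument relies on that.\<close>

lemma noise_fourth_moment:
  fixes w :: "real^'k \<Rightarrow> real"
  assumes w[measurable]: "w \<in> borel_measurable borel" and int: "integrable P (\<lambda>\<omega>. (\<epsilon> 0 \<omega> * w (x 0 \<omega>)) ^ 4)"
    and inte: "integrable P (\<epsilon> 0)"
  defines "v \<equiv> (\<integral>\<omega>. (\<epsilon> 0 \<omega> * w (x 0 \<omega>))\<^sup>2 \<partial>P)" and "f \<equiv> (\<integral>\<omega>. (\<epsilon> 0 \<omega> * w (x 0 \<omega>)) ^ 4 \<partial>P)"
  shows "integrable P (\<lambda>\<omega>. (\<Sum>t\<in>{1..int n}. \<epsilon> t \<omega> * w (x t \<omega>)) ^ 4)"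
    and "(\<integral>\<omega>. (\<Sum>t\<in>{1..int n}. \<epsilon> t \<omega> * w (x t \<omega>)) ^ 4 \<partial>P) \<le> 228 * ((n * v)\<^sup>2 + n * (mix_const * f))"
proof -
  define d where "d i \<omega> = \<epsilon> (int i + 1) \<omega> * w (x (int i + 1) \<omega>)" for i \<omega>
  define \<phi> where "\<phi> z = (snd z * w (fst z))\<^sup>2" for z :: "(real^'k) \<times> real"
  have [measurable]: "\<phi> \<in> borel_measurable borel"
    unfolding \<phi>_def borel_prod[symmetric] by measurable
  have int4: "integrable P (\<lambda>\<omega>. (\<phi> (Z t \<omega>))\<^sup>2)" for t
  proof (rule integrable_shift[of "\<lambda>z. (\<phi> z)\<^sup>2"])
    show "integrable P (\<lambda>\<omega>. (\<phi> (Z 0 \<omega>))\<^sup>2)" using int by (simp add: \<phi>_def)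
  qed measurable
  have inte': "integrable P (\<epsilon> t)" for t
    using integrable_shift[of snd t] inte
    by (simp add: borel_measurable_continuous_onI continuous_on_snd)
  have d_meas[measurable]: "d i \<in> borel_measurable P" for i unfolding d_def by measurable
  have d4: "integrable P (\<lambda>\<omega>. d i \<omega> ^ 4)" for i
    using int4[of "int i + 1"] by (simp add: \<phi>_def d_def)
  have d2: "integrable P (\<lambda>\<omega>. d i \<omega> ^ 2)" for i
    by (rule square_integrable_imp_integrable) (use d4[of i] in simp_all)
  have d1: "integrable P (d i)" for i
    by (rule square_integrable_imp_integrable) (use d2[of i] in simp_all)
  let ?G = "\<lambda>i. F (int i)"
  have mono: "i \<le> j \<Longrightarrow> sets (F (int i)) \<subseteq> sets (F (int j))" for i j :: nat
    by (rule filtration.sets_F_mono[OF filtr])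
  have pred: "x (int i + 1) \<in> borel_measurable (F (int i))" for i
    using x_predictable[of "int i + 1"] by simp
  have pred_w: "(\<lambda>\<omega>. w (x (int i + 1) \<omega>)) \<in> borel_measurable (F (int i))" for i
    using pred w by measurable
  have adapted: "d i \<in> borel_measurable (F (int (Suc i)))" for i
  proof -
    have "subalgebra (F (int i + 1)) (F (int i))"
      using sub[of "int i"] sub[of "int i + 1"] mono[of i "Suc i"]
      unfolding subalgebra_def by (simp add: add.commute)
    then have "(\<lambda>\<omega>. w (x (int i + 1) \<omega>)) \<in> borel_measurable (F (int i + 1))"
      by (rule measurable_from_subalg[OF _ pred_w])
    from borel_measurable_times[OF eps_adapted this] show ?thesis
      unfolding d_def by (simp add: add.commute)
  qed
  have mds: "AE \<omega> in P. real_cond_exp P (F (int i)) (d i) \<omega> = 0" for i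
  proof -
    interpret finite_measure_subalgebra P "F (int i)" by unfold_locales (rule sub)
    have int_prod: "integrable P (\<lambda>\<omega>. w (x (int i + 1) \<omega>) * \<epsilon> (int i + 1) \<omega>)"
      using d1[of i] by (simp add: d_def[abs_def] mult.commute)
    have "AE \<omega> in P. real_cond_exp P (F (int i)) (\<lambda>\<omega>. w (x (int i + 1) \<omega>) * \<epsilon> (int i + 1) \<omega>) \<omega>
       = w (x (int i + 1) \<omega>) * real_cond_exp P (F (int i)) (\<epsilon> (int i + 1)) \<omega>"
      by (rule real_cond_exp_mult[OF pred_w eps_measurable int_prod])
    moreover have "AE \<omega> in P. real_cond_exp P (F (int i)) (\<epsilon> (int i + 1)) \<omega> = 0"
      using noise[of "int i + 1"] by simp
    ultimately show ?thesis unfolding d_def by (auto simp: mult.commute)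
  qed
  note mfm = martingale_fourth_moment[of ?G d n, OF sub mono adapted mds d4]
  have sum_d: "(\<Sum>t\<in>{1..int n}. \<epsilon> t \<omega> * w (x t \<omega>)) = (\<Sum>i<n. d i \<omega>)" for \<omega>
    by (simp add: sum_over_window d_def)
  show "integrable P (\<lambda>\<omega>. (\<Sum>t\<in>{1..int n}. \<epsilon> t \<omega> * w (x t \<omega>)) ^ 4)"
    unfolding sum_d by (rule mfm(1))
  have sum_sq: "(\<Sum>t\<in>{1..int n}. \<phi> (Z t \<omega>)) = (\<Sum>i<n. d i \<omega> ^ 2)" for \<omega>
    by (simp add: sum_over_window d_def \<phi>_def)
  have v: "(\<integral>\<omega>. \<phi> (Z 0 \<omega>) \<partial>P) = v" by (simp add: v_def \<phi>_def)
  have f: "(\<integral>\<omega>. (\<phi> (Z 0 \<omega>))\<^sup>2 \<partial>P) = f" by (simp add: f_def \<phi>_def)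
  note var = variance_sum_le[of \<phi> n, OF _ int4, unfolded v f sum_sq]
  have "expectation (\<lambda>\<omega>. (\<Sum>i<n. d i \<omega> ^ 2) ^ 2)
      \<le> expectation (\<lambda>\<omega>. 2 * (n * v)\<^sup>2 + 2 * ((\<Sum>i<n. d i \<omega> ^ 2) - n * v)\<^sup>2)"
  proof (rule integral_mono)
    show "integrable P (\<lambda>\<omega>. (\<Sum>i<n. d i \<omega> ^ 2) ^ 2)" by (rule mfm(2))
    show "integrable P (\<lambda>\<omega>. 2 * (n * v)\<^sup>2 + 2 * ((\<Sum>i<n. d i \<omega> ^ 2) - n * v)\<^sup>2)"
      using var(1) by simp
    have "a\<^sup>2 \<le> 2 * b\<^sup>2 + 2 * (a - b)\<^sup>2" for a b :: real
      using zero_le_power2[of "a - 2 * b"] by (simp add: power2_eq_square algebra_simps)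
    then show "(\<Sum>i<n. (d i \<omega>)\<^sup>2)\<^sup>2 \<le> 2 * (n * v)\<^sup>2 + 2 * ((\<Sum>i<n. d i \<omega> ^ 2) - n * v)\<^sup>2" for \<omega> .
  qed
  also have "\<dots> \<le> 2 * (n * v)\<^sup>2 + 2 * (n * (mix_const * f))"
    using var by (simp add: prob_space)
  finally have "114 * expectation (\<lambda>\<omega>. (\<Sum>i<n. d i \<omega> ^ 2) ^ 2) \<le> 228 * ((n * v)\<^sup>2 + n * (mix_const * f))"
    by simp
  moreover have "expectation (\<lambda>\<omega>. (\<Sum>i<n. d i \<omega>) ^ 4) \<le> 114 * expectation (\<lambda>\<omega>. (\<Sum>i<n. d i \<omega> ^ 2) ^ 2)"
    by (rule mfm(3))
  ultimately show "(\<integral>\<omega>. (\<Sum>t\<in>{1..int n}. \<epsilon> t \<omega> * w (x t \<omega>)) ^ 4 \<partial>P) \<le> 228 * ((n * v)\<^sup>2 + n * (mix_const * f))"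
    unfolding sum_d by linarith
qed

definition noise_sum :: "nat \<Rightarrow> (real^'k \<Rightarrow> real) \<Rightarrow> (real^'k) set \<Rightarrow> 'w \<Rightarrow> real" where
  "noise_sum n w A \<omega> = (\<Sum>t\<in>{1..int n}. \<epsilon> t \<omega> * (w (x t \<omega>) * indicator A (x t \<omega>)))"

lemma noise_tail:
  assumes [measurable]: "w \<in> borel_measurable borel" "A \<in> sets borel"
    and int: "integrable P (\<lambda>\<omega>. (\<epsilon> 0 \<omega> * w (x 0 \<omega>)) ^ 4)" and inte: "integrable P (\<epsilon> 0)" and "0 < a"
    and v: "(\<integral>\<omega>. (\<epsilon> 0 \<omega> * w (x 0 \<omega>))\<^sup>2 * indicator A (x 0 \<omega>) \<partial>P) \<le> v"
    and f: "(\<integral>\<omega>. (\<epsilon> 0 \<omega> * w (x 0 \<omega>)) ^ 4 * indicator A (x 0 \<omega>) \<partial>P) \<le> f"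
  shows "likely P (228 * ((n * v)\<^sup>2 + n * (mix_const * f)) / a ^ 4) (\<lambda>\<omega>. \<bar>noise_sum n w A \<omega>\<bar> < a)"
proof -
  let ?w = "\<lambda>u. w u * indicator A u"
  have pow: "(\<epsilon> 0 \<omega> * ?w (x 0 \<omega>)) ^ 4 = (\<epsilon> 0 \<omega> * w (x 0 \<omega>)) ^ 4 * indicator A (x 0 \<omega>)"
     "(\<epsilon> 0 \<omega> * ?w (x 0 \<omega>))\<^sup>2 = (\<epsilon> 0 \<omega> * w (x 0 \<omega>))\<^sup>2 * indicator A (x 0 \<omega>)" for \<omega>
    by (auto simp: indicator_def)
  have int': "integrable P (\<lambda>\<omega>. (\<epsilon> 0 \<omega> * ?w (x 0 \<omega>)) ^ 4)"
    by (rule Bochner_Integration.integrable_bound[OF int]) (measurable, auto simp: indicator_def)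
  note m = noise_fourth_moment[of ?w n, OF _ int' inte, unfolded pow]
  let ?v = "\<integral>\<omega>. (\<epsilon> 0 \<omega> * w (x 0 \<omega>))\<^sup>2 * indicator A (x 0 \<omega>) \<partial>P"
  let ?f = "\<integral>\<omega>. (\<epsilon> 0 \<omega> * w (x 0 \<omega>)) ^ 4 * indicator A (x 0 \<omega>) \<partial>P"
  have "(n * ?v)\<^sup>2 \<le> (n * v)\<^sup>2"
    by (intro power_mono mult_left_mono v mult_nonneg_nonneg) auto
  moreover have "n * (mix_const * ?f) \<le> n * (mix_const * f)"
    using mix_const_ge by (intro mult_left_mono f) auto
  ultimately have "(\<integral>\<omega>. noise_sum n w A \<omega> ^ 4 \<partial>P) \<le> 228 * ((n * v)\<^sup>2 + n * (mix_const * f))"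
    using m(2) unfolding noise_sum_def by simp
  moreover have "integrable P (\<lambda>\<omega>. noise_sum n w A \<omega> ^ 4)"
    using m(1) unfolding noise_sum_def by simp
  ultimately have "likely P (228 * ((n * v)\<^sup>2 + n * (mix_const * f)) / a ^ 4) (\<lambda>\<omega>. noise_sum n w A \<omega> ^ 4 < a ^ 4)"
    using \<open>0 < a\<close> by (intro likely_markov) auto
  then show ?thesis
  proof (rule likely_mono)
    fix \<omega> assume "noise_sum n w A \<omega> ^ 4 < a ^ 4"
    then have "\<bar>noise_sum n w A \<omega>\<bar> ^ 4 < a ^ 4" by simp
    then show "\<bar>noise_sum n w A \<omega>\<bar> < a"
      by (rule power_less_imp_less_base) (use \<open>0 < a\<close> in simp)
  qed simp
qed

lemma mean_tail:
  fixes \<phi> :: "(real^'k) \<times> real \<Rightarrow> real"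
  assumes \<phi>: "\<phi> \<in> borel_measurable borel" "integrable P (\<lambda>\<omega>. (\<phi> (Z 0 \<omega>))\<^sup>2)" and "0 < a"
    and v: "(\<integral>\<omega>. (\<phi> (Z 0 \<omega>))\<^sup>2 \<partial>P) \<le> v"
  shows "likely P (n * (mix_const * v) / a\<^sup>2)
     (\<lambda>\<omega>. \<bar>(\<Sum>t\<in>{1..int n}. \<phi> (Z t \<omega>)) - n * (\<integral>\<omega>. \<phi> (Z 0 \<omega>) \<partial>P)\<bar> < a)"
proof -
  note var = variance_sum_le[OF \<phi>, of n]
  have "n * (mix_const * (\<integral>\<omega>. (\<phi> (Z 0 \<omega>))\<^sup>2 \<partial>P)) \<le> n * (mix_const * v)"
    using mix_const_ge by (intro mult_left_mono v) auto
  with var(2) have le: "(\<integral>\<omega>. ((\<Sum>t\<in>{1..int n}. \<phi> (Z t \<omega>)) - n * (\<integral>\<omega>. \<phi> (Z 0 \<omega>) \<partial>P))\<^sup>2 \<partial>P) \<le> n * (mix_const * v)"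
    by (rule order_trans)
  have "likely P (n * (mix_const * v) / a\<^sup>2)
     (\<lambda>\<omega>. ((\<Sum>t\<in>{1..int n}. \<phi> (Z t \<omega>)) - n * (\<integral>\<omega>. \<phi> (Z 0 \<omega>) \<partial>P))\<^sup>2 < a\<^sup>2)"
    by (rule likely_markov[OF var(1) _ le]) (use \<open>0 < a\<close> in simp_all)
  then show ?thesis
  proof (rule likely_mono)
    fix \<omega> assume "((\<Sum>t\<in>{1..int n}. \<phi> (Z t \<omega>)) - n * (\<integral>\<omega>. \<phi> (Z 0 \<omega>) \<partial>P))\<^sup>2 < a\<^sup>2"
    then have "\<bar>(\<Sum>t\<in>{1..int n}. \<phi> (Z t \<omega>)) - n * (\<integral>\<omega>. \<phi> (Z 0 \<omega>) \<partial>P)\<bar>\<^sup>2 < a\<^sup>2" by simp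
    then show "\<bar>(\<Sum>t\<in>{1..int n}. \<phi> (Z t \<omega>)) - n * (\<integral>\<omega>. \<phi> (Z 0 \<omega>) \<partial>P)\<bar> < a"
      by (rule power_less_imp_less_base) (use \<open>0 < a\<close> in simp)
  qed simp
qed

end

section \<open>A maximal inequality over nested sets\<close>

lemma ex_dyadic_floor:
  fixes y :: real
  assumes "1 \<le> y"
  shows "\<exists>l. 2 ^ l \<le> y \<and> y < 2 ^ Suc l"
proof -
  have ex: "\<exists>k. y < 2 ^ k" by (rule real_arch_pow) simp
  define k where "k = (LEAST k. y < 2 ^ k)"
  have k: "y < 2 ^ k" unfolding k_def by (rule LeastI_ex[OF ex])
  have "k \<noteq> 0" using k assms by (intro notI) simp
  then obtain l where l: "k = Suc l" by (cases k) auto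
  have "\<not> y < 2 ^ l" using not_less_Least[of l "\<lambda>k. y < 2 ^ k"] l k_def by simp
  then show ?thesis using k l by (intro exI[of _ l]) auto
qed

text \<open>A dyadic point of level \<open>k\<close> is either one of level \<open>k - 1\<close> or the right neighbour of one, so it is
  reached from the origin by at most one cell of each level.\<close>

lemma dyadic_chain:
  fixes G :: "real \<Rightarrow> real"
  assumes G0: "G 0 = 0"
    and cells: "\<And>k i. k \<le> K \<Longrightarrow> i < 2 ^ k \<Longrightarrow>
       \<bar>G (s\<^sub>0 * real (Suc i) / 2 ^ k) - G (s\<^sub>0 * real i / 2 ^ k)\<bar> \<le> m k"
    and "k \<le> K" "i \<le> 2 ^ k"
  shows "\<bar>G (s\<^sub>0 * real i / 2 ^ k)\<bar> \<le> (\<Sum>l\<le>k. m l)"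
  using assms(3,4)
proof (induction k arbitrary: i)
  case 0
  have "i = 0 \<or> i = 1" using 0 by auto
  moreover have "\<bar>G (s\<^sub>0 * real (Suc 0) / 2 ^ 0) - G (s\<^sub>0 * real 0 / 2 ^ 0)\<bar> \<le> m 0" using cells[of 0 0] by simp
  ultimately show ?case using G0 by auto
next
  case (Suc k)
  have half: "s\<^sub>0 * real (2 * i') / 2 ^ Suc k = s\<^sub>0 * real i' / 2 ^ k" for i' by (simp add: field_simps)
  have m0: "0 \<le> m (Suc k)" using cells[of "Suc k" 0] Suc.prems by (simp add: order_trans[OF abs_ge_zero])
  show ?case
  proof (cases "even i")
    case True
    then obtain i' where i': "i = 2 * i'" by blast
    then have "\<bar>G (s\<^sub>0 * real i' / 2 ^ k)\<bar> \<le> (\<Sum>l\<le>k. m l)" using Suc by simp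
    then show ?thesis unfolding i' half using m0 by simp
  next
    case False
    then obtain i' where i': "i = Suc (2 * i')" using oddE by fastforce
    then have lt: "2 * i' < 2 ^ Suc k" using Suc.prems by simp
    have "\<bar>G (s\<^sub>0 * real i' / 2 ^ k)\<bar> \<le> (\<Sum>l\<le>k. m l)" using Suc i' by simp
    moreover have "\<bar>G (s\<^sub>0 * real (Suc (2 * i')) / 2 ^ Suc k) - G (s\<^sub>0 * real (2 * i') / 2 ^ Suc k)\<bar> \<le> m (Suc k)"
      by (rule cells) (use Suc.prems lt in auto)
    ultimately show ?thesis unfolding i' half by (simp only: sum.atMost_Suc)
  qed
qed

text \<open>The ratio \<open>9/10\<close> of successive thresholds serves the maximal inequality: its fourth power lies strictly
  between \<open>1/2\<close> and \<open>1\<close>.\<close>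

lemma chain_series:
  fixes K :: nat
  shows "(\<Sum>k\<le>K. (9/10 :: real) ^ k) \<le> 10"
    and "(\<Sum>k\<le>K. 1 / (2 ^ k * ((9/10) ^ k) ^ 4 :: real)) \<le> 5"
    and "(\<Sum>k\<le>K. 1 / (((9/10) ^ k) ^ 4 :: real)) \<le> 2 * 2 ^ K"
proof -
  have geom: "(\<Sum>k\<le>K. r ^ k) \<le> 1 / (1 - r)" if "0 \<le> r" "r < 1" for r :: real
  proof -
    have "(\<Sum>k\<le>K. r ^ k) \<le> (\<Sum>k. r ^ k)"
      by (rule sum_le_suminf) (use that in auto)
    then show ?thesis using that by (simp add: suminf_geometric)
  qed
  show "(\<Sum>k\<le>K. (9/10 :: real) ^ k) \<le> 10" using geom[of "9/10"] by simp
  have q4: "(((9/10) ^ k) ^ 4 :: real) = (6561 / 10000) ^ k" for k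
  proof -
    have "(((9/10) ^ k) ^ 4 :: real) = ((9/10) ^ 4) ^ k" by (simp only: power_mult[symmetric] mult.commute)
    also have "((9/10) ^ 4 :: real) = 6561 / 10000" by (simp add: power4_eq_xxxx)
    finally show ?thesis .
  qed
  have inv: "1 / (6561 / 10000) ^ k = (10000 / 6561 :: real) ^ k" for k
    using power_one_over[of "6561 / 10000 :: real" k] by simp
  have eq: "1 / (2 ^ k * ((9/10) ^ k) ^ 4 :: real) = (10000 / 13122) ^ k" for k
  proof -
    have "1 / (2 ^ k * ((9/10) ^ k) ^ 4 :: real) = (1 / 2) ^ k * (1 / (6561 / 10000) ^ k)"
      unfolding q4 power_one_over by simp
    also have "\<dots> = (1 / 2 * (10000 / 6561)) ^ k" unfolding inv by (rule power_mult_distrib[symmetric])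
    finally show ?thesis by simp
  qed
  have "(\<Sum>k\<le>K. (10000 / 13122 :: real) ^ k) \<le> 1 / (1 - 10000 / 13122)" by (rule geom) auto
  also have "\<dots> \<le> 5" by simp
  finally show "(\<Sum>k\<le>K. 1 / (2 ^ k * ((9/10) ^ k) ^ 4 :: real)) \<le> 5" unfolding eq .
  have eq': "1 / (((9/10) ^ k) ^ 4 :: real) = (10000 / 6561) ^ k" for k
    unfolding q4 inv ..
  have "(\<Sum>k\<le>K. (10000 / 6561 :: real) ^ k) \<le> (\<Sum>k\<le>K. 2 ^ k)"
    by (intro sum_mono power_mono) auto
  also have "\<dots> = 2 ^ Suc K - 1" by (induction K) auto
  finally show "(\<Sum>k\<le>K. 1 / (((9/10) ^ k) ^ 4 :: real)) \<le> 2 * 2 ^ K" unfolding eq' by simp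
qed

context mixing_noise
begin

definition abs_sum :: "nat \<Rightarrow> (real^'k \<Rightarrow> real) \<Rightarrow> (real^'k) set \<Rightarrow> 'w \<Rightarrow> real" where
  "abs_sum n w A \<omega> = (\<Sum>t\<in>{1..int n}. \<bar>\<epsilon> t \<omega> * w (x t \<omega>)\<bar> * indicator A (x t \<omega>))"

lemma noise_sum_diff:
  assumes "A \<subseteq> B"
  shows "noise_sum n w B \<omega> - noise_sum n w A \<omega> = noise_sum n w (B - A) \<omega>"
  unfolding noise_sum_def sum_subtractf[symmetric]
  by (rule sum.cong) (use assms in \<open>auto simp: indicator_def algebra_simps\<close>)

lemma noise_sum_le_abs_sum: "\<bar>noise_sum n w A \<omega>\<bar> \<le> abs_sum n w A \<omega>"
proof -
  have "\<bar>\<epsilon> t \<omega> * (w (x t \<omega>) * indicator A (x t \<omega>))\<bar> = \<bar>\<epsilon> t \<omega> * w (x t \<omega>)\<bar> * indicator A (x t \<omega>)" for t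
    by (simp add: indicator_def)
  then show ?thesis
    unfolding noise_sum_def abs_sum_def by (metis (no_types, lifting) sum_abs sum.cong)
qed

lemma abs_sum_mono: "A \<subseteq> B \<Longrightarrow> abs_sum n w A \<omega> \<le> abs_sum n w B \<omega>"
  unfolding abs_sum_def by (intro sum_mono mult_left_mono) (auto simp: indicator_def)

lemma abs_sum_tail:
  assumes [measurable]: "w \<in> borel_measurable borel" "A \<in> sets borel"
    and int: "integrable P (\<lambda>\<omega>. (\<epsilon> 0 \<omega> * w (x 0 \<omega>))\<^sup>2)" and "0 < a"
    and m: "(\<integral>\<omega>. \<bar>\<epsilon> 0 \<omega> * w (x 0 \<omega>)\<bar> * indicator A (x 0 \<omega>) \<partial>P) \<le> m"
    and v: "(\<integral>\<omega>. (\<epsilon> 0 \<omega> * w (x 0 \<omega>))\<^sup>2 * indicator A (x 0 \<omega>) \<partial>P) \<le> v"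
  shows "likely P (n * (mix_const * v) / a\<^sup>2) (\<lambda>\<omega>. abs_sum n w A \<omega> < n * m + a)"
proof -
  let ?\<phi> = "\<lambda>z :: (real^'k) \<times> real. \<bar>snd z * w (fst z)\<bar> * indicator A (fst z)"
  have sq: "(?\<phi> z)\<^sup>2 = (snd z * w (fst z))\<^sup>2 * indicator A (fst z)" for z
    by (simp add: power_mult_distrib indicator_def)
  have meas: "?\<phi> \<in> borel_measurable borel" unfolding borel_prod[symmetric] by measurable
  have int': "integrable P (\<lambda>\<omega>. (?\<phi> (Z 0 \<omega>))\<^sup>2)"
    by (rule Bochner_Integration.integrable_bound[OF int]) (measurable, auto simp: sq indicator_def)
  have v': "(\<integral>\<omega>. (?\<phi> (Z 0 \<omega>))\<^sup>2 \<partial>P) \<le> v" unfolding sq using v by simp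
  show ?thesis
  proof (rule likely_mono[OF mean_tail[OF meas int' \<open>0 < a\<close> v', of n]])
    fix \<omega> assume "\<bar>(\<Sum>t\<in>{1..int n}. ?\<phi> (Z t \<omega>)) - n * (\<integral>\<omega>. ?\<phi> (Z 0 \<omega>) \<partial>P)\<bar> < a"
    then have "\<bar>abs_sum n w A \<omega> - n * (\<integral>\<omega>. \<bar>\<epsilon> 0 \<omega> * w (x 0 \<omega>)\<bar> * indicator A (x 0 \<omega>) \<partial>P)\<bar> < a"
      by (simp add: abs_sum_def)
    moreover have "n * (\<integral>\<omega>. \<bar>\<epsilon> 0 \<omega> * w (x 0 \<omega>)\<bar> * indicator A (x 0 \<omega>) \<partial>P) \<le> n * m"
      by (intro mult_left_mono m) auto
    ultimately show "abs_sum n w A \<omega> < n * m + a" by linarith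
  qed simp
qed

definition chain_const :: "real \<Rightarrow> real" where
  "chain_const C = 228 * (5 * C\<^sup>2 + 4 * (mix_const * C)) + mix_const * C"

text \<open>Chaining over dyadic cells needs fourth moments: at level \<open>k\<close> the contributions \<open>(n v)\<^sup>2\<close> of the
  \<open>2\<^sup>k\<close> cells sum up to order \<open>2\<^sup>-\<^sup>k\<close>, which leaves room for geometrically shrinking thresholds,
  whereas second moments would sum up to a constant at each level and cost a logarithm. The remaining
  contributions \<open>n f\<close> sum up to the fourth moment over \<open>W s\<^sub>0\<close>, whatever the level. Below the finest
  level monotonicity of \<open>W\<close> bounds the increment by the sum of absolute values over a cell. The condition
  \<open>n s\<^sub>0\<^sup>3 \<ge> 1\<close> keeps the number of cells small enough. So the supremum is of the order of the standard
  deviation \<open>b \<surd>(n s\<^sub>0)\<close> at the right end.\<close>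

theorem chaining:
  fixes W :: "real \<Rightarrow> (real^'k) set"
  assumes W_meas[measurable]: "\<And>s. W s \<in> sets borel"
    and W_mono: "\<And>s s'. 0 \<le> s \<Longrightarrow> s \<le> s' \<Longrightarrow> W s \<subseteq> W s'" and W_0: "W 0 = {}"
    and w[measurable]: "w \<in> borel_measurable borel"
    and int: "integrable P (\<lambda>\<omega>. (\<epsilon> 0 \<omega> * w (x 0 \<omega>)) ^ 4)"
    and int2: "integrable P (\<lambda>\<omega>. (\<epsilon> 0 \<omega> * w (x 0 \<omega>))\<^sup>2)" and inte: "integrable P (\<epsilon> 0)"
    and pos: "0 \<le> C" "0 < b" "0 < s\<^sub>0" "s\<^sub>0 \<le> 1" "1 \<le> real n * s\<^sub>0 ^ 3" "1 \<le> T"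
    and m1: "\<And>s s'. 0 \<le> s \<Longrightarrow> s \<le> s' \<Longrightarrow> s' \<le> s\<^sub>0 \<Longrightarrow>
       (\<integral>\<omega>. \<bar>\<epsilon> 0 \<omega> * w (x 0 \<omega>)\<bar> * indicator (W s' - W s) (x 0 \<omega>) \<partial>P) \<le> C * b * (s' - s)"
    and m2: "\<And>s s'. 0 \<le> s \<Longrightarrow> s \<le> s' \<Longrightarrow> s' \<le> s\<^sub>0 \<Longrightarrow>
       (\<integral>\<omega>. (\<epsilon> 0 \<omega> * w (x 0 \<omega>))\<^sup>2 * indicator (W s' - W s) (x 0 \<omega>) \<partial>P) \<le> C * b\<^sup>2 * (s' - s)"
    and m4: "(\<integral>\<omega>. (\<epsilon> 0 \<omega> * w (x 0 \<omega>)) ^ 4 * indicator (W s\<^sub>0) (x 0 \<omega>) \<partial>P) \<le> C * b ^ 4"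
  shows "likely P (chain_const C / T\<^sup>2)
    (\<lambda>\<omega>. \<forall>s\<in>{0..s\<^sub>0}. \<bar>noise_sum n w (W s) \<omega>\<bar> \<le> (C + 11) * (T * b * sqrt (n * s\<^sub>0)))"
proof -
  have n0: "0 < real n" using pos(5) by (cases n) auto
  have ns: "1 \<le> n * s\<^sub>0"
  proof -
    have "s\<^sub>0 ^ 3 \<le> s\<^sub>0" using power_decreasing[of 1 3 s\<^sub>0] pos by simp
    then have "n * s\<^sub>0 ^ 3 \<le> n * s\<^sub>0" by (intro mult_left_mono) auto
    then show ?thesis using pos(5) by linarith
  qed
  define y where "y = sqrt (n * s\<^sub>0)"
  have y: "1 \<le> y" "y\<^sup>2 = n * s\<^sub>0" unfolding y_def using ns by auto
  obtain l where l: "2 ^ l \<le> y" "y < 2 ^ Suc l" using ex_dyadic_floor[OF y(1)] by blast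
  \<comment> \<open>At the finest level, with \<open>2\<^sup>K\<close> about \<open>y\<close>, the mean absolute noise over a
    cell is of the order of the supremum to be bounded.\<close>
  define K where "K = Suc l"
  have K: "y \<le> 2 ^ K" "2 ^ K \<le> 2 * y" using l unfolding K_def by auto
  define a where "a = T * b * y"
  have a0: "0 < a" unfolding a_def using pos y(1) by simp
  define r where "r k i = s\<^sub>0 * real i / 2 ^ k" for k i
  define cell where "cell k i = W (r k (Suc i)) - W (r k i)" for k i
  have cell_meas[measurable]: "cell k i \<in> sets borel" for k i unfolding cell_def by measurable
  have r: "0 \<le> r k i" "r k i \<le> r k (Suc i)" "r k (Suc i) - r k i = s\<^sub>0 / 2 ^ k" for k i
    unfolding r_def using pos by (auto simp: field_simps)
  have r_le: "r k i \<le> s\<^sub>0" if "i \<le> 2 ^ k" for k i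
  proof -
    have "real i \<le> 2 ^ k" using that by (metis of_nat_le_iff of_nat_numeral of_nat_power)
    then show ?thesis unfolding r_def using pos by (simp add: field_simps)
  qed
  have r_end: "r k (2 ^ k) = s\<^sub>0" "r k 0 = 0" for k unfolding r_def by auto
  define f where "f k i = (\<integral>\<omega>. (\<epsilon> 0 \<omega> * w (x 0 \<omega>)) ^ 4 * indicator (cell k i) (x 0 \<omega>) \<partial>P)" for k i
  define \<Phi> where "\<Phi> s = (\<integral>\<omega>. (\<epsilon> 0 \<omega> * w (x 0 \<omega>)) ^ 4 * indicator (W s) (x 0 \<omega>) \<partial>P)" for s
  have int_W: "integrable P (\<lambda>\<omega>. (\<epsilon> 0 \<omega> * w (x 0 \<omega>)) ^ 4 * indicator (W s) (x 0 \<omega>))" for s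
    by (rule Bochner_Integration.integrable_bound[OF int]) (measurable, auto simp: indicator_def)
  \<comment> \<open>Additivity over cells: a whole level costs no more than the fourth moment over \<open>W
    s\<^sub>0\<close>.\<close>
  have f_diff: "f k i = \<Phi> (r k (Suc i)) - \<Phi> (r k i)" for k i
  proof -
    have "f k i = (\<integral>\<omega>. (\<epsilon> 0 \<omega> * w (x 0 \<omega>)) ^ 4 * indicator (W (r k (Suc i))) (x 0 \<omega>)
        - (\<epsilon> 0 \<omega> * w (x 0 \<omega>)) ^ 4 * indicator (W (r k i)) (x 0 \<omega>) \<partial>P)"
      unfolding f_def cell_def
      by (rule Bochner_Integration.integral_cong)
         (use W_mono[OF r(1) r(2), of k i] in \<open>auto simp: indicator_def\<close>)
    then show ?thesis unfolding \<Phi>_def using int_W by simp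
  qed
  have sum_f: "(\<Sum>i<2 ^ k. f k i) \<le> C * b ^ 4" for k
  proof -
    have "(\<Sum>i<2 ^ k. f k i) = \<Phi> (r k (2 ^ k)) - \<Phi> (r k 0)"
      unfolding f_diff by (rule sum_lessThan_telescope)
    also have "\<dots> \<le> C * b ^ 4" unfolding r_end using m4 by (simp add: \<Phi>_def W_0)
    finally show ?thesis .
  qed
  define v where "v k = C * b\<^sup>2 * (s\<^sub>0 / 2 ^ k)" for k :: nat
  have v_le: "(\<integral>\<omega>. (\<epsilon> 0 \<omega> * w (x 0 \<omega>))\<^sup>2 * indicator (cell k i) (x 0 \<omega>) \<partial>P) \<le> v k"
    if "i < 2 ^ k" for k i
    using m2[of "r k i" "r k (Suc i)"] r[of k i] r_le[of "Suc i" k] that by (simp add: cell_def v_def)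
  have m_le: "(\<integral>\<omega>. \<bar>\<epsilon> 0 \<omega> * w (x 0 \<omega>)\<bar> * indicator (cell k i) (x 0 \<omega>) \<partial>P) \<le> C * b * (s\<^sub>0 / 2 ^ k)"
    if "i < 2 ^ k" for k i
    using m1[of "r k i" "r k (Suc i)"] r[of k i] r_le[of "Suc i" k] that by (simp add: cell_def)
  define q where "q k = (9/10 :: real) ^ k" for k :: nat
  have q0: "0 < q k" for k unfolding q_def by simp
  have level: "likely P (\<Sum>i<2 ^ k. 228 * ((n * v k)\<^sup>2 + n * (mix_const * f k i)) / (a * q k) ^ 4)
      (\<lambda>\<omega>. \<forall>i\<in>{..<2 ^ k}. \<bar>noise_sum n w (cell k i) \<omega>\<bar> < a * q k)" for k
    by (intro likely_ball noise_tail int inte) (use a0 q0 v_le in \<open>auto simp: f_def\<close>)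
  have level_sum: "(\<Sum>i<2 ^ k. 228 * ((n * v k)\<^sup>2 + n * (mix_const * f k i)) / (a * q k) ^ 4)
      \<le> 228 / T ^ 4 * (C\<^sup>2 * (1 / (2 ^ k * q k ^ 4)) + mix_const * C / (n * s\<^sub>0\<^sup>2) * (1 / q k ^ 4))" for k
  proof -
    have a4: "a ^ 4 = T ^ 4 * b ^ 4 * (n * s\<^sub>0)\<^sup>2"
      unfolding a_def power_mult_distrib y(2)[symmetric] by (simp flip: power_mult)
    have "(\<Sum>i<2 ^ k. 228 * ((n * v k)\<^sup>2 + n * (mix_const * f k i)) / (a * q k) ^ 4)
       = 228 * (2 ^ k * (n * v k)\<^sup>2 + n * (mix_const * (\<Sum>i<2 ^ k. f k i))) / (a * q k) ^ 4"
      by (simp add: sum_divide_distrib[symmetric] sum_distrib_left[symmetric] sum.distrib)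
    also have "\<dots> \<le> 228 * (2 ^ k * (n * v k)\<^sup>2 + n * (mix_const * (C * b ^ 4))) / (a * q k) ^ 4"
      using mix_const_ge a0 q0[of k] sum_f[of k]
      by (intro divide_right_mono mult_left_mono add_left_mono) auto
    also have "\<dots> = 228 / T ^ 4 * (C\<^sup>2 * (1 / (2 ^ k * q k ^ 4)) + mix_const * C / (n * s\<^sub>0\<^sup>2) * (1 / q k ^ 4))"
      unfolding v_def power_mult_distrib a4 using pos n0 q0[of k]
      by (simp add: divide_simps power2_eq_square power4_eq_xxxx) (simp add: algebra_simps)
    finally show ?thesis .
  qed
  have T4: "1 / T ^ 4 \<le> 1 / T\<^sup>2"
    using pos(6) power_increasing[of 2 4 T] by (intro divide_left_mono) auto
  have K_bound: "2 * 2 ^ K / (n * s\<^sub>0\<^sup>2) \<le> 4"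
  proof -
    have "y \<le> n * s\<^sub>0\<^sup>2"
    proof (rule power2_le_imp_le)
      have "n * s\<^sub>0 * 1 \<le> n * s\<^sub>0 * (n * s\<^sub>0 ^ 3)" using pos n0 by (intro mult_left_mono) auto
      then show "y\<^sup>2 \<le> (n * s\<^sub>0\<^sup>2)\<^sup>2"
        unfolding y(2) by (simp add: power2_eq_square power3_eq_cube mult_ac)
    qed (use pos in auto)
    then have "2 * 2 ^ K \<le> 4 * (n * s\<^sub>0\<^sup>2)" using K(2) by linarith
    then show ?thesis using pos n0 by (simp add: divide_le_eq)
  qed
  have levels: "likely P (228 * (5 * C\<^sup>2 + 4 * (mix_const * C)) / T\<^sup>2)
      (\<lambda>\<omega>. \<forall>k\<in>{..K}. \<forall>i\<in>{..<2 ^ k}. \<bar>noise_sum n w (cell k i) \<omega>\<bar> < a * q k)"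
  proof (rule likely_mono)
    show "likely P (\<Sum>k\<le>K. (\<Sum>i<2 ^ k. 228 * ((n * v k)\<^sup>2 + n * (mix_const * f k i)) / (a * q k) ^ 4))
      (\<lambda>\<omega>. \<forall>k\<in>{..K}. \<forall>i\<in>{..<2 ^ k}. \<bar>noise_sum n w (cell k i) \<omega>\<bar> < a * q k)"
      by (intro likely_ball level) auto
    have "(\<Sum>k\<le>K. (\<Sum>i<2 ^ k. 228 * ((n * v k)\<^sup>2 + n * (mix_const * f k i)) / (a * q k) ^ 4))
       \<le> (\<Sum>k\<le>K. 228 / T ^ 4 * (C\<^sup>2 * (1 / (2 ^ k * q k ^ 4)) + mix_const * C / (n * s\<^sub>0\<^sup>2) * (1 / q k ^ 4)))"
      by (intro sum_mono level_sum)
    also have "\<dots> = 228 / T ^ 4 * (C\<^sup>2 * (\<Sum>k\<le>K. 1 / (2 ^ k * q k ^ 4)) + mix_const * C / (n * s\<^sub>0\<^sup>2) * (\<Sum>k\<le>K. 1 / q k ^ 4))"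
      by (simp only: sum_distrib_left[symmetric] sum.distrib)
    also have "\<dots> \<le> 228 / T ^ 4 * (C\<^sup>2 * 5 + mix_const * C / (n * s\<^sub>0\<^sup>2) * (2 * 2 ^ K))"
      using pos mix_const_ge chain_series(2,3)[of K] unfolding q_def
      by (intro mult_left_mono add_mono) auto
    also have "\<dots> = 228 * (1 / T ^ 4) * (C\<^sup>2 * 5 + mix_const * C * (2 * 2 ^ K / (n * s\<^sub>0\<^sup>2)))" by simp
    also have "\<dots> \<le> 228 * (1 / T\<^sup>2) * (C\<^sup>2 * 5 + mix_const * C * 4)"
      using pos mix_const_ge K_bound T4
      by (intro mult_mono add_mono mult_left_mono order_refl) auto
    also have "\<dots> = 228 * (5 * C\<^sup>2 + 4 * (mix_const * C)) / T\<^sup>2"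
      by (simp add: add_divide_distrib algebra_simps)
    finally show "(\<Sum>k\<le>K. (\<Sum>i<2 ^ k. 228 * ((n * v k)\<^sup>2 + n * (mix_const * f k i)) / (a * q k) ^ 4))
       \<le> 228 * (5 * C\<^sup>2 + 4 * (mix_const * C)) / T\<^sup>2" .
  qed
  have finest: "likely P (mix_const * C / T\<^sup>2)
      (\<lambda>\<omega>. \<forall>i\<in>{..<2 ^ K}. abs_sum n w (cell K i) \<omega> < n * (C * b * (s\<^sub>0 / 2 ^ K)) + a)"
  proof (rule likely_mono)
    show "likely P (\<Sum>i<(2::nat) ^ K. n * (mix_const * v K) / a\<^sup>2)
      (\<lambda>\<omega>. \<forall>i\<in>{..<2 ^ K}. abs_sum n w (cell K i) \<omega> < n * (C * b * (s\<^sub>0 / 2 ^ K)) + a)"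
      by (intro likely_ball abs_sum_tail int2) (use a0 v_le m_le in auto)
    have "(\<Sum>i<(2::nat) ^ K. n * (mix_const * v K) / a\<^sup>2) = mix_const * C / T\<^sup>2"
      unfolding v_def a_def power_mult_distrib y(2) using pos n0 by (simp add: field_simps)
    then show "(\<Sum>i<(2::nat) ^ K. n * (mix_const * v K) / a\<^sup>2) \<le> mix_const * C / T\<^sup>2" by simp
  qed
  have "likely P (228 * (5 * C\<^sup>2 + 4 * (mix_const * C)) / T\<^sup>2 + mix_const * C / T\<^sup>2) (\<lambda>\<omega>.
       (\<forall>k\<in>{..K}. \<forall>i\<in>{..<2 ^ k}. \<bar>noise_sum n w (cell k i) \<omega>\<bar> < a * q k) \<and>
       (\<forall>i\<in>{..<2 ^ K}. abs_sum n w (cell K i) \<omega> < n * (C * b * (s\<^sub>0 / 2 ^ K)) + a))"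
    by (rule likely_conj[OF levels finest])
  then show ?thesis
  proof (rule likely_mono)
    show "228 * (5 * C\<^sup>2 + 4 * (mix_const * C)) / T\<^sup>2 + mix_const * C / T\<^sup>2 \<le> chain_const C / T\<^sup>2"
      by (simp add: chain_const_def add_divide_distrib)
    fix \<omega>
    assume H: "(\<forall>k\<in>{..K}. \<forall>i\<in>{..<2 ^ k}. \<bar>noise_sum n w (cell k i) \<omega>\<bar> < a * q k) \<and>
       (\<forall>i\<in>{..<2 ^ K}. abs_sum n w (cell K i) \<omega> < n * (C * b * (s\<^sub>0 / 2 ^ K)) + a)"
    have cells: "\<bar>noise_sum n w (W (r k (Suc i))) \<omega> - noise_sum n w (W (r k i)) \<omega>\<bar> \<le> a * q k"
      if "k \<le> K" "i < 2 ^ k" for k i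
    proof -
      have "\<bar>noise_sum n w (cell k i) \<omega>\<bar> < a * q k" using H that by blast
      then show ?thesis
        unfolding noise_sum_diff[OF W_mono[OF r(1) r(2)]] by (simp add: cell_def)
    qed
    have grid: "\<bar>noise_sum n w (W (r K i)) \<omega>\<bar> \<le> 10 * a" if "i \<le> 2 ^ K" for i
    proof -
      have "\<bar>noise_sum n w (W (r K i)) \<omega>\<bar> \<le> (\<Sum>k\<le>K. a * q k)"
        unfolding r_def
        by (rule dyadic_chain[where G = "\<lambda>s. noise_sum n w (W s) \<omega>" and K = K])
           (use cells that in \<open>auto simp: r_def W_0 noise_sum_def\<close>)
      also have "\<dots> = a * (\<Sum>k\<le>K. q k)" by (simp add: sum_distrib_left)
      also have "\<dots> \<le> a * 10" unfolding q_def using a0 chain_series(1) by (intro mult_left_mono) auto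
      finally show ?thesis by simp
    qed
    have mean: "n * (C * b * (s\<^sub>0 / 2 ^ K)) \<le> C * a"
    proof -
      have "n * s\<^sub>0 / 2 ^ K \<le> y"
        using K(1) y by (simp add: divide_le_eq flip: y(2)) (simp add: power2_eq_square mult_left_mono)
      then have "C * b * (n * s\<^sub>0 / 2 ^ K) \<le> C * b * y" using pos by (intro mult_left_mono) auto
      also have "\<dots> \<le> C * b * (T * y)" using pos y(1) by (intro mult_left_mono) auto
      finally show ?thesis by (simp add: a_def mult_ac)
    qed
    show "\<forall>s\<in>{0..s\<^sub>0}. \<bar>noise_sum n w (W s) \<omega>\<bar> \<le> (C + 11) * (T * b * sqrt (n * s\<^sub>0))"
    proof
      fix s assume s: "s \<in> {0..s\<^sub>0}"
      have "\<bar>noise_sum n w (W s) \<omega>\<bar> \<le> 10 * a + (C * a + a)"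
      proof (cases "s = s\<^sub>0")
        case True
        have "0 \<le> C * a" using pos a0 by simp
        then show ?thesis using grid[of "2 ^ K"] True a0 unfolding r_end by simp
      next
        case False
        then have s': "0 \<le> s" "s < s\<^sub>0" using s by auto
        define i where "i = nat \<lfloor>s * 2 ^ K / s\<^sub>0\<rfloor>"
        have i_eq: "real i = of_int \<lfloor>s * 2 ^ K / s\<^sub>0\<rfloor>" unfolding i_def using s' pos by simp
        have i1: "real i \<le> s * 2 ^ K / s\<^sub>0" "s * 2 ^ K / s\<^sub>0 < real i + 1" unfolding i_eq by linarith+
        have "s * 2 ^ K / s\<^sub>0 < 2 ^ K" using s' pos by (simp add: divide_less_eq)
        then have "real i < 2 ^ K" using i1 by linarith
        then have iK: "i < 2 ^ K" by simp
        have rs: "r K i \<le> s" "s \<le> r K (Suc i)"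
          using i1 pos by (auto simp: r_def field_simps)
        have "noise_sum n w (W s) \<omega> = noise_sum n w (W (r K i)) \<omega> + noise_sum n w (W s - W (r K i)) \<omega>"
          using noise_sum_diff[OF W_mono[OF r(1) rs(1)], of n w \<omega>] by simp
        moreover have "\<bar>noise_sum n w (W s - W (r K i)) \<omega>\<bar> \<le> abs_sum n w (cell K i) \<omega>"
          by (rule order_trans[OF noise_sum_le_abs_sum abs_sum_mono])
             (use W_mono[OF s'(1) rs(2)] in \<open>auto simp: cell_def\<close>)
        moreover have "abs_sum n w (cell K i) \<omega> < C * a + a"
        proof -
          have "abs_sum n w (cell K i) \<omega> < n * (C * b * (s\<^sub>0 / 2 ^ K)) + a" using H iK by blast
          then show ?thesis using mean by linarith
        qed
        moreover have "\<bar>noise_sum n w (W (r K i)) \<omega>\<bar> \<le> 10 * a" by (rule grid) (use iK in simp)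
        ultimately show ?thesis by linarith
      qed
      then show "\<bar>noise_sum n w (W s) \<omega>\<bar> \<le> (C + 11) * (T * b * sqrt (n * s\<^sub>0))"
        by (simp add: a_def y_def algebra_simps)
    qed
  qed
qed

end

section \<open>Bands next to the kink\<close>

definition strip :: "'k \<Rightarrow> real \<Rightarrow> real \<Rightarrow> (real^'k) set" where
  "strip j a b = {v. a < v $ j \<and> v $ j \<le> b}"

text \<open>The observations on which moving the threshold from \<open>g\<close> to \<open>g + s\<close> (or to \<open>g - s\<close>) changes the regime.
  The asymmetric end points are those of the indicator \<open>q > \<gamma>\<close>. Treating the two directions through a flag
  avoids a second copy of every argument.\<close>

definition band :: "bool \<Rightarrow> 'k \<Rightarrow> real \<Rightarrow> real \<Rightarrow> (real^'k) set" where
  "band up j g s = (if up then strip j g (g + s) else strip j (g - s) g)"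

text \<open>The half-space on the side of \<open>g\<close> opposite to the bands; there the regime does not depend on how far
  the threshold has moved.\<close>

definition base :: "bool \<Rightarrow> 'k \<Rightarrow> real \<Rightarrow> (real^'k) set" where
  "base up j g = (if up then {v. v $ j \<le> g} else {v. g < v $ j})"

lemma strip_measurable[measurable]: "strip (j::'k::finite) a b \<in> sets borel"
proof -
  have "strip j a b = (\<lambda>v. v $ j) -` {a<..b} \<inter> space borel" unfolding strip_def by auto
  also have "\<dots> \<in> sets borel" by (rule measurable_sets[OF borel_measurable_continuous_onI]) (auto intro!: continuous_intros)
  finally show ?thesis .
qed

lemma band_measurable[measurable]: "band up (j::'k::finite) g s \<in> sets borel"
  unfolding band_def by simp

lemma base_measurable[measurable]: "base up (j::'k::finite) g \<in> sets borel"
proof -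
  have "base up j g = (\<lambda>v. v $ j) -` (if up then {..g} else {g<..}) \<inter> space borel" unfolding base_def by auto
  also have "\<dots> \<in> sets borel" by (rule measurable_sets[OF borel_measurable_continuous_onI]) (auto intro!: continuous_intros)
  finally show ?thesis .
qed

lemma band_mono: "s \<le> s' \<Longrightarrow> band up j g s \<subseteq> band up j g s'"
  unfolding band_def strip_def by auto

lemma band_0: "band up j g 0 = {}"
  unfolding band_def strip_def by auto

lemma band_dist: "v \<in> band up j g s \<Longrightarrow> \<bar>v $ j - g\<bar> \<le> s"
  unfolding band_def strip_def by (auto split: if_splits)

lemma band_diff_dist: "v \<in> band up j g s' - band up j g s \<Longrightarrow> s \<le> \<bar>v $ j - g\<bar>"
  unfolding band_def strip_def by (auto split: if_splits)

lemma band_base: "band up j g s \<inter> base up j g = {}"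
  unfolding band_def strip_def base_def by auto

lemma base_compl: "base (\<not> up) j g = - base up j g"
  unfolding base_def by auto

lemma band_diff_strip:
  assumes "0 \<le> s" "s \<le> s'"
  shows "band up j g s' - band up j g s
     = strip j (if up then g + s else g - s') (if up then g + s' else g - s)"
  using assms unfolding band_def strip_def by auto

section \<open>Laws of large numbers\<close>

lemma eventually_div_le:
  fixes A e :: real
  assumes "0 < e"
  shows "\<forall>\<^sub>F n in sequentially. A / real n \<le> e"
proof -
  have "(\<lambda>n. A / real n) \<longlonglongrightarrow> 0" by (rule lim_const_over_n)
  then have "\<forall>\<^sub>F n in sequentially. A / real n < e" using assms by (rule order_tendstoD(2))
  then show ?thesis by (rule eventually_mono) simp
qed

lemma eventually_sqrt_le:
  fixes a q :: real
  assumes "0 < q"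
  shows "\<forall>\<^sub>F n in sequentially. a * sqrt (real n) \<le> q * real n"
proof -
  have "(\<lambda>n. a / sqrt (real n)) \<longlonglongrightarrow> 0"
    by (intro tendsto_divide_0[OF tendsto_const] filterlim_at_top_imp_at_infinity filterlim_compose[OF sqrt_at_top] filterlim_real_sequentially)
  then have "\<forall>\<^sub>F n in sequentially. a / sqrt (real n) < q" using assms by (rule order_tendstoD(2))
  then show ?thesis using eventually_gt_at_top[of 0]
  proof eventually_elim
    case (elim n)
    then have "a < q * sqrt n" by (simp add: divide_less_eq)
    then have "a * sqrt n \<le> q * sqrt n * sqrt n" by (intro mult_right_mono) auto
    also have "\<dots> = q * n" by (simp add: mult.assoc)
    finally show ?case .
  qed
qed

lemma vec_nth_measurable[measurable]: "(\<lambda>v. v $ (i::'k::finite)) \<in> borel_measurable (borel :: (real^'k) measure)"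
  by (intro borel_measurable_continuous_onI continuous_intros)

context mixing_noise
begin

lemma lln:
  fixes \<phi> :: "(real^'k) \<times> real \<Rightarrow> real" and \<delta> e :: real
  assumes \<phi>: "\<phi> \<in> borel_measurable borel" "integrable P (\<lambda>\<omega>. (\<phi> (Z 0 \<omega>))\<^sup>2)" and "0 < \<delta>" "0 < e"
  shows "\<forall>\<^sub>F n in sequentially. likely P e
     (\<lambda>\<omega>. \<bar>(\<Sum>t\<in>{1..int n}. \<phi> (Z t \<omega>)) - n * (\<integral>\<omega>. \<phi> (Z 0 \<omega>) \<partial>P)\<bar> < \<delta> * n)"
proof -
  let ?v = "\<integral>\<omega>. (\<phi> (Z 0 \<omega>))\<^sup>2 \<partial>P"
  have "\<forall>\<^sub>F n in sequentially. (mix_const * ?v / \<delta>\<^sup>2) / real n \<le> e" by (rule eventually_div_le) fact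
  then show ?thesis using eventually_gt_at_top[of 0]
  proof eventually_elim
    case (elim n)
    have "n * (mix_const * ?v) / (\<delta> * n)\<^sup>2 = (mix_const * ?v / \<delta>\<^sup>2) / real n"
      using elim(2) by (simp add: power2_eq_square field_simps)
    then have le: "n * (mix_const * ?v) / (\<delta> * n)\<^sup>2 \<le> e" using elim(1) by simp
    have "0 < \<delta> * n" using elim(2) \<open>0 < \<delta>\<close> by simp
    then show ?case
      by (rule likely_mono[OF mean_tail[OF \<phi> _ order_refl] le])
  qed
qed

text \<open>Uniformity in \<open>p\<close> is free, as the quadratic form has finitely many coefficients.\<close>

lemma quadratic_form_lln:
  fixes \<delta> e :: real
  assumes B[measurable]: "B \<in> sets borel" and int4: "integrable P (\<lambda>\<omega>. norm (x 0 \<omega>) ^ 4)"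
    and "0 < \<delta>" "0 < e"
  shows "\<forall>\<^sub>F n in sequentially. likely P e
     (\<lambda>\<omega>. \<forall>p. \<bar>(\<Sum>t\<in>{1..int n}. (p \<bullet> x t \<omega>)\<^sup>2 * indicator B (x t \<omega>))
        - n * (\<integral>\<omega>. (p \<bullet> x 0 \<omega>)\<^sup>2 * indicator B (x 0 \<omega>) \<partial>P)\<bar> \<le> \<delta> * n * (norm p)\<^sup>2)"
proof -
  define N where "N = real CARD('k)"
  have N: "1 \<le> N" unfolding N_def by (simp add: Suc_leI)
  define \<phi> where "\<phi> ab z = fst z $ fst ab * fst z $ snd ab * indicator B (fst z)"
    for ab :: "'k \<times> 'k" and z :: "(real^'k) \<times> real"
  have \<phi>_meas: "\<phi> ab \<in> borel_measurable borel" for ab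
    unfolding \<phi>_def borel_prod[symmetric] by measurable
  have \<phi>_le: "(\<phi> ab (u, r))\<^sup>2 \<le> norm u ^ 4" for ab u r
  proof -
    have "\<bar>u $ fst ab * u $ snd ab\<bar> \<le> norm u * norm u"
      unfolding abs_mult by (intro mult_mono component_le_norm_cart) auto
    then have "\<bar>\<phi> ab (u, r)\<bar> \<le> norm u * norm u" by (auto simp: \<phi>_def indicator_def)
    then have "\<bar>\<phi> ab (u, r)\<bar>\<^sup>2 \<le> (norm u * norm u)\<^sup>2" by (intro power_mono) auto
    then show ?thesis by (simp add: power2_eq_square power4_eq_xxxx mult_ac)
  qed
  have \<phi>_int: "integrable P (\<lambda>\<omega>. (\<phi> ab (Z 0 \<omega>))\<^sup>2)" for ab
  proof (rule Bochner_Integration.integrable_bound[OF int4])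
    have "(\<lambda>\<omega>. \<phi> ab (Z 0 \<omega>)) \<in> borel_measurable P"
      by (rule measurable_compose[OF Z_measurable \<phi>_meas])
    then show "(\<lambda>\<omega>. (\<phi> ab (Z 0 \<omega>))\<^sup>2) \<in> borel_measurable P" by measurable
    show "AE \<omega> in P. norm ((\<phi> ab (Z 0 \<omega>))\<^sup>2) \<le> norm (norm (x 0 \<omega>) ^ 4)"
      using \<phi>_le by (intro AE_I2) simp
  qed
  have \<phi>_int1: "integrable P (\<lambda>\<omega>. \<phi> ab (Z 0 \<omega>))" for ab
    by (rule square_integrable_imp_integrable[OF measurable_compose[OF Z_measurable \<phi>_meas] \<phi>_int])
  have expand: "(p \<bullet> u)\<^sup>2 * indicator B u = (\<Sum>ab\<in>UNIV. p $ fst ab * p $ snd ab * \<phi> ab (u, r))" for p u r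
  proof -
    have "(p \<bullet> u)\<^sup>2 = (\<Sum>a\<in>UNIV. \<Sum>b\<in>UNIV. (p $ a * u $ a) * (p $ b * u $ b))"
      by (simp add: power2_eq_square inner_vec_def sum_product)
    also have "\<dots> = (\<Sum>ab\<in>UNIV. (p $ fst ab * u $ fst ab) * (p $ snd ab * u $ snd ab))"
      by (simp add: sum.cartesian_product case_prod_beta)
    finally show ?thesis by (simp add: sum_distrib_right \<phi>_def mult_ac)
  qed
  define \<delta>' where "\<delta>' = \<delta> / (N * N)"
  have \<delta>': "0 < \<delta>'" unfolding \<delta>'_def using assms N by simp
  define \<mu> where "\<mu> ab = (\<integral>\<omega>. \<phi> ab (Z 0 \<omega>) \<partial>P)" for ab
  have "\<forall>\<^sub>F n in sequentially. \<forall>ab\<in>UNIV. likely P (e / (N * N))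
     (\<lambda>\<omega>. \<bar>(\<Sum>t\<in>{1..int n}. \<phi> ab (Z t \<omega>)) - n * \<mu> ab\<bar> < \<delta>' * n)"
  proof (intro eventually_ball_finite ballI)
    have "0 < e / (N * N)" using assms N by simp
    then show "\<forall>\<^sub>F n in sequentially. likely P (e / (N * N))
     (\<lambda>\<omega>. \<bar>(\<Sum>t\<in>{1..int n}. \<phi> ab (Z t \<omega>)) - n * \<mu> ab\<bar> < \<delta>' * n)" for ab
      unfolding \<mu>_def by (rule lln[OF \<phi>_meas \<phi>_int \<delta>'])
  qed simp
  then show ?thesis
  proof eventually_elim
    case (elim n)
    have "likely P (\<Sum>ab\<in>(UNIV :: ('k \<times> 'k) set). e / (N * N))
      (\<lambda>\<omega>. \<forall>ab\<in>UNIV. \<bar>(\<Sum>t\<in>{1..int n}. \<phi> ab (Z t \<omega>)) - n * \<mu> ab\<bar> < \<delta>' * n)"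
      by (rule likely_ball) (use elim in auto)
    moreover have "(\<Sum>ab\<in>(UNIV :: ('k \<times> 'k) set). e / (N * N)) = e"
      using N by (simp add: N_def card_cartesian_product flip: UNIV_Times_UNIV)
    ultimately have "likely P e (\<lambda>\<omega>. \<forall>ab\<in>UNIV. \<bar>(\<Sum>t\<in>{1..int n}. \<phi> ab (Z t \<omega>)) - n * \<mu> ab\<bar> < \<delta>' * n)"
      by simp
    then show ?case
    proof (rule likely_mono, simp, intro allI)
      fix \<omega> p assume H: "\<forall>ab\<in>UNIV. \<bar>(\<Sum>t\<in>{1..int n}. \<phi> ab (Z t \<omega>)) - n * \<mu> ab\<bar> < \<delta>' * n"
      have expand': "(p \<bullet> x t \<omega>')\<^sup>2 * indicator B (x t \<omega>') = (\<Sum>ab\<in>UNIV. p $ fst ab * p $ snd ab * \<phi> ab (Z t \<omega>'))" for t \<omega>'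
        by (rule expand)
      have e1: "(\<Sum>t\<in>{1..int n}. (p \<bullet> x t \<omega>)\<^sup>2 * indicator B (x t \<omega>))
         = (\<Sum>ab\<in>UNIV. p $ fst ab * p $ snd ab * (\<Sum>t\<in>{1..int n}. \<phi> ab (Z t \<omega>)))"
        unfolding expand' sum_distrib_left by (rule sum.swap)
      have e2: "(\<integral>\<omega>. (p \<bullet> x 0 \<omega>)\<^sup>2 * indicator B (x 0 \<omega>) \<partial>P) = (\<Sum>ab\<in>UNIV. p $ fst ab * p $ snd ab * \<mu> ab)"
        unfolding expand' \<mu>_def using \<phi>_int1 by (simp add: Bochner_Integration.integral_sum)
      have "\<bar>(\<Sum>t\<in>{1..int n}. (p \<bullet> x t \<omega>)\<^sup>2 * indicator B (x t \<omega>))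
        - n * (\<integral>\<omega>. (p \<bullet> x 0 \<omega>)\<^sup>2 * indicator B (x 0 \<omega>) \<partial>P)\<bar>
        = \<bar>\<Sum>ab\<in>UNIV. p $ fst ab * p $ snd ab * ((\<Sum>t\<in>{1..int n}. \<phi> ab (Z t \<omega>)) - n * \<mu> ab)\<bar>"
        unfolding e1 e2 by (simp add: sum_distrib_left right_diff_distrib sum_subtractf mult_ac)
      also have "\<dots> \<le> (\<Sum>ab\<in>(UNIV :: ('k \<times> 'k) set). (norm p * norm p) * (\<delta>' * n))"
      proof (rule order_trans[OF sum_abs], rule sum_mono)
        fix ab :: "'k \<times> 'k"
        have "\<bar>p $ fst ab * p $ snd ab\<bar> \<le> norm p * norm p"
          unfolding abs_mult by (intro mult_mono component_le_norm_cart) auto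
        moreover have "\<bar>(\<Sum>t\<in>{1..int n}. \<phi> ab (Z t \<omega>)) - n * \<mu> ab\<bar> \<le> \<delta>' * n"
          using bspec[OF H UNIV_I, of ab] by (rule less_imp_le)
        ultimately show "\<bar>p $ fst ab * p $ snd ab * ((\<Sum>t\<in>{1..int n}. \<phi> ab (Z t \<omega>)) - n * \<mu> ab)\<bar>
           \<le> (norm p * norm p) * (\<delta>' * n)"
          unfolding abs_mult[of "p $ fst ab * p $ snd ab"] by (intro mult_mono) auto
      qed
      also have "\<dots> = \<delta> * n * (norm p)\<^sup>2"
        using N by (simp add: \<delta>'_def N_def power2_eq_square card_cartesian_product flip: UNIV_Times_UNIV)
      finally show "\<bar>(\<Sum>t\<in>{1..int n}. (p \<bullet> x t \<omega>)\<^sup>2 * indicator B (x t \<omega>))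
        - n * (\<integral>\<omega>. (p \<bullet> x 0 \<omega>)\<^sup>2 * indicator B (x 0 \<omega>) \<partial>P)\<bar> \<le> \<delta> * n * (norm p)\<^sup>2" .
    qed
  qed
qed

lemma noise_sum_bounded:
  assumes w: "w \<in> borel_measurable borel" and A: "A \<in> sets borel"
    and int: "integrable P (\<lambda>\<omega>. (\<epsilon> 0 \<omega> * w (x 0 \<omega>)) ^ 4)" and inte: "integrable P (\<epsilon> 0)" and "0 < e"
  shows "\<exists>T\<ge>1. \<forall>n\<ge>1. likely P e (\<lambda>\<omega>. \<bar>noise_sum n w A \<omega>\<bar> \<le> T * sqrt n)"
proof -
  define v where "v = (\<integral>\<omega>. (\<epsilon> 0 \<omega> * w (x 0 \<omega>))\<^sup>2 * indicator A (x 0 \<omega>) \<partial>P)"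
  define f where "f = (\<integral>\<omega>. (\<epsilon> 0 \<omega> * w (x 0 \<omega>)) ^ 4 * indicator A (x 0 \<omega>) \<partial>P)"
  define R where "R = 228 * (v\<^sup>2 + mix_const * f)"
  have f0: "0 \<le> f" unfolding f_def by (intro Bochner_Integration.integral_nonneg) (auto simp: indicator_def)
  have R0: "0 \<le> R" unfolding R_def using f0 mix_const_ge by simp
  define T where "T = 1 + R / e"
  have T1: "1 \<le> T" unfolding T_def using R0 \<open>0 < e\<close> by simp
  have T4: "R / T ^ 4 \<le> e"
  proof -
    have "R / e \<le> T" unfolding T_def by simp
    also have "T \<le> T ^ 4" using T1 power_increasing[of 1 4 T] by simp
    finally show ?thesis using \<open>0 < e\<close> T1 by (simp add: divide_le_eq mult.commute)
  qed
  have "likely P e (\<lambda>\<omega>. \<bar>noise_sum n w A \<omega>\<bar> \<le> T * sqrt n)" if n: "n \<ge> 1" for n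
  proof (rule likely_mono)
    have pos: "0 < T * sqrt n" using T1 n by simp
    show "likely P (228 * ((n * v)\<^sup>2 + n * (mix_const * f)) / (T * sqrt n) ^ 4) (\<lambda>\<omega>. \<bar>noise_sum n w A \<omega>\<bar> < T * sqrt n)"
      by (rule noise_tail[OF w A int inte pos]) (simp_all add: v_def f_def)
    have s4: "(T * sqrt n) ^ 4 = T ^ 4 * (real n)\<^sup>2"
    proof -
      have "sqrt n ^ 4 = (sqrt n ^ 2) ^ 2" by (simp only: power_mult[symmetric]) simp
      then show ?thesis by (simp add: power_mult_distrib)
    qed
    have "n * (mix_const * f) \<le> (real n)\<^sup>2 * (mix_const * f)"
      using f0 mix_const_ge n by (intro mult_right_mono) (auto simp: power2_eq_square)
    then have "228 * ((n * v)\<^sup>2 + n * (mix_const * f)) \<le> (real n)\<^sup>2 * R"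
      unfolding R_def by (simp add: power_mult_distrib algebra_simps)
    then have "228 * ((n * v)\<^sup>2 + n * (mix_const * f)) / (T * sqrt n) ^ 4 \<le> (real n)\<^sup>2 * R / (T ^ 4 * (real n)\<^sup>2)"
      unfolding s4 using T1 by (intro divide_right_mono) auto
    also have "\<dots> = R / T ^ 4" using n by simp
    finally show "228 * ((n * v)\<^sup>2 + n * (mix_const * f)) / (T * sqrt n) ^ 4 \<le> e" using T4 by simp
  qed simp
  then show ?thesis using T1 by blast
qed

text \<open>Without atoms of \<open>q\<close>, the indicator of a band depends continuously on its width, almost surely.\<close>

lemma band_moment_continuous:
  fixes h :: "'w \<Rightarrow> real"
  assumes h: "integrable P h" and no_atoms: "\<And>r. measure P {\<omega>\<in>space P. x 0 \<omega> $ j = r} = 0"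
  shows "continuous_on {0..} (\<lambda>s. \<integral>\<omega>. h \<omega> * indicator (band up j g s) (x 0 \<omega>) \<partial>P)"
proof (rule continuous_on_sequentiallyI)
  have [measurable]: "h \<in> borel_measurable P" using h by auto
  fix u s assume u: "\<forall>n. u n \<in> {0..}" "s \<in> {0..}" "u \<longlonglongrightarrow> (s::real)"
  show "(\<lambda>n. \<integral>\<omega>. h \<omega> * indicator (band up j g (u n)) (x 0 \<omega>) \<partial>P)
     \<longlonglongrightarrow> (\<integral>\<omega>. h \<omega> * indicator (band up j g s) (x 0 \<omega>) \<partial>P)"
  proof (rule integral_dominated_convergence[where w = "\<lambda>\<omega>. \<bar>h \<omega>\<bar>"])
    define r where "r = (if up then g + s else g - s)"
    have "{\<omega>\<in>space P. x 0 \<omega> $ j = r} \<in> null_sets P"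
      using no_atoms[of r] by (auto simp: null_sets_def emeasure_eq_measure)
    then have "AE \<omega> in P. x 0 \<omega> $ j \<noteq> r" by (rule AE_I') auto
    then show "AE \<omega> in P. (\<lambda>n. h \<omega> * indicator (band up j g (u n)) (x 0 \<omega>)) \<longlonglongrightarrow> h \<omega> * indicator (band up j g s) (x 0 \<omega>)"
    proof eventually_elim
      case (elim \<omega>)
      define d where "d = (if up then x 0 \<omega> $ j - g else g - x 0 \<omega> $ j)"
      have ds: "d \<noteq> s" using elim unfolding d_def r_def by auto
      have "\<forall>\<^sub>F n in sequentially. (d < u n) = (d < s) \<and> u n \<noteq> d"
      proof (cases "d < s")
        case True
        then show ?thesis using order_tendstoD(1)[OF u(3) True] by (auto elim: eventually_mono)
      next
        case False
        then have "s < d" using ds by auto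
        then show ?thesis using order_tendstoD(2)[OF u(3) \<open>s < d\<close>] by (auto elim: eventually_mono)
      qed
      then have "\<forall>\<^sub>F n in sequentially. h \<omega> * indicator (band up j g (u n)) (x 0 \<omega>) = h \<omega> * indicator (band up j g s) (x 0 \<omega>)"
      proof eventually_elim
        case (elim n)
        then have "(x 0 \<omega> \<in> band up j g (u n)) = (x 0 \<omega> \<in> band up j g s)"
          using ds unfolding band_def strip_def d_def by (auto split: if_splits)
        then show ?case by (simp add: indicator_def)
      qed
      then show ?case by (rule tendsto_eventually)
    qed
    show "AE \<omega> in P. norm (h \<omega> * indicator (band up j g (u n)) (x 0 \<omega>)) \<le> \<bar>h \<omega>\<bar>" for n
      by (auto simp: indicator_def)
  qed (use h in auto)
qed

text \<open>A Glivenko-Cantelli argument: on a grid whose cells carry little of \<open>|\<epsilon> w|\<close>, the fourth moments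
  handle the grid points and the law of large numbers for \<open>|\<epsilon> w|\<close> handles the cells. It gives no
  rate but needs no density bound, so it covers thresholds far from the kink.\<close>

lemma noise_sum_uniform_lln:
  fixes S \<kappa> e :: real
  assumes w[measurable]: "w \<in> borel_measurable borel"
    and int: "integrable P (\<lambda>\<omega>. (\<epsilon> 0 \<omega> * w (x 0 \<omega>)) ^ 4)" and inte: "integrable P (\<epsilon> 0)"
    and no_atoms: "\<And>r. measure P {\<omega>\<in>space P. x 0 \<omega> $ j = r} = 0"
    and "0 < S" "0 < \<kappa>" "0 < e"
  shows "\<forall>\<^sub>F n in sequentially. likely P e (\<lambda>\<omega>. \<forall>s\<in>{0..S}. \<bar>noise_sum n w (band up j g s) \<omega>\<bar> \<le> \<kappa> * n)"
proof -
  have int2: "integrable P (\<lambda>\<omega>. (\<epsilon> 0 \<omega> * w (x 0 \<omega>))\<^sup>2)"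
    by (rule square_integrable_imp_integrable) (use int in simp_all)
  have int1: "integrable P (\<lambda>\<omega>. \<bar>\<epsilon> 0 \<omega> * w (x 0 \<omega>)\<bar>)"
    by (rule integrable_abs, rule square_integrable_imp_integrable) (use int2 in simp_all)
  let ?W = "band up j g"
  define \<kappa>' where "\<kappa>' = \<kappa> / 3"
  have k0: "0 < \<kappa>'" unfolding \<kappa>'_def using assms by simp
  define m where "m s = (\<integral>\<omega>. \<bar>\<epsilon> 0 \<omega> * w (x 0 \<omega>)\<bar> * indicator (?W s) (x 0 \<omega>) \<partial>P)" for s
  have "uniformly_continuous_on {0..S} m"
    unfolding m_def
    by (intro compact_uniformly_continuous continuous_on_subset[OF band_moment_continuous[OF int1 no_atoms]]) auto
  then obtain d where d: "0 < d" "\<And>s s'. s \<in> {0..S} \<Longrightarrow> s' \<in> {0..S} \<Longrightarrow> dist s' s < d \<Longrightarrow> dist (m s') (m s) < \<kappa>'"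
    unfolding uniformly_continuous_on_def using k0 by metis
  obtain N :: nat where N: "S / d < real N" using reals_Archimedean2 by blast
  have N0: "0 < real N" using N assms(5) d(1) by (meson divide_pos_pos less_trans)
  define r where "r i = S * real i / real N" for i :: nat
  have r: "0 \<le> r i" "r i \<le> r (Suc i)" "r (Suc i) - r i = S / real N" for i
    unfolding r_def using N0 assms(5) by (auto simp: field_simps)
  have rS: "r i \<le> S" if "i \<le> N" for i
    unfolding r_def using that N0 assms(5) by (simp add: field_simps)
  have mesh: "S / real N < d" using N N0 d(1) by (simp add: field_simps)
  define cell where "cell i = ?W (r (Suc i)) - ?W (r i)" for i
  have [measurable]: "cell i \<in> sets borel" for i unfolding cell_def by measurable
  have int_W: "integrable P (\<lambda>\<omega>. \<bar>\<epsilon> 0 \<omega> * w (x 0 \<omega>)\<bar> * indicator (?W s) (x 0 \<omega>))" for s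
    by (rule Bochner_Integration.integrable_bound[OF int1]) (measurable, auto simp: indicator_def)
  have cell_m: "(\<integral>\<omega>. \<bar>\<epsilon> 0 \<omega> * w (x 0 \<omega>)\<bar> * indicator (cell i) (x 0 \<omega>) \<partial>P) \<le> \<kappa>'" if "i < N" for i
  proof -
    have "(\<integral>\<omega>. \<bar>\<epsilon> 0 \<omega> * w (x 0 \<omega>)\<bar> * indicator (cell i) (x 0 \<omega>) \<partial>P)
      = (\<integral>\<omega>. \<bar>\<epsilon> 0 \<omega> * w (x 0 \<omega>)\<bar> * indicator (?W (r (Suc i))) (x 0 \<omega>)
           - \<bar>\<epsilon> 0 \<omega> * w (x 0 \<omega>)\<bar> * indicator (?W (r i)) (x 0 \<omega>) \<partial>P)"
      unfolding cell_def
      by (rule Bochner_Integration.integral_cong)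
         (use band_mono[OF r(2), of up j g i] in \<open>auto simp: indicator_def\<close>)
    also have "\<dots> = m (r (Suc i)) - m (r i)" unfolding m_def using int_W by simp
    also have "\<dots> \<le> \<kappa>'"
      using d(2)[of "r i" "r (Suc i)"] r[of i] rS[of i] rS[of "Suc i"] that mesh
      by (simp add: dist_real_def)
    finally show ?thesis .
  qed
  define v where "v = (\<integral>\<omega>. (\<epsilon> 0 \<omega> * w (x 0 \<omega>))\<^sup>2 \<partial>P)"
  have v_cell: "(\<integral>\<omega>. (\<epsilon> 0 \<omega> * w (x 0 \<omega>))\<^sup>2 * indicator A (x 0 \<omega>) \<partial>P) \<le> v" if [measurable]: "A \<in> sets borel" for A
    unfolding v_def
  proof (rule integral_mono[OF _ int2])
    show "integrable P (\<lambda>\<omega>. (\<epsilon> 0 \<omega> * w (x 0 \<omega>))\<^sup>2 * indicator A (x 0 \<omega>))"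
      by (rule Bochner_Integration.integrable_bound[OF int2]) (measurable, auto simp: indicator_def)
  qed (auto simp: indicator_def)
  define e' where "e' = e / (2 * real N)"
  have e': "0 < e'" unfolding e'_def using N0 assms by simp
  have "\<forall>i\<in>{..<N}. \<exists>T\<ge>1. \<forall>n\<ge>1. likely P e' (\<lambda>\<omega>. \<bar>noise_sum n w (?W (r i)) \<omega>\<bar> \<le> T * sqrt n)"
    by (intro ballI noise_sum_bounded w band_measurable int inte e')
  then obtain T where T: "\<And>i n. i \<in> {..<N} \<Longrightarrow> 1 \<le> n \<Longrightarrow> likely P e' (\<lambda>\<omega>. \<bar>noise_sum n w (?W (r i)) \<omega>\<bar> \<le> T i * sqrt n)"
    by metis
  have "\<forall>\<^sub>F n in sequentially. T i * sqrt (real n) \<le> \<kappa>' * n" for i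
    by (rule eventually_sqrt_le[OF k0])
  then have "\<forall>\<^sub>F n in sequentially. \<forall>i\<in>{..<N}. T i * sqrt (real n) \<le> \<kappa>' * n"
    by (intro eventually_ball_finite) auto
  moreover have "\<forall>\<^sub>F n in sequentially. (mix_const * v / \<kappa>'\<^sup>2) / real n \<le> e'" by (rule eventually_div_le[OF e'])
  ultimately show ?thesis using eventually_gt_at_top[of 0]
  proof eventually_elim
    case (elim n)
    have "likely P (\<Sum>i\<in>{..<N}. e') (\<lambda>\<omega>. \<forall>i\<in>{..<N}. \<bar>noise_sum n w (?W (r i)) \<omega>\<bar> \<le> T i * sqrt n)"
      by (rule likely_ball) (use elim T in auto)
    moreover have "likely P (\<Sum>i\<in>{..<N}. e') (\<lambda>\<omega>. \<forall>i\<in>{..<N}. abs_sum n w (cell i) \<omega> < n * \<kappa>' + \<kappa>' * n)"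
    proof (intro likely_ball)
      fix i assume i: "i \<in> {..<N}"
      have pos: "0 < \<kappa>' * n" using k0 elim by simp
      have "likely P (n * (mix_const * v) / (\<kappa>' * n)\<^sup>2) (\<lambda>\<omega>. abs_sum n w (cell i) \<omega> < n * \<kappa>' + \<kappa>' * n)"
        by (rule abs_sum_tail[OF w _ int2 pos cell_m v_cell]) (use i in auto)
      moreover have "n * (mix_const * v) / (\<kappa>' * n)\<^sup>2 \<le> e'"
        using elim by (simp add: power2_eq_square field_simps)
      ultimately show "likely P e' (\<lambda>\<omega>. abs_sum n w (cell i) \<omega> < n * \<kappa>' + \<kappa>' * n)"
        by (rule likely_mono) simp
    qed simp
    ultimately have "likely P ((\<Sum>i\<in>{..<N}. e') + (\<Sum>i\<in>{..<N}. e')) (\<lambda>\<omega>. (\<forall>i\<in>{..<N}. \<bar>noise_sum n w (?W (r i)) \<omega>\<bar> \<le> T i * sqrt n)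
       \<and> (\<forall>i\<in>{..<N}. abs_sum n w (cell i) \<omega> < n * \<kappa>' + \<kappa>' * n))"
      by (rule likely_conj)
    then show ?case
    proof (rule likely_mono)
      show "(\<Sum>i\<in>{..<N}. e') + (\<Sum>i\<in>{..<N}. e') \<le> e" using N0 by (simp add: e'_def field_simps)
      fix \<omega> assume H: "(\<forall>i\<in>{..<N}. \<bar>noise_sum n w (?W (r i)) \<omega>\<bar> \<le> T i * sqrt n)
       \<and> (\<forall>i\<in>{..<N}. abs_sum n w (cell i) \<omega> < n * \<kappa>' + \<kappa>' * n)"
      show "\<forall>s\<in>{0..S}. \<bar>noise_sum n w (?W s) \<omega>\<bar> \<le> \<kappa> * n"
      proof
        fix s assume s: "s \<in> {0..S}"
        obtain i where i: "i < N" "r i \<le> s" "s \<le> r (Suc i)"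
        proof (cases "s = S")
          case True
          have "N \<noteq> 0" using N0 by simp
          then have "Suc (N - 1) = N" by simp
          then have "s = r (Suc (N - 1))" using True N0 by (simp add: r_def)
          then show ?thesis using that[of "N - 1"] r(2)[of "N - 1"] \<open>N \<noteq> 0\<close> by simp
        next
          case False
          define i where "i = nat \<lfloor>s * N / S\<rfloor>"
          have i_eq: "real i = of_int \<lfloor>s * N / S\<rfloor>" unfolding i_def using s assms(5) by simp
          have i1: "real i \<le> s * N / S" "s * N / S < real i + 1" unfolding i_eq by linarith+
          have "s * N / S < N" using s False assms(5) N0 by (simp add: divide_less_eq)
          then have "i < N" using i1 by linarith
          moreover have "r i \<le> s" "s \<le> r (Suc i)"
            using i1 assms(5) N0 by (auto simp: r_def field_simps)
          ultimately show ?thesis using that by blast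
        qed
        have "noise_sum n w (?W s) \<omega> = noise_sum n w (?W (r i)) \<omega> + noise_sum n w (?W s - ?W (r i)) \<omega>"
          using noise_sum_diff[OF band_mono[OF i(2)], of n w up j g \<omega>] by simp
        moreover have "\<bar>noise_sum n w (?W s - ?W (r i)) \<omega>\<bar> \<le> abs_sum n w (cell i) \<omega>"
          by (rule order_trans[OF noise_sum_le_abs_sum abs_sum_mono])
             (use band_mono[OF i(3), of up j g] in \<open>auto simp: cell_def\<close>)
        moreover have "abs_sum n w (cell i) \<omega> < n * \<kappa>' + \<kappa>' * n" using H i(1) by blast
        moreover have "\<bar>noise_sum n w (?W (r i)) \<omega>\<bar> \<le> T i * sqrt n" using H i(1) by blast
        moreover have "T i * sqrt n \<le> \<kappa>' * n" using elim i(1) by blast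
        ultimately show "\<bar>noise_sum n w (?W s) \<omega>\<bar> \<le> \<kappa> * n" by (simp add: \<kappa>'_def field_simps)
      qed
    qed
  qed
qed

end

section \<open>Samples with a kink\<close>

text \<open>The rate of the threshold estimator. At distance \<open>s = rate n\<close> the signal \<open>n s\<^sup>3\<close> equals the noise level
  \<open>\<surd>(n s\<^sup>3)\<close>, both being 1.\<close>

definition rate :: "nat \<Rightarrow> real" where "rate n = real n powr (- 1 / 3)"

lemma rate_pos: "0 < n \<Longrightarrow> 0 < rate n"
  unfolding rate_def by simp

lemma rate_cube: "0 < n \<Longrightarrow> real n * rate n ^ 3 = 1"
  unfolding rate_def by (simp add: powr_power powr_minus field_simps)

lemma rate_tendsto_0: "rate \<longlonglongrightarrow> 0"
proof -
  have "((\<lambda>x :: real. x powr (- 1 / 3)) \<longlongrightarrow> 0) at_top" by (rule tendsto_neg_powr) (auto simp: filterlim_ident)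
  from filterlim_compose[OF this filterlim_real_sequentially] show ?thesis unfolding rate_def .
qed

lemma eventually_rate_le: "0 < a \<Longrightarrow> \<forall>\<^sub>F n in sequentially. K * rate n \<le> a"
proof -
  assume "0 < a"
  have "(\<lambda>n. K * rate n) \<longlonglongrightarrow> K * 0" by (intro tendsto_intros rate_tendsto_0)
  then have "\<forall>\<^sub>F n in sequentially. K * rate n < a" using \<open>0 < a\<close> by (intro order_tendstoD(2)) auto
  then show ?thesis by (rule eventually_mono) simp
qed

lemma eighth_series: "finite L \<Longrightarrow> (\<Sum>l\<in>L. 1 / 8 ^ l :: real) \<le> 2"
  and half_series: "finite L \<Longrightarrow> (\<Sum>l\<in>L. 1 / 2 ^ l :: real) \<le> 2"
proof -
  assume L: "finite L"
  have "(\<Sum>l\<in>L. (1 / 2) ^ l :: real) \<le> (\<Sum>l. (1 / 2) ^ l)" by (rule sum_le_suminf) (use L in auto)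
  also have "\<dots> = 2" by (simp add: suminf_geometric)
  finally show half: "(\<Sum>l\<in>L. 1 / 2 ^ l :: real) \<le> 2" by (simp add: power_one_over)
  have "(\<Sum>l\<in>L. 1 / 8 ^ l :: real) \<le> (\<Sum>l\<in>L. 1 / 2 ^ l)"
    by (intro sum_mono divide_left_mono power_mono) auto
  with half show "(\<Sum>l\<in>L. 1 / 8 ^ l :: real) \<le> 2" by linarith
qed

lemma finite_dyadic_scales:
  fixes \<rho> \<eta> :: real
  assumes "0 < \<rho>"
  shows "finite {l :: nat. 2 ^ l * \<rho> \<le> \<eta>}"
proof (rule finite_subset)
  show "{l :: nat. 2 ^ l * \<rho> \<le> \<eta>} \<subseteq> {..nat \<lceil>\<eta> / \<rho>\<rceil>}"
  proof
    fix l :: nat assume "l \<in> {l. 2 ^ l * \<rho> \<le> \<eta>}"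
    then have "2 ^ l \<le> \<eta> / \<rho>" using assms by (simp add: field_simps)
    moreover have "real l < 2 ^ l" by (rule of_nat_less_two_power)
    ultimately have "real l \<le> \<eta> / \<rho>" by linarith
    then show "l \<in> {..nat \<lceil>\<eta> / \<rho>\<rceil>}" by simp linarith
  qed
qed simp

text \<open>What the argument uses of the distribution of \<open>(x, \<epsilon>)\<close>. Near the kink \<open>g\<close>, a strip of \<open>q\<close> has
  probability between \<open>c\<^sub>0\<close> and \<open>C\<^sub>0\<close> times its width, and the noise on it a second moment of that
  order. On both sides of \<open>g\<close> the second moment matrix of the regressors is at least \<open>c\<^sub>1\<close>.\<close>

locale kink_sample = mixing_noise P F x \<epsilon>
  for P :: "'w measure" and F and x :: "int \<Rightarrow> 'w \<Rightarrow> real^'k" and \<epsilon> +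
  fixes c j :: 'k and g h\<^sub>0 c\<^sub>0 C\<^sub>0 c\<^sub>1 :: real
  assumes const: "\<And>t \<omega>. \<omega> \<in> space P \<Longrightarrow> x t \<omega> $ c = 1"
    and x4: "integrable P (\<lambda>\<omega>. norm (x 0 \<omega>) ^ 4)"
    and ex4: "integrable P (\<lambda>\<omega>. norm (\<epsilon> 0 \<omega> *\<^sub>R x 0 \<omega>) ^ 4)"
    and h\<^sub>0: "0 < h\<^sub>0" "h\<^sub>0 \<le> 1" and c\<^sub>0: "0 < c\<^sub>0" and C\<^sub>0: "0 \<le> C\<^sub>0" and c\<^sub>1: "0 < c\<^sub>1"
    and strip_low: "\<And>a b. g - h\<^sub>0 \<le> a \<Longrightarrow> a \<le> b \<Longrightarrow> b \<le> g + h\<^sub>0 \<Longrightarrow>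
          c\<^sub>0 * (b - a) \<le> (\<integral>\<omega>. indicator (strip j a b) (x 0 \<omega>) \<partial>P)"
    and strip_up: "\<And>a b. g - h\<^sub>0 \<le> a \<Longrightarrow> a \<le> b \<Longrightarrow> b \<le> g + h\<^sub>0 \<Longrightarrow>
          (\<integral>\<omega>. indicator (strip j a b) (x 0 \<omega>) \<partial>P) \<le> C\<^sub>0 * (b - a)"
    and noise_strip: "\<And>a b i. g - h\<^sub>0 \<le> a \<Longrightarrow> a \<le> b \<Longrightarrow> b \<le> g + h\<^sub>0 \<Longrightarrow>
          (\<integral>\<omega>. (\<epsilon> 0 \<omega> * x 0 \<omega> $ i)\<^sup>2 * indicator (strip j a b) (x 0 \<omega>) \<partial>P) \<le> C\<^sub>0 * (b - a)"
    and no_atoms: "\<And>r. measure P {\<omega>\<in>space P. x 0 \<omega> $ j = r} = 0"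
    and nondegenerate: "\<And>up p. c\<^sub>1 * (norm p)\<^sup>2 \<le> (\<integral>\<omega>. (p \<bullet> x 0 \<omega>)\<^sup>2 * indicator (base up j g) (x 0 \<omega>) \<partial>P)"
begin

text \<open>One constant for all moment conditions of the maximal inequality.\<close>

definition C\<^sub>c :: real where "C\<^sub>c = C\<^sub>0 + (\<integral>\<omega>. norm (\<epsilon> 0 \<omega> *\<^sub>R x 0 \<omega>) ^ 4 \<partial>P)"

lemma C\<^sub>c: "C\<^sub>0 \<le> C\<^sub>c" "0 \<le> C\<^sub>c" "(\<integral>\<omega>. norm (\<epsilon> 0 \<omega> *\<^sub>R x 0 \<omega>) ^ 4 \<partial>P) \<le> C\<^sub>c"
proof -
  have "0 \<le> (\<integral>\<omega>. norm (\<epsilon> 0 \<omega> *\<^sub>R x 0 \<omega>) ^ 4 \<partial>P)" by simp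
  then show "C\<^sub>0 \<le> C\<^sub>c" "0 \<le> C\<^sub>c" "(\<integral>\<omega>. norm (\<epsilon> 0 \<omega> *\<^sub>R x 0 \<omega>) ^ 4 \<partial>P) \<le> C\<^sub>c"
    using C\<^sub>0 unfolding C\<^sub>c_def by auto
qed

lemma norm_x_ge_1: "\<omega> \<in> space P \<Longrightarrow> 1 \<le> norm (x t \<omega>)"
  using component_le_norm_cart[of "x t \<omega>" c] by (simp add: const)

lemma abs_eps_x_le: "\<bar>\<epsilon> 0 \<omega> * x 0 \<omega> $ i\<bar> \<le> norm (\<epsilon> 0 \<omega> *\<^sub>R x 0 \<omega>)"
  unfolding abs_mult by (simp add: mult_left_mono component_le_norm_cart)

lemma eps_x_fourth: "(\<epsilon> 0 \<omega> * x 0 \<omega> $ i) ^ 4 \<le> norm (\<epsilon> 0 \<omega> *\<^sub>R x 0 \<omega>) ^ 4"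
  using power_mono[OF abs_eps_x_le abs_ge_zero, of \<omega> i 4] by simp

lemma eps_x_int4: "integrable P (\<lambda>\<omega>. (\<epsilon> 0 \<omega> * x 0 \<omega> $ i) ^ 4)"
  by (rule Bochner_Integration.integrable_bound[OF ex4]) (measurable, use eps_x_fourth in auto)

lemma eps_x_int2: "integrable P (\<lambda>\<omega>. (\<epsilon> 0 \<omega> * x 0 \<omega> $ i)\<^sup>2)"
  by (rule square_integrable_imp_integrable) (use eps_x_int4[of i] in simp_all)

lemma eps_x_int1: "integrable P (\<lambda>\<omega>. \<epsilon> 0 \<omega> * x 0 \<omega> $ i)"
  by (rule square_integrable_imp_integrable) (use eps_x_int2[of i] in simp_all)

lemma eps_int: "integrable P (\<epsilon> 0)"
proof -
  have "integrable P (\<lambda>\<omega>. \<epsilon> 0 \<omega> * x 0 \<omega> $ c) = integrable P (\<epsilon> 0)"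
    by (rule Bochner_Integration.integrable_cong) (auto simp: const)
  then show ?thesis using eps_x_int1 by simp
qed

lemma abs_eps_z_le:
  assumes "\<omega> \<in> space P"
  shows "\<bar>\<epsilon> 0 \<omega> * (x 0 \<omega> $ j - g)\<bar> \<le> (1 + \<bar>g\<bar>) * norm (\<epsilon> 0 \<omega> *\<^sub>R x 0 \<omega>)"
proof -
  have "\<bar>x 0 \<omega> $ j - g\<bar> \<le> norm (x 0 \<omega>) + \<bar>g\<bar> * 1"
    using component_le_norm_cart[of "x 0 \<omega>" j] by simp
  also have "\<dots> \<le> norm (x 0 \<omega>) + \<bar>g\<bar> * norm (x 0 \<omega>)"
    using norm_x_ge_1[OF assms] by (intro add_left_mono mult_left_mono) auto
  finally have "\<bar>\<epsilon> 0 \<omega>\<bar> * \<bar>x 0 \<omega> $ j - g\<bar> \<le> \<bar>\<epsilon> 0 \<omega>\<bar> * (norm (x 0 \<omega>) + \<bar>g\<bar> * norm (x 0 \<omega>))"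
    by (intro mult_left_mono) auto
  also have "\<dots> = (1 + \<bar>g\<bar>) * norm (\<epsilon> 0 \<omega> *\<^sub>R x 0 \<omega>)" by (simp add: algebra_simps)
  finally show ?thesis unfolding abs_mult .
qed

lemma eps_z_int4: "integrable P (\<lambda>\<omega>. (\<epsilon> 0 \<omega> * (x 0 \<omega> $ j - g)) ^ 4)"
proof (rule Bochner_Integration.integrable_bound)
  show "integrable P (\<lambda>\<omega>. (1 + \<bar>g\<bar>) ^ 4 * norm (\<epsilon> 0 \<omega> *\<^sub>R x 0 \<omega>) ^ 4)" using ex4 by simp
  show "AE \<omega> in P. norm ((\<epsilon> 0 \<omega> * (x 0 \<omega> $ j - g)) ^ 4) \<le> norm ((1 + \<bar>g\<bar>) ^ 4 * norm (\<epsilon> 0 \<omega> *\<^sub>R x 0 \<omega>) ^ 4)"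
  proof (rule AE_I2)
    fix \<omega> assume "\<omega> \<in> space P"
    from power_mono[OF abs_eps_z_le[OF this] abs_ge_zero, of 4]
    show "norm ((\<epsilon> 0 \<omega> * (x 0 \<omega> $ j - g)) ^ 4) \<le> norm ((1 + \<bar>g\<bar>) ^ 4 * norm (\<epsilon> 0 \<omega> *\<^sub>R x 0 \<omega>) ^ 4)"
      by (simp add: power_mult_distrib)
  qed
qed measurable

lemma eps_z_int2: "integrable P (\<lambda>\<omega>. (\<epsilon> 0 \<omega> * (x 0 \<omega> $ j - g))\<^sup>2)"
  by (rule square_integrable_imp_integrable) (use eps_z_int4 in simp_all)

lemma cell_strip:
  assumes "0 \<le> s" "s \<le> s'" "s' \<le> h\<^sub>0"
  obtains a b where "band up j g s' - band up j g s = strip j a b" "g - h\<^sub>0 \<le> a" "a \<le> b" "b \<le> g + h\<^sub>0" "b - a = s' - s"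
  using band_diff_strip[OF assms(1,2), of up j g] assms
  by (intro that[of "if up then g + s else g - s'" "if up then g + s' else g - s"]) auto

lemma integrable_indicator_x:
  assumes [measurable]: "A \<in> sets borel"
  shows "integrable P (\<lambda>\<omega>. indicator A (x 0 \<omega>) :: real)"
  by (rule integrable_const_bound[where B = 1]) (auto simp: indicator_def)

lemma integrable_times_indicator:
  assumes "integrable P h" and [measurable]: "A \<in> sets borel"
  shows "integrable P (\<lambda>\<omega>. h \<omega> * indicator A (x 0 \<omega>) :: real)"
proof -
  have [measurable]: "h \<in> borel_measurable P" using assms(1) by auto
  show ?thesis
    by (rule Bochner_Integration.integrable_bound[OF assms(1)]) (measurable, auto simp: indicator_def)
qed

lemma cell_second_moment:
  assumes "0 \<le> s" "s \<le> s'" "s' \<le> h\<^sub>0"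
  shows "(\<integral>\<omega>. (\<epsilon> 0 \<omega> * x 0 \<omega> $ i)\<^sup>2 * indicator (band up j g s' - band up j g s) (x 0 \<omega>) \<partial>P) \<le> C\<^sub>0 * (s' - s)"
proof -
  obtain a b where ab: "band up j g s' - band up j g s = strip j a b" "g - h\<^sub>0 \<le> a" "a \<le> b" "b \<le> g + h\<^sub>0" "b - a = s' - s"
    by (rule cell_strip[OF assms])
  show ?thesis unfolding ab(1) ab(5)[symmetric] by (rule noise_strip) fact+
qed

lemma cell_first_moment:
  assumes "0 \<le> s" "s \<le> s'" "s' \<le> h\<^sub>0"
  shows "(\<integral>\<omega>. \<bar>\<epsilon> 0 \<omega> * x 0 \<omega> $ i\<bar> * indicator (band up j g s' - band up j g s) (x 0 \<omega>) \<partial>P) \<le> C\<^sub>0 * (s' - s)"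
proof -
  obtain a b where ab: "band up j g s' - band up j g s = strip j a b" "g - h\<^sub>0 \<le> a" "a \<le> b" "b \<le> g + h\<^sub>0" "b - a = s' - s"
    by (rule cell_strip[OF assms])
  let ?A = "strip j a b"
  have i2: "integrable P (\<lambda>\<omega>. (\<epsilon> 0 \<omega> * x 0 \<omega> $ i)\<^sup>2 * indicator ?A (x 0 \<omega>))"
    by (rule integrable_times_indicator[OF eps_x_int2 strip_measurable])
  have i0: "integrable P (\<lambda>\<omega>. indicator ?A (x 0 \<omega>) :: real)" by (rule integrable_indicator_x[OF strip_measurable])
  have "(\<integral>\<omega>. \<bar>\<epsilon> 0 \<omega> * x 0 \<omega> $ i\<bar> * indicator ?A (x 0 \<omega>) \<partial>P)
     \<le> (\<integral>\<omega>. (indicator ?A (x 0 \<omega>) + (\<epsilon> 0 \<omega> * x 0 \<omega> $ i)\<^sup>2 * indicator ?A (x 0 \<omega>)) / 2 \<partial>P)"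
  proof (rule integral_mono)
    show "integrable P (\<lambda>\<omega>. \<bar>\<epsilon> 0 \<omega> * x 0 \<omega> $ i\<bar> * indicator ?A (x 0 \<omega>))"
      by (rule integrable_times_indicator[OF integrable_abs[OF eps_x_int1] strip_measurable])
    have "\<bar>u\<bar> \<le> (1 + u\<^sup>2) / 2" for u :: real
      using zero_le_power2[of "\<bar>u\<bar> - 1"] by (simp add: power2_diff)
    then show "\<bar>\<epsilon> 0 \<omega> * x 0 \<omega> $ i\<bar> * indicator ?A (x 0 \<omega>)
      \<le> (indicator ?A (x 0 \<omega>) + (\<epsilon> 0 \<omega> * x 0 \<omega> $ i)\<^sup>2 * indicator ?A (x 0 \<omega>)) / 2" for \<omega>
      by (simp add: indicator_def)
  qed (use i0 i2 in auto)
  also have "\<dots> = ((\<integral>\<omega>. indicator ?A (x 0 \<omega>) \<partial>P) + (\<integral>\<omega>. (\<epsilon> 0 \<omega> * x 0 \<omega> $ i)\<^sup>2 * indicator ?A (x 0 \<omega>) \<partial>P)) / 2"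
    using i0 i2 by simp
  also have "\<dots> \<le> C\<^sub>0 * (s' - s)"
    using strip_up[OF ab(2-4)] noise_strip[OF ab(2-4), of i] unfolding ab(5) by simp
  finally show ?thesis unfolding ab(1) .
qed

lemma chain_x:
  assumes "0 < \<eta>" "\<eta> \<le> h\<^sub>0" "1 \<le> real n * \<eta> ^ 3" "1 \<le> T"
  shows "likely P (chain_const C\<^sub>c / T\<^sup>2)
    (\<lambda>\<omega>. \<forall>s\<in>{0..\<eta>}. \<bar>noise_sum n (\<lambda>v. v $ i) (band up j g s) \<omega>\<bar> \<le> (C\<^sub>c + 11) * (T * 1 * sqrt (n * \<eta>)))"
proof (rule chaining[where W = "band up j g" and w = "\<lambda>v. v $ i", OF band_measurable band_mono band_0 vec_nth_measurable eps_x_int4 eps_x_int2 eps_int])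
  fix s s' :: real assume s: "0 \<le> s" "s \<le> s'" "s' \<le> \<eta>"
  then have s': "s' \<le> h\<^sub>0" using assms by simp
  have "C\<^sub>0 * (s' - s) \<le> C\<^sub>c * (s' - s)" using C\<^sub>c s by (intro mult_right_mono) auto
  then show "(\<integral>\<omega>. \<bar>\<epsilon> 0 \<omega> * x 0 \<omega> $ i\<bar> * indicator (band up j g s' - band up j g s) (x 0 \<omega>) \<partial>P) \<le> C\<^sub>c * 1 * (s' - s)"
    "(\<integral>\<omega>. (\<epsilon> 0 \<omega> * x 0 \<omega> $ i)\<^sup>2 * indicator (band up j g s' - band up j g s) (x 0 \<omega>) \<partial>P) \<le> C\<^sub>c * 1\<^sup>2 * (s' - s)"
    using cell_first_moment[OF s(1,2) s', of i up] cell_second_moment[OF s(1,2) s', of i up] by simp_all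
next
  have "(\<integral>\<omega>. (\<epsilon> 0 \<omega> * x 0 \<omega> $ i) ^ 4 * indicator (band up j g \<eta>) (x 0 \<omega>) \<partial>P) \<le> (\<integral>\<omega>. norm (\<epsilon> 0 \<omega> *\<^sub>R x 0 \<omega>) ^ 4 \<partial>P)"
    by (rule integral_mono[OF integrable_times_indicator[OF eps_x_int4 band_measurable] ex4])
       (use eps_x_fourth in \<open>auto simp: indicator_def\<close>)
  then show "(\<integral>\<omega>. (\<epsilon> 0 \<omega> * x 0 \<omega> $ i) ^ 4 * indicator (band up j g \<eta>) (x 0 \<omega>) \<partial>P) \<le> C\<^sub>c * 1 ^ 4"
    using C\<^sub>c(3) by simp
qed (use assms h\<^sub>0 C\<^sub>c in auto)

text \<open>On a band of width \<open>\<eta>\<close> the weight \<open>q - g\<close> is at most \<open>\<eta>\<close>, so the maximal inequality applies at scale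
  \<open>b = \<eta>\<close> and gives \<open>\<surd>n \<eta>\<^sup>3\<^sup>/\<^sup>2\<close>: the continuity of the regression function shrinks the noise near
  the kink. The constant regressor bounds the moments of \<open>\<epsilon>\<close> itself.\<close>

lemma chain_z:
  assumes "0 < \<eta>" "\<eta> \<le> h\<^sub>0" "1 \<le> real n * \<eta> ^ 3" "1 \<le> T"
  shows "likely P (chain_const C\<^sub>c / T\<^sup>2)
    (\<lambda>\<omega>. \<forall>s\<in>{0..\<eta>}. \<bar>noise_sum n (\<lambda>v. v $ j - g) (band up j g s) \<omega>\<bar> \<le> (C\<^sub>c + 11) * (T * \<eta> * sqrt (n * \<eta>)))"
proof (rule chaining[where W = "band up j g" and w = "\<lambda>v. v $ j - g", OF band_measurable band_mono band_0 _ eps_z_int4 eps_z_int2 eps_int])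
  fix s s' :: real assume s: "0 \<le> s" "s \<le> s'" "s' \<le> \<eta>"
  then have s': "s' \<le> h\<^sub>0" using assms by simp
  let ?A = "band up j g s' - band up j g s"
  have A[measurable]: "?A \<in> sets borel" by simp
  have le: "C\<^sub>0 * (s' - s) \<le> C\<^sub>c * (s' - s)" using C\<^sub>c s by (intro mult_right_mono) auto
  have pt: "\<bar>\<epsilon> 0 \<omega> * (x 0 \<omega> $ j - g)\<bar> \<le> \<eta> * \<bar>\<epsilon> 0 \<omega> * x 0 \<omega> $ c\<bar>" if "x 0 \<omega> \<in> band up j g \<eta>" "\<omega> \<in> space P" for \<omega>
    using mult_left_mono[OF band_dist[OF that(1)], of "\<bar>\<epsilon> 0 \<omega>\<bar>"] that(2) by (simp add: const abs_mult mult.commute)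
  have sub: "?A \<subseteq> band up j g \<eta>" using band_mono[OF s(3), of up j g] by auto
  have "(\<integral>\<omega>. \<bar>\<epsilon> 0 \<omega> * (x 0 \<omega> $ j - g)\<bar> * indicator ?A (x 0 \<omega>) \<partial>P)
     \<le> (\<integral>\<omega>. \<eta> * (\<bar>\<epsilon> 0 \<omega> * x 0 \<omega> $ c\<bar> * indicator ?A (x 0 \<omega>)) \<partial>P)"
  proof (rule integral_mono)
    have "integrable P (\<lambda>\<omega>. \<epsilon> 0 \<omega> * (x 0 \<omega> $ j - g))"
      by (rule square_integrable_imp_integrable[OF _ eps_z_int2]) measurable
    then show "integrable P (\<lambda>\<omega>. \<bar>\<epsilon> 0 \<omega> * (x 0 \<omega> $ j - g)\<bar> * indicator ?A (x 0 \<omega>))"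
      by (intro integrable_times_indicator[OF integrable_abs A])
    show "integrable P (\<lambda>\<omega>. \<eta> * (\<bar>\<epsilon> 0 \<omega> * x 0 \<omega> $ c\<bar> * indicator ?A (x 0 \<omega>)))"
      by (intro integrable_mult_right integrable_times_indicator[OF integrable_abs[OF eps_x_int1] A])
  qed (use pt sub in \<open>auto simp: indicator_def\<close>)
  also have "\<dots> = \<eta> * (\<integral>\<omega>. \<bar>\<epsilon> 0 \<omega> * x 0 \<omega> $ c\<bar> * indicator ?A (x 0 \<omega>) \<partial>P)" by simp
  also have "\<dots> \<le> \<eta> * (C\<^sub>c * (s' - s))"
    using cell_first_moment[OF s(1,2) s', of c up] le assms by (intro mult_left_mono) auto
  finally show "(\<integral>\<omega>. \<bar>\<epsilon> 0 \<omega> * (x 0 \<omega> $ j - g)\<bar> * indicator ?A (x 0 \<omega>) \<partial>P) \<le> C\<^sub>c * \<eta> * (s' - s)"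
    by (simp add: mult_ac)
  have "(\<integral>\<omega>. (\<epsilon> 0 \<omega> * (x 0 \<omega> $ j - g))\<^sup>2 * indicator ?A (x 0 \<omega>) \<partial>P)
     \<le> (\<integral>\<omega>. \<eta>\<^sup>2 * ((\<epsilon> 0 \<omega> * x 0 \<omega> $ c)\<^sup>2 * indicator ?A (x 0 \<omega>)) \<partial>P)"
  proof (rule integral_mono)
    show "integrable P (\<lambda>\<omega>. (\<epsilon> 0 \<omega> * (x 0 \<omega> $ j - g))\<^sup>2 * indicator ?A (x 0 \<omega>))"
      by (rule integrable_times_indicator[OF eps_z_int2 A])
    show "integrable P (\<lambda>\<omega>. \<eta>\<^sup>2 * ((\<epsilon> 0 \<omega> * x 0 \<omega> $ c)\<^sup>2 * indicator ?A (x 0 \<omega>)))"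
      by (intro integrable_mult_right integrable_times_indicator[OF eps_x_int2 A])
    fix \<omega> assume w: "\<omega> \<in> space P"
    show "(\<epsilon> 0 \<omega> * (x 0 \<omega> $ j - g))\<^sup>2 * indicator ?A (x 0 \<omega>) \<le> \<eta>\<^sup>2 * ((\<epsilon> 0 \<omega> * x 0 \<omega> $ c)\<^sup>2 * indicator ?A (x 0 \<omega>))"
    proof (cases "x 0 \<omega> \<in> ?A")
      case True
      then have "x 0 \<omega> \<in> band up j g \<eta>" using sub by blast
      from power_mono[OF pt[OF this w] abs_ge_zero, of 2] True show ?thesis by (simp add: power_mult_distrib)
    qed simp
  qed
  also have "\<dots> = \<eta>\<^sup>2 * (\<integral>\<omega>. (\<epsilon> 0 \<omega> * x 0 \<omega> $ c)\<^sup>2 * indicator ?A (x 0 \<omega>) \<partial>P)" by simp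
  also have "\<dots> \<le> \<eta>\<^sup>2 * (C\<^sub>c * (s' - s))"
    using cell_second_moment[OF s(1,2) s', of c up] le by (intro mult_left_mono) auto
  finally show "(\<integral>\<omega>. (\<epsilon> 0 \<omega> * (x 0 \<omega> $ j - g))\<^sup>2 * indicator ?A (x 0 \<omega>) \<partial>P) \<le> C\<^sub>c * \<eta>\<^sup>2 * (s' - s)"
    by (simp add: mult_ac)
next
  have "(\<integral>\<omega>. (\<epsilon> 0 \<omega> * (x 0 \<omega> $ j - g)) ^ 4 * indicator (band up j g \<eta>) (x 0 \<omega>) \<partial>P)
     \<le> (\<integral>\<omega>. \<eta> ^ 4 * norm (\<epsilon> 0 \<omega> *\<^sub>R x 0 \<omega>) ^ 4 \<partial>P)"
  proof (rule integral_mono[OF integrable_times_indicator[OF eps_z_int4 band_measurable]])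
    show "integrable P (\<lambda>\<omega>. \<eta> ^ 4 * norm (\<epsilon> 0 \<omega> *\<^sub>R x 0 \<omega>) ^ 4)" using ex4 by simp
    fix \<omega> assume w: "\<omega> \<in> space P"
    show "(\<epsilon> 0 \<omega> * (x 0 \<omega> $ j - g)) ^ 4 * indicator (band up j g \<eta>) (x 0 \<omega>) \<le> \<eta> ^ 4 * norm (\<epsilon> 0 \<omega> *\<^sub>R x 0 \<omega>) ^ 4"
    proof (cases "x 0 \<omega> \<in> band up j g \<eta>")
      case True
      have "\<bar>\<epsilon> 0 \<omega> * (x 0 \<omega> $ j - g)\<bar> \<le> \<eta> * \<bar>\<epsilon> 0 \<omega>\<bar>"
        using mult_left_mono[OF band_dist[OF True], of "\<bar>\<epsilon> 0 \<omega>\<bar>"] by (simp add: abs_mult mult.commute)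
      also have "\<dots> \<le> \<eta> * norm (\<epsilon> 0 \<omega> *\<^sub>R x 0 \<omega>)"
        using mult_left_mono[OF norm_x_ge_1[OF w], of "\<bar>\<epsilon> 0 \<omega>\<bar>" 0] assms by (intro mult_left_mono) auto
      finally have "\<bar>\<epsilon> 0 \<omega> * (x 0 \<omega> $ j - g)\<bar> ^ 4 \<le> (\<eta> * norm (\<epsilon> 0 \<omega> *\<^sub>R x 0 \<omega>)) ^ 4"
        by (rule power_mono) simp
      then show ?thesis using True by (simp add: power_mult_distrib)
    qed simp
  qed
  also have "\<dots> \<le> C\<^sub>c * \<eta> ^ 4" using mult_left_mono[OF C\<^sub>c(3), of "\<eta> ^ 4"] by (simp add: mult.commute)
  finally show "(\<integral>\<omega>. (\<epsilon> 0 \<omega> * (x 0 \<omega> $ j - g)) ^ 4 * indicator (band up j g \<eta>) (x 0 \<omega>) \<partial>P) \<le> C\<^sub>c * \<eta> ^ 4" .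
qed (use assms h\<^sub>0 C\<^sub>c in \<open>auto intro: borel_measurable_diff\<close>)

lemma chain_const_nonneg: "0 \<le> chain_const C\<^sub>c"
  unfolding chain_const_def using C\<^sub>c mix_const_ge by simp

lemma noise_band_bounded:
  assumes "0 < \<eta>" "\<eta> \<le> h\<^sub>0" "0 < e"
  shows "\<exists>T\<ge>1. \<forall>\<^sub>F n in sequentially. likely P e
    (\<lambda>\<omega>. \<forall>s\<in>{0..\<eta>}. \<bar>noise_sum n (\<lambda>v. v $ i) (band up j g s) \<omega>\<bar> \<le> T * sqrt n)"
proof -
  define T where "T = 1 + chain_const C\<^sub>c / e"
  have T1: "1 \<le> T" unfolding T_def using chain_const_nonneg assms by simp
  have "chain_const C\<^sub>c / e \<le> T" unfolding T_def by simp
  also have "T \<le> T\<^sup>2" using T1 by (simp add: power2_eq_square)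
  finally have T2: "chain_const C\<^sub>c / T\<^sup>2 \<le> e" using assms T1 by (simp add: divide_le_eq mult.commute)
  have T': "1 \<le> (C\<^sub>c + 11) * T" using C\<^sub>c T1 mult_mono[of 1 "C\<^sub>c + 11" 1 T] by simp
  have "\<forall>\<^sub>F n in sequentially. 1 / \<eta> ^ 3 / real n \<le> 1" by (rule eventually_div_le) simp
  then have "\<forall>\<^sub>F n in sequentially. likely P e
    (\<lambda>\<omega>. \<forall>s\<in>{0..\<eta>}. \<bar>noise_sum n (\<lambda>v. v $ i) (band up j g s) \<omega>\<bar> \<le> (C\<^sub>c + 11) * T * sqrt n)"
    using eventually_gt_at_top[of 0]
  proof eventually_elim
    case (elim n)
    then have n: "1 \<le> n * \<eta> ^ 3" using assms by (simp add: field_simps)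
    have "sqrt (n * \<eta>) \<le> sqrt n" using assms h\<^sub>0 by (simp add: mult_left_le)
    then have le: "(C\<^sub>c + 11) * (T * 1 * sqrt (n * \<eta>)) \<le> (C\<^sub>c + 11) * T * sqrt n"
      using C\<^sub>c T1 by (simp add: mult.assoc mult_left_mono)
    show ?case
    proof (rule likely_mono[OF chain_x[where i = i and up = up, OF assms(1,2) n T1] T2])
      fix \<omega> assume H: "\<forall>s\<in>{0..\<eta>}. \<bar>noise_sum n (\<lambda>v. v $ i) (band up j g s) \<omega>\<bar> \<le> (C\<^sub>c + 11) * (T * 1 * sqrt (n * \<eta>))"
      show "\<forall>s\<in>{0..\<eta>}. \<bar>noise_sum n (\<lambda>v. v $ i) (band up j g s) \<omega>\<bar> \<le> (C\<^sub>c + 11) * T * sqrt n"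
        by (rule ballI) (rule order_trans[OF bspec[OF H] le])
    qed
  qed
  then show ?thesis using T' by blast
qed

text \<open>The noise on a band of width \<open>s\<close> is of order \<open>\<surd>(n s\<^sup>3)\<close>, which is small against \<open>n s\<^sup>3\<close> as soon as
  \<open>s\<close> exceeds a large multiple \<open>K\<close> of the rate. To have this for all \<open>s\<close> at once, the maximal inequality is
  applied on the dyadic scales \<open>2\<^sup>l K rate n\<close>. The failure probabilities decay like \<open>8\<^sup>-\<^sup>l / K\<^sup>3\<close>.\<close>

lemma noise_kink_peeling:
  fixes \<eta> \<kappa> e :: real
  assumes "0 < \<eta>" "2 * \<eta> \<le> h\<^sub>0" "0 < \<kappa>" "0 < e"
  shows "\<exists>K\<ge>1. \<forall>\<^sub>F n in sequentially. likely P e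
    (\<lambda>\<omega>. \<forall>s\<in>{0..\<eta>}. \<bar>noise_sum n (\<lambda>v. v $ j - g) (band up j g s) \<omega>\<bar> \<le> \<kappa> * n * (max s (K * rate n)) ^ 3)"
proof -
  define \<kappa>' where "\<kappa>' = \<kappa> / (8 * (C\<^sub>c + 11))"
  have k': "0 < \<kappa>'" unfolding \<kappa>'_def using assms C\<^sub>c by simp
  define K where "K = 1 + (1 + 2 * chain_const C\<^sub>c / e) / \<kappa>'\<^sup>2"
  have R0: "0 \<le> 2 * chain_const C\<^sub>c / e" using chain_const_nonneg assms by simp
  have K1: "1 \<le> K" unfolding K_def using R0 k' by simp
  have KK: "1 + 2 * chain_const C\<^sub>c / e \<le> \<kappa>'\<^sup>2 * K ^ 3"
  proof -
    have "1 + 2 * chain_const C\<^sub>c / e \<le> \<kappa>'\<^sup>2 * K" unfolding K_def using k' by (simp add: field_simps)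
    also have "\<dots> \<le> \<kappa>'\<^sup>2 * K ^ 3" using K1 power_increasing[of 1 3 K] by (intro mult_left_mono) auto
    finally show ?thesis .
  qed
  have "\<forall>\<^sub>F n in sequentially. K * rate n \<le> 2 * \<eta>" by (rule eventually_rate_le) (use assms in simp)
  then have "\<forall>\<^sub>F n in sequentially. likely P e
    (\<lambda>\<omega>. \<forall>s\<in>{0..\<eta>}. \<bar>noise_sum n (\<lambda>v. v $ j - g) (band up j g s) \<omega>\<bar> \<le> \<kappa> * n * (max s (K * rate n)) ^ 3)"
    using eventually_gt_at_top[of 0]
  proof eventually_elim
    case (elim n)
    define \<rho> where "\<rho> = K * rate n"
    have rho: "0 < \<rho>" "\<rho> \<le> 2 * \<eta>" "n * \<rho> ^ 3 = K ^ 3"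
      using elim K1 rate_pos[of n] rate_cube[of n] unfolding \<rho>_def by (auto simp: power_mult_distrib)
    define L where "L = {l :: nat. 2 ^ l * \<rho> \<le> 2 * \<eta>}"
    have L: "finite L" unfolding L_def by (rule finite_dyadic_scales[OF rho(1)])
    define S where "S l = 2 ^ l * \<rho>" for l :: nat
    have S: "0 < S l" "n * S l ^ 3 = 8 ^ l * K ^ 3" for l
    proof -
      show "0 < S l" unfolding S_def using rho by simp
      have "n * S l ^ 3 = (2 ^ l) ^ 3 * (n * \<rho> ^ 3)" unfolding S_def by (simp add: power_mult_distrib)
      also have "(2 ^ l) ^ 3 = (8 :: real) ^ l"
        by (simp add: power_mult[symmetric] mult.commute[of l]) (simp add: power_mult)
      finally show "n * S l ^ 3 = 8 ^ l * K ^ 3" using rho by simp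
    qed
    \<comment> \<open>With this level the maximal inequality on scale \<open>S l\<close> yields exactly
      \<open>\<kappa>/8\<close> times the signal; the 8 pays for passing from s to a scale up to 2 s.\<close>
    define T where "T l = \<kappa>' * sqrt (n * S l ^ 3)" for l
    have T2: "(T l)\<^sup>2 = \<kappa>'\<^sup>2 * (8 ^ l * K ^ 3)" for l
      unfolding T_def S(2) using K1 by (simp add: power_mult_distrib)
    have T2_ge: "8 ^ l * (1 + 2 * chain_const C\<^sub>c / e) \<le> (T l)\<^sup>2" for l
      unfolding T2 using mult_left_mono[OF KK, of "8 ^ l"] by (simp add: mult_ac)
    have T1: "1 \<le> T l" for l
    proof (rule power2_le_imp_le)
      have "1 * 1 \<le> 8 ^ l * (1 + 2 * chain_const C\<^sub>c / e)" using R0 by (intro mult_mono) auto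
      then show "1\<^sup>2 \<le> (T l)\<^sup>2" using T2_ge[of l] by simp
      show "0 \<le> T l" unfolding T_def using k' S(1)[of l] by simp
    qed
    have bound: "(C\<^sub>c + 11) * (T l * S l * sqrt (n * S l)) = \<kappa> / 8 * (n * S l ^ 3)" for l
    proof -
      have "sqrt (n * S l ^ 3) * sqrt (n * S l) = sqrt ((n * S l ^ 2)\<^sup>2)"
        by (simp add: power2_eq_square power3_eq_cube mult_ac flip: real_sqrt_mult)
      also have "\<dots> = n * S l ^ 2" using S(1)[of l] by simp
      finally have "T l * S l * sqrt (n * S l) = \<kappa>' * (n * S l ^ 3)"
        unfolding T_def by (simp add: power2_eq_square power3_eq_cube mult_ac)
      then have "(C\<^sub>c + 11) * (T l * S l * sqrt (n * S l)) = (C\<^sub>c + 11) * \<kappa>' * (n * S l ^ 3)" by simp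
      also have "(C\<^sub>c + 11) * \<kappa>' = \<kappa> / 8" unfolding \<kappa>'_def using C\<^sub>c by (simp add: field_simps)
      finally show ?thesis .
    qed
    have "likely P (\<Sum>l\<in>L. chain_const C\<^sub>c / (T l)\<^sup>2) (\<lambda>\<omega>. \<forall>l\<in>L. \<forall>s\<in>{0..S l}.
       \<bar>noise_sum n (\<lambda>v. v $ j - g) (band up j g s) \<omega>\<bar> \<le> (C\<^sub>c + 11) * (T l * S l * sqrt (n * S l)))"
    proof (intro likely_ball L chain_z S(1) T1)
      fix l assume "l \<in> L"
      then show "S l \<le> h\<^sub>0" using assms by (simp add: L_def S_def)
      have "1 * 1 \<le> 8 ^ l * K ^ 3" using K1 by (intro mult_mono) auto
      then show "1 \<le> n * S l ^ 3" unfolding S(2) by simp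
    qed
    moreover have "(\<Sum>l\<in>L. chain_const C\<^sub>c / (T l)\<^sup>2) \<le> e"
    proof -
      have "chain_const C\<^sub>c / (T l)\<^sup>2 \<le> e / 2 * (1 / 8 ^ l)" for l
      proof -
        have "8 ^ l * (2 * chain_const C\<^sub>c / e) \<le> 8 ^ l * (1 + 2 * chain_const C\<^sub>c / e)"
          by (intro mult_left_mono) auto
        then have "8 ^ l * (2 * chain_const C\<^sub>c / e) \<le> (T l)\<^sup>2" using T2_ge[of l] by linarith
        then have "chain_const C\<^sub>c \<le> e / 2 * (1 / 8 ^ l) * (T l)\<^sup>2" using assms by (simp add: field_simps)
        moreover have "0 < (T l)\<^sup>2" using T1[of l] by simp
        ultimately show ?thesis by (simp add: pos_divide_le_eq)
      qed
      then have "(\<Sum>l\<in>L. chain_const C\<^sub>c / (T l)\<^sup>2) \<le> (\<Sum>l\<in>L. e / 2 * (1 / 8 ^ l))" by (intro sum_mono)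
      also have "\<dots> = e / 2 * (\<Sum>l\<in>L. 1 / 8 ^ l)" by (simp only: sum_distrib_left)
      also have "\<dots> \<le> e / 2 * 2" using eighth_series[OF L] assms by (intro mult_left_mono) auto
      finally show ?thesis by simp
    qed
    ultimately show ?case
    proof (rule likely_mono)
      fix \<omega> assume H: "\<forall>l\<in>L. \<forall>s\<in>{0..S l}.
       \<bar>noise_sum n (\<lambda>v. v $ j - g) (band up j g s) \<omega>\<bar> \<le> (C\<^sub>c + 11) * (T l * S l * sqrt (n * S l))"
      show "\<forall>s\<in>{0..\<eta>}. \<bar>noise_sum n (\<lambda>v. v $ j - g) (band up j g s) \<omega>\<bar> \<le> \<kappa> * n * (max s (K * rate n)) ^ 3"
      proof
        fix s assume s: "s \<in> {0..\<eta>}"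
        \<comment> \<open>The scale is the dyadic one just above s, at least the smallest one.\<close>
        obtain l where l: "l \<in> L" "s \<le> S l" "S l \<le> 2 * max s \<rho>"
        proof (cases "s \<le> \<rho>")
          case True
          then show ?thesis using that[of 0] rho by (simp add: L_def S_def max_def)
        next
          case False
          then have "1 \<le> s / \<rho>" using rho by (simp add: field_simps)
          then obtain l where "2 ^ l \<le> s / \<rho>" "s / \<rho> < 2 ^ Suc l" using ex_dyadic_floor by blast
          then have "2 ^ l * \<rho> \<le> s" "s < 2 ^ Suc l * \<rho>" using rho by (auto simp: field_simps)
          then show ?thesis using that[of "Suc l"] s False by (simp add: L_def S_def max_def)
        qed
        have "\<bar>noise_sum n (\<lambda>v. v $ j - g) (band up j g s) \<omega>\<bar> \<le> \<kappa> / 8 * (n * S l ^ 3)"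
          using H l(1,2) s unfolding bound by auto
        also have "\<dots> \<le> \<kappa> / 8 * (n * (2 * max s \<rho>) ^ 3)"
          using assms l(3) S(1)[of l] by (intro mult_left_mono power_mono) auto
        also have "\<dots> = \<kappa> * n * (max s (K * rate n)) ^ 3"
          unfolding \<rho>_def[symmetric] by (simp add: power_mult_distrib)
        finally show "\<bar>noise_sum n (\<lambda>v. v $ j - g) (band up j g s) \<omega>\<bar> \<le> \<kappa> * n * (max s (K * rate n)) ^ 3" .
      qed
    qed
  qed
  then show ?thesis using K1 by blast
qed

text \<open>The signal on a band: about \<open>n s\<close> observations at distance about \<open>s\<close> contribute \<open>n s\<^sup>3\<close>. On each dyadic
  scale it suffices to count the observations in the outer half of the band, by Chebyshev's inequality.\<close>

lemma band_occupation:
  fixes \<eta> K e :: real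
  assumes "0 < \<eta>" "\<eta> \<le> h\<^sub>0" "1 \<le> K" "0 < e"
  shows "\<forall>\<^sub>F n in sequentially. likely P e (\<lambda>\<omega>. \<forall>s\<in>{K * rate n..\<eta>}.
     c\<^sub>0 / 128 * n * s ^ 3 \<le> (\<Sum>t\<in>{1..int n}. (x t \<omega> $ j - g)\<^sup>2 * indicator (band up j g s) (x t \<omega>)))"
proof -
  define A where "A = 8 * mix_const * C\<^sub>0 / c\<^sub>0\<^sup>2"
  have A0: "0 \<le> A" unfolding A_def using mix_const_ge C\<^sub>0 by simp
  have "\<forall>\<^sub>F n in sequentially. 2 * A * rate n \<le> e" by (rule eventually_rate_le) fact
  moreover have "\<forall>\<^sub>F n in sequentially. 1 * rate n \<le> 1" by (rule eventually_rate_le) simp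
  ultimately show ?thesis using eventually_gt_at_top[of 0]
  proof eventually_elim
    case (elim n)
    define \<rho> where "\<rho> = K * rate n"
    have r0: "0 < rate n" using rate_pos[of n] elim by simp
    have rho: "0 < \<rho>" unfolding \<rho>_def using r0 assms by simp
    have n_rho: "1 / (n * \<rho>) \<le> rate n"
    proof -
      have "1 = n * rate n ^ 3" using rate_cube[of n] elim by simp
      also have "\<dots> = n * rate n * (rate n * rate n)" by (simp add: power3_eq_cube)
      also have "\<dots> \<le> n * \<rho> * (1 * rate n)"
        using r0 elim assms unfolding \<rho>_def by (intro mult_mono) auto
      finally show ?thesis using rho elim by (simp add: divide_le_eq mult_ac)
    qed
    define L where "L = {l :: nat. 2 ^ l * \<rho> \<le> \<eta>}"
    have L: "finite L" unfolding L_def by (rule finite_dyadic_scales[OF rho(1)])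
    define S where "S l = 2 ^ l * \<rho>" for l :: nat
    have S: "0 < S l" for l unfolding S_def using rho by simp
    define cell where "cell l = band up j g (S l) - band up j g (S l / 2)" for l
    have cell_meas[measurable]: "cell l \<in> sets borel" for l unfolding cell_def by simp
    define \<phi> where "\<phi> l z = (indicator (cell l) (fst z) :: real)" for l and z :: "(real^'k) \<times> real"
    have \<phi>_meas: "\<phi> l \<in> borel_measurable borel" for l
      unfolding \<phi>_def borel_prod[symmetric] by measurable
    have \<phi>_sq: "(\<phi> l z)\<^sup>2 = \<phi> l z" for l z unfolding \<phi>_def by (simp add: indicator_def)
    have \<phi>_int: "integrable P (\<lambda>\<omega>. (\<phi> l (Z 0 \<omega>))\<^sup>2)" for l
      unfolding \<phi>_sq unfolding \<phi>_def fst_conv by (rule integrable_indicator_x[OF cell_meas])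
    have mean: "c\<^sub>0 * (S l / 2) \<le> (\<integral>\<omega>. \<phi> l (Z 0 \<omega>) \<partial>P)" "(\<integral>\<omega>. \<phi> l (Z 0 \<omega>) \<partial>P) \<le> C\<^sub>0 * (S l / 2)" if "l \<in> L" for l
    proof -
      have "0 \<le> S l / 2" "S l / 2 \<le> S l" "S l \<le> h\<^sub>0" using S[of l] rho that assms by (auto simp: L_def S_def)
      then obtain a b where ab: "cell l = strip j a b" "g - h\<^sub>0 \<le> a" "a \<le> b" "b \<le> g + h\<^sub>0" "b - a = S l - S l / 2"
        unfolding cell_def by (rule cell_strip)
      show "c\<^sub>0 * (S l / 2) \<le> (\<integral>\<omega>. \<phi> l (Z 0 \<omega>) \<partial>P)" "(\<integral>\<omega>. \<phi> l (Z 0 \<omega>) \<partial>P) \<le> C\<^sub>0 * (S l / 2)"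
        using strip_low[OF ab(2-4)] strip_up[OF ab(2-4)] unfolding \<phi>_def fst_conv ab(1) ab(5) by simp_all
    qed
    define a where "a l = n * (c\<^sub>0 * S l / 4)" for l
    have a0: "0 < a l" for l unfolding a_def using elim c\<^sub>0 S[of l] by simp
    have "likely P (\<Sum>l\<in>L. n * (mix_const * (C\<^sub>0 * (S l / 2))) / (a l)\<^sup>2) (\<lambda>\<omega>. \<forall>l\<in>L.
       \<bar>(\<Sum>t\<in>{1..int n}. \<phi> l (Z t \<omega>)) - n * (\<integral>\<omega>. \<phi> l (Z 0 \<omega>) \<partial>P)\<bar> < a l)"
      by (intro likely_ball L mean_tail \<phi>_meas \<phi>_int a0) (use mean \<phi>_sq in auto)
    moreover have "(\<Sum>l\<in>L. n * (mix_const * (C\<^sub>0 * (S l / 2))) / (a l)\<^sup>2) \<le> e"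
    proof -
      have "n * (mix_const * (C\<^sub>0 * (S l / 2))) / (a l)\<^sup>2 = A * (1 / (n * \<rho>)) * (1 / 2 ^ l)" for l
        unfolding a_def A_def S_def using rho elim c\<^sub>0 by (simp add: field_simps power2_eq_square)
      then have "(\<Sum>l\<in>L. n * (mix_const * (C\<^sub>0 * (S l / 2))) / (a l)\<^sup>2) = A * (1 / (n * \<rho>)) * (\<Sum>l\<in>L. 1 / 2 ^ l)"
        by (simp only: sum_distrib_left)
      also have "\<dots> \<le> A * rate n * 2"
        using A0 n_rho half_series[OF L] r0 by (intro mult_mono mult_left_mono) (auto intro: sum_nonneg)
      finally show ?thesis using elim by simp
    qed
    ultimately show ?case
    proof (rule likely_mono)
      fix \<omega> assume H: "\<forall>l\<in>L. \<bar>(\<Sum>t\<in>{1..int n}. \<phi> l (Z t \<omega>)) - n * (\<integral>\<omega>. \<phi> l (Z 0 \<omega>) \<partial>P)\<bar> < a l"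
      show "\<forall>s\<in>{K * rate n..\<eta>}. c\<^sub>0 / 128 * n * s ^ 3
         \<le> (\<Sum>t\<in>{1..int n}. (x t \<omega> $ j - g)\<^sup>2 * indicator (band up j g s) (x t \<omega>))"
      proof
        fix s assume s: "s \<in> {K * rate n..\<eta>}"
        then have s': "\<rho> \<le> s" "s \<le> \<eta>" unfolding \<rho>_def by auto
        then have "1 \<le> s / \<rho>" using rho by (simp add: field_simps)
        then obtain l where "2 ^ l \<le> s / \<rho>" "s / \<rho> < 2 ^ Suc l" using ex_dyadic_floor by blast
        then have l: "S l \<le> s" "s < 2 * S l" using rho by (auto simp: field_simps S_def)
        have lL: "l \<in> L" using l s' by (simp add: L_def S_def)
        have "n * (c\<^sub>0 * (S l / 2)) \<le> n * (\<integral>\<omega>. \<phi> l (Z 0 \<omega>) \<partial>P)"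
          using mean(1)[OF lL] by (intro mult_left_mono) auto
        moreover have "\<bar>(\<Sum>t\<in>{1..int n}. \<phi> l (Z t \<omega>)) - n * (\<integral>\<omega>. \<phi> l (Z 0 \<omega>) \<partial>P)\<bar> < a l" using H lL by blast
        moreover have "n * (c\<^sub>0 * (S l / 2)) = 2 * a l" unfolding a_def by simp
        \<comment> \<open>Half of the expected count survives. The constant 128 is 4 * 4 * 8: one 4 from the count, one from
          the distance S l / 2, and 8 from s < 2 S l.\<close>
        ultimately have count: "a l \<le> (\<Sum>t\<in>{1..int n}. \<phi> l (Z t \<omega>))" by linarith
        have "c\<^sub>0 / 128 * n * s ^ 3 \<le> c\<^sub>0 / 128 * n * (2 * S l) ^ 3"
          using l s' rho c\<^sub>0 by (intro mult_left_mono power_mono) auto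
        also have "\<dots> = (S l / 2)\<^sup>2 * a l"
          unfolding a_def by (simp add: power2_eq_square power3_eq_cube)
        also have "\<dots> \<le> (S l / 2)\<^sup>2 * (\<Sum>t\<in>{1..int n}. \<phi> l (Z t \<omega>))"
          by (intro mult_left_mono count) simp
        also have "\<dots> = (\<Sum>t\<in>{1..int n}. (S l / 2)\<^sup>2 * \<phi> l (Z t \<omega>))" by (rule sum_distrib_left)
        also have "\<dots> \<le> (\<Sum>t\<in>{1..int n}. (x t \<omega> $ j - g)\<^sup>2 * indicator (band up j g s) (x t \<omega>))"
        proof (rule sum_mono)
          fix t
          show "(S l / 2)\<^sup>2 * \<phi> l (Z t \<omega>) \<le> (x t \<omega> $ j - g)\<^sup>2 * indicator (band up j g s) (x t \<omega>)"
          proof (cases "x t \<omega> \<in> cell l")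
            case True
            then have "S l / 2 \<le> \<bar>x t \<omega> $ j - g\<bar>" unfolding cell_def by (rule band_diff_dist)
            then have "(S l / 2)\<^sup>2 \<le> \<bar>x t \<omega> $ j - g\<bar>\<^sup>2" using S[of l] by (intro power_mono) auto
            moreover have "x t \<omega> \<in> band up j g s" using True band_mono[OF l(1), of up j g] by (auto simp: cell_def)
            ultimately show ?thesis using True by (simp add: \<phi>_def)
          qed (simp add: \<phi>_def)
        qed
        finally show "c\<^sub>0 / 128 * n * s ^ 3 \<le> (\<Sum>t\<in>{1..int n}. (x t \<omega> $ j - g)\<^sup>2 * indicator (band up j g s) (x t \<omega>))" .
      qed
    qed
  qed
qed

section \<open>Regular samples\<close>

text \<open>The sample behaves like the population. In this order: the regressors opposite to the bands
  have a nondegenerate second moment matrix; those on the fixed band of width \<open>\<eta>\<close> are negligible against it;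
  bands of width at least \<open>K rate n\<close> carry the signal \<open>n s\<^sup>3\<close>; the score is of order \<open>\<surd>n\<close>, opposite to the bands and
  on narrow bands; the noise of the kink term is at most \<open>\<kappa>\<close> times the order of the signal; on bands of
  any relevant width \<open>s \<le> S\<close> the score is at most \<open>\<kappa>' n\<close>.\<close>

definition regular :: "bool \<Rightarrow> real \<Rightarrow> real \<Rightarrow> real \<Rightarrow> real \<Rightarrow> real \<Rightarrow> real \<Rightarrow> nat \<Rightarrow> 'w \<Rightarrow> bool" where
  "regular up \<eta> \<kappa> \<kappa>' S T K n \<omega> \<longleftrightarrow>
     (\<forall>p. c\<^sub>1 / 2 * n * (norm p)\<^sup>2 \<le> (\<Sum>t\<in>{1..int n}. (p \<bullet> x t \<omega>)\<^sup>2 * indicator (base up j g) (x t \<omega>))) \<and>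
     (\<Sum>t\<in>{1..int n}. (norm (x t \<omega>))\<^sup>2 * indicator (band up j g \<eta>) (x t \<omega>)) \<le> c\<^sub>1 / 6 * n \<and>
     (\<forall>s\<in>{K * rate n..\<eta>}. c\<^sub>0 / 128 * n * s ^ 3
        \<le> (\<Sum>t\<in>{1..int n}. (x t \<omega> $ j - g)\<^sup>2 * indicator (band up j g s) (x t \<omega>))) \<and>
     (\<forall>i\<in>UNIV. \<bar>noise_sum n (\<lambda>v. v $ i) (base up j g) \<omega>\<bar> \<le> T * sqrt n) \<and>
     (\<forall>i\<in>UNIV. \<forall>s\<in>{0..\<eta>}. \<bar>noise_sum n (\<lambda>v. v $ i) (band up j g s) \<omega>\<bar> \<le> T * sqrt n) \<and>
     (\<forall>s\<in>{0..\<eta>}. \<bar>noise_sum n (\<lambda>v. v $ j - g) (band up j g s) \<omega>\<bar> \<le> \<kappa> * n * (max s (K * rate n)) ^ 3) \<and>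
     (\<forall>i\<in>UNIV. \<forall>s\<in>{0..S}. \<bar>noise_sum n (\<lambda>v. v $ i) (band up j g s) \<omega>\<bar> \<le> \<kappa>' * n)"

text \<open>Monotonicity makes it possible to use the same \<open>T\<close> and \<open>K\<close> on both sides of the kink.\<close>

lemma regular_mono:
  assumes good: "regular up \<eta> \<kappa> \<kappa>' S T K n \<omega>" and T: "T \<le> T'" and K: "K \<le> K'" "0 \<le> K" "0 \<le> \<kappa>"
  shows "regular up \<eta> \<kappa> \<kappa>' S T' K' n \<omega>"
proof -
  have r: "0 \<le> rate n" unfolding rate_def by simp
  then have Kr: "K * rate n \<le> K' * rate n" using K by (intro mult_right_mono) auto
  have Tn: "T * sqrt n \<le> T' * sqrt n" using T by (intro mult_right_mono) auto
  have Km: "\<kappa> * n * (max s (K * rate n)) ^ 3 \<le> \<kappa> * n * (max s (K' * rate n)) ^ 3" for s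
  proof -
    have "0 \<le> K * rate n" using K r by simp
    then have "0 \<le> max s (K * rate n)" by simp
    moreover have "max s (K * rate n) \<le> max s (K' * rate n)" using Kr by (rule max.mono[OF order_refl])
    ultimately show ?thesis using K by (intro mult_left_mono power_mono) auto
  qed
  note G = good[unfolded regular_def]
  note G1 = G[THEN conjunct1] and G2 = G[THEN conjunct2, THEN conjunct1]
  note G' = G[THEN conjunct2, THEN conjunct2]
  note G3 = G'[THEN conjunct1] and G4 = G'[THEN conjunct2, THEN conjunct1]
  note G'' = G'[THEN conjunct2, THEN conjunct2]
  note G5 = G''[THEN conjunct1] and G6 = G''[THEN conjunct2, THEN conjunct1] and G7 = G''[THEN conjunct2, THEN conjunct2]
  have G3': "\<forall>s\<in>{K' * rate n..\<eta>}. c\<^sub>0 / 128 * n * s ^ 3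
        \<le> (\<Sum>t\<in>{1..int n}. (x t \<omega> $ j - g)\<^sup>2 * indicator (band up j g s) (x t \<omega>))"
  proof
    fix s assume "s \<in> {K' * rate n..\<eta>}"
    then have "s \<in> {K * rate n..\<eta>}" using Kr by simp
    then show "c\<^sub>0 / 128 * n * s ^ 3
        \<le> (\<Sum>t\<in>{1..int n}. (x t \<omega> $ j - g)\<^sup>2 * indicator (band up j g s) (x t \<omega>))" by (rule bspec[OF G3])
  qed
  have G4': "\<forall>i\<in>UNIV. \<bar>noise_sum n (\<lambda>v. v $ i) (base up j g) \<omega>\<bar> \<le> T' * sqrt n"
    by (intro ballI order_trans[OF bspec[OF G4 UNIV_I] Tn])
  have G5': "\<forall>i\<in>UNIV. \<forall>s\<in>{0..\<eta>}. \<bar>noise_sum n (\<lambda>v. v $ i) (band up j g s) \<omega>\<bar> \<le> T' * sqrt n"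
    by (intro ballI order_trans[OF bspec[OF bspec[OF G5 UNIV_I]] Tn])
  have G6': "\<forall>s\<in>{0..\<eta>}. \<bar>noise_sum n (\<lambda>v. v $ j - g) (band up j g s) \<omega>\<bar> \<le> \<kappa> * n * (max s (K' * rate n)) ^ 3"
    by (intro ballI order_trans[OF bspec[OF G6] Km])
  show ?thesis
    unfolding regular_def by (intro conjI G1 G2 G3' G4' G5' G6' G7)
qed

lemma norm_band_lln:
  assumes small: "(\<integral>\<omega>. (norm (x 0 \<omega>))\<^sup>2 * indicator (band up j g \<eta>) (x 0 \<omega>) \<partial>P) \<le> c\<^sub>1 / 12" and "0 < e"
  shows "\<forall>\<^sub>F n in sequentially. likely P e (\<lambda>\<omega>.
     (\<Sum>t\<in>{1..int n}. (norm (x t \<omega>))\<^sup>2 * indicator (band up j g \<eta>) (x t \<omega>)) \<le> c\<^sub>1 / 6 * n)"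
proof -
  define \<phi> where "\<phi> z = (norm (fst z))\<^sup>2 * indicator (band up j g \<eta>) (fst z)" for z :: "(real^'k) \<times> real"
  have \<phi>_meas: "\<phi> \<in> borel_measurable borel" unfolding \<phi>_def borel_prod[symmetric] by measurable
  have \<phi>_int: "integrable P (\<lambda>\<omega>. (\<phi> (Z 0 \<omega>))\<^sup>2)"
    by (rule Bochner_Integration.integrable_bound[OF x4])
       (use measurable_compose[OF Z_measurable \<phi>_meas] in \<open>auto simp: \<phi>_def indicator_def\<close>)
  have "0 < c\<^sub>1 / 12" using c\<^sub>1 by simp
  from lln[OF \<phi>_meas \<phi>_int this \<open>0 < e\<close>] show ?thesis
  proof (rule eventually_mono)
    fix n assume "likely P e (\<lambda>\<omega>. \<bar>(\<Sum>t\<in>{1..int n}. \<phi> (Z t \<omega>)) - n * (\<integral>\<omega>. \<phi> (Z 0 \<omega>) \<partial>P)\<bar> < c\<^sub>1 / 12 * n)"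
    then show "likely P e (\<lambda>\<omega>. (\<Sum>t\<in>{1..int n}. (norm (x t \<omega>))\<^sup>2 * indicator (band up j g \<eta>) (x t \<omega>)) \<le> c\<^sub>1 / 6 * n)"
    proof (rule likely_mono)
      fix \<omega> assume H: "\<bar>(\<Sum>t\<in>{1..int n}. \<phi> (Z t \<omega>)) - n * (\<integral>\<omega>. \<phi> (Z 0 \<omega>) \<partial>P)\<bar> < c\<^sub>1 / 12 * n"
      have "n * (\<integral>\<omega>. \<phi> (Z 0 \<omega>) \<partial>P) \<le> n * (c\<^sub>1 / 12)"
        using small by (intro mult_left_mono) (auto simp: \<phi>_def)
      moreover have "c\<^sub>1 / 6 * n = n * (c\<^sub>1 / 12) + c\<^sub>1 / 12 * n" by simp
      ultimately have "(\<Sum>t\<in>{1..int n}. \<phi> (Z t \<omega>)) \<le> c\<^sub>1 / 6 * n" using H by linarith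
      then show "(\<Sum>t\<in>{1..int n}. (norm (x t \<omega>))\<^sup>2 * indicator (band up j g \<eta>) (x t \<omega>)) \<le> c\<^sub>1 / 6 * n"
        by (simp add: \<phi>_def)
    qed simp
  qed
qed

lemma likely_all_components:
  fixes \<Phi> :: "'k \<Rightarrow> nat \<Rightarrow> 'w \<Rightarrow> bool"
  assumes "\<And>i e. 0 < e \<Longrightarrow> \<forall>\<^sub>F n in sequentially. likely P e (\<Phi> i n)" "0 < e"
  shows "\<forall>\<^sub>F n in sequentially. likely P e (\<lambda>\<omega>. \<forall>i\<in>UNIV. \<Phi> i n \<omega>)"
proof -
  have "\<forall>\<^sub>F n in sequentially. \<forall>i\<in>UNIV. likely P (e / CARD('k)) (\<Phi> i n)"
    by (intro eventually_ball_finite ballI assms(1)) (use assms(2) in auto)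
  then show ?thesis
  proof eventually_elim
    case (elim n)
    have "likely P (\<Sum>i\<in>(UNIV :: 'k set). e / CARD('k)) (\<lambda>\<omega>. \<forall>i\<in>UNIV. \<Phi> i n \<omega>)"
      by (rule likely_ball) (use elim in auto)
    then show ?case by simp
  qed
qed

lemma likely_all_components_bounded:
  fixes \<Phi> :: "'k \<Rightarrow> real \<Rightarrow> nat \<Rightarrow> 'w \<Rightarrow> bool"
  assumes bounded: "\<And>i e. 0 < e \<Longrightarrow> \<exists>T\<ge>1. \<forall>\<^sub>F n in sequentially. likely P e (\<Phi> i T n)" and "0 < e"
    and mono: "\<And>i T T' n \<omega>. T \<le> T' \<Longrightarrow> \<Phi> i T n \<omega> \<Longrightarrow> \<Phi> i T' n \<omega>"
  shows "\<exists>T\<ge>1. \<forall>\<^sub>F n in sequentially. likely P e (\<lambda>\<omega>. \<forall>i\<in>UNIV. \<Phi> i T n \<omega>)"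
proof -
  have "\<forall>i. \<exists>T\<ge>1. \<forall>\<^sub>F n in sequentially. likely P (e / CARD('k)) (\<Phi> i T n)"
    using bounded \<open>0 < e\<close> by simp
  then obtain T where T: "\<And>i. 1 \<le> T i" "\<And>i. \<forall>\<^sub>F n in sequentially. likely P (e / CARD('k)) (\<Phi> i (T i) n)"
    by metis
  define T' where "T' = (\<Sum>i\<in>UNIV. T i)"
  have le: "T i \<le> T'" for i
    unfolding T'_def by (rule member_le_sum) (use T(1) in \<open>auto intro: order_trans[of 0 1]\<close>)
  have "\<forall>\<^sub>F n in sequentially. \<forall>i\<in>UNIV. likely P (e / CARD('k)) (\<Phi> i T' n)"
    by (intro eventually_ball_finite ballI eventually_mono[OF T(2)])
       (auto intro: likely_mono mono[OF le])
  then have "\<forall>\<^sub>F n in sequentially. likely P e (\<lambda>\<omega>. \<forall>i\<in>UNIV. \<Phi> i T' n \<omega>)"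
  proof eventually_elim
    case (elim n)
    have "likely P (\<Sum>i\<in>(UNIV :: 'k set). e / CARD('k)) (\<lambda>\<omega>. \<forall>i\<in>UNIV. \<Phi> i T' n \<omega>)"
      by (rule likely_ball) (use elim in auto)
    then show ?case by simp
  qed
  moreover have "1 \<le> T'" using T(1) le order_trans by blast
  ultimately show ?thesis by blast
qed

text \<open>Each of the seven clauses gets a seventh of the admitted probability.\<close>

lemma regular_likely_one_side:
  assumes \<eta>: "0 < \<eta>" "2 * \<eta> \<le> h\<^sub>0"
    and small: "(\<integral>\<omega>. (norm (x 0 \<omega>))\<^sup>2 * indicator (band up j g \<eta>) (x 0 \<omega>) \<partial>P) \<le> c\<^sub>1 / 12"
    and pos: "0 < \<kappa>" "0 < \<kappa>'" "0 < S" "0 < e"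
  shows "\<exists>T\<ge>1. \<exists>K\<ge>1. \<forall>\<^sub>F n in sequentially. likely P e (regular up \<eta> \<kappa> \<kappa>' S T K n)"
proof -
  define d where "d = e / 7"
  have d: "0 < d" unfolding d_def using pos by simp
  have \<eta>': "\<eta> \<le> h\<^sub>0" using \<eta> by simp
  have mT: "T \<le> T' \<Longrightarrow> T * sqrt n \<le> T' * sqrt n" for T T' and n :: nat by (intro mult_right_mono) auto
  have c2: "0 < c\<^sub>1 / 2" using c\<^sub>1 by simp
  have E1: "\<forall>\<^sub>F n in sequentially. likely P d (\<lambda>\<omega>. \<forall>p. c\<^sub>1 / 2 * n * (norm p)\<^sup>2
        \<le> (\<Sum>t\<in>{1..int n}. (p \<bullet> x t \<omega>)\<^sup>2 * indicator (base up j g) (x t \<omega>)))"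
    using quadratic_form_lln[OF base_measurable x4 c2 d, of up j g]
  proof (rule eventually_mono)
    fix n assume "likely P d (\<lambda>\<omega>. \<forall>p. \<bar>(\<Sum>t\<in>{1..int n}. (p \<bullet> x t \<omega>)\<^sup>2 * indicator (base up j g) (x t \<omega>))
        - n * (\<integral>\<omega>. (p \<bullet> x 0 \<omega>)\<^sup>2 * indicator (base up j g) (x 0 \<omega>) \<partial>P)\<bar> \<le> c\<^sub>1 / 2 * n * (norm p)\<^sup>2)"
    then show "likely P d (\<lambda>\<omega>. \<forall>p. c\<^sub>1 / 2 * n * (norm p)\<^sup>2
        \<le> (\<Sum>t\<in>{1..int n}. (p \<bullet> x t \<omega>)\<^sup>2 * indicator (base up j g) (x t \<omega>)))"
    proof (rule likely_mono[OF _ order_refl], intro allI)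
      fix \<omega> p assume "\<forall>p. \<bar>(\<Sum>t\<in>{1..int n}. (p \<bullet> x t \<omega>)\<^sup>2 * indicator (base up j g) (x t \<omega>))
        - n * (\<integral>\<omega>. (p \<bullet> x 0 \<omega>)\<^sup>2 * indicator (base up j g) (x 0 \<omega>) \<partial>P)\<bar> \<le> c\<^sub>1 / 2 * n * (norm p)\<^sup>2"
      from this[rule_format, of p]
      have "n * (\<integral>\<omega>. (p \<bullet> x 0 \<omega>)\<^sup>2 * indicator (base up j g) (x 0 \<omega>) \<partial>P) - c\<^sub>1 / 2 * n * (norm p)\<^sup>2
        \<le> (\<Sum>t\<in>{1..int n}. (p \<bullet> x t \<omega>)\<^sup>2 * indicator (base up j g) (x t \<omega>))" by linarith
      moreover have "n * (c\<^sub>1 * (norm p)\<^sup>2) \<le> n * (\<integral>\<omega>. (p \<bullet> x 0 \<omega>)\<^sup>2 * indicator (base up j g) (x 0 \<omega>) \<partial>P)"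
        by (intro mult_left_mono nondegenerate) simp
      ultimately show "c\<^sub>1 / 2 * n * (norm p)\<^sup>2 \<le> (\<Sum>t\<in>{1..int n}. (p \<bullet> x t \<omega>)\<^sup>2 * indicator (base up j g) (x t \<omega>))"
        by (simp add: field_simps)
    qed
  qed
  note E2 = norm_band_lln[OF small d]
  have E4: "\<exists>T\<ge>1. \<forall>\<^sub>F n in sequentially. likely P d (\<lambda>\<omega>. \<forall>i\<in>UNIV. \<bar>noise_sum n (\<lambda>v. v $ i) (base up j g) \<omega>\<bar> \<le> T * sqrt n)"
  proof (rule likely_all_components_bounded[where \<Phi> = "\<lambda>i T n \<omega>. \<bar>noise_sum n (\<lambda>v. v $ i) (base up j g) \<omega>\<bar> \<le> T * sqrt n"])
    fix i :: 'k and e :: real assume "0 < e"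
    from noise_sum_bounded[OF vec_nth_measurable base_measurable eps_x_int4 eps_int this, of i up j g]
    obtain T where "1 \<le> T" "\<forall>n\<ge>1. likely P e (\<lambda>\<omega>. \<bar>noise_sum n (\<lambda>v. v $ i) (base up j g) \<omega>\<bar> \<le> T * sqrt n)" by blast
    then show "\<exists>T\<ge>1. \<forall>\<^sub>F n in sequentially. likely P e (\<lambda>\<omega>. \<bar>noise_sum n (\<lambda>v. v $ i) (base up j g) \<omega>\<bar> \<le> T * sqrt n)"
      by (auto simp: eventually_sequentially)
  qed (use d mT in \<open>auto intro: order_trans\<close>)
  then obtain T\<^sub>1 where T1: "1 \<le> T\<^sub>1"
    "\<forall>\<^sub>F n in sequentially. likely P d (\<lambda>\<omega>. \<forall>i\<in>UNIV. \<bar>noise_sum n (\<lambda>v. v $ i) (base up j g) \<omega>\<bar> \<le> T\<^sub>1 * sqrt n)" by blast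
  have E5: "\<exists>T\<ge>1. \<forall>\<^sub>F n in sequentially. likely P d (\<lambda>\<omega>. \<forall>i\<in>UNIV. \<forall>s\<in>{0..\<eta>}. \<bar>noise_sum n (\<lambda>v. v $ i) (band up j g s) \<omega>\<bar> \<le> T * sqrt n)"
    by (rule likely_all_components_bounded[where \<Phi> = "\<lambda>i T n \<omega>. \<forall>s\<in>{0..\<eta>}. \<bar>noise_sum n (\<lambda>v. v $ i) (band up j g s) \<omega>\<bar> \<le> T * sqrt n",
         OF noise_band_bounded[OF \<eta>(1) \<eta>'] d])
       (use mT in \<open>auto intro: order_trans\<close>)
  then obtain T\<^sub>2 where T2: "1 \<le> T\<^sub>2"
    "\<forall>\<^sub>F n in sequentially. likely P d (\<lambda>\<omega>. \<forall>i\<in>UNIV. \<forall>s\<in>{0..\<eta>}. \<bar>noise_sum n (\<lambda>v. v $ i) (band up j g s) \<omega>\<bar> \<le> T\<^sub>2 * sqrt n)" by blast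
  obtain K where K: "1 \<le> K" "\<forall>\<^sub>F n in sequentially. likely P d (\<lambda>\<omega>. \<forall>s\<in>{0..\<eta>}.
      \<bar>noise_sum n (\<lambda>v. v $ j - g) (band up j g s) \<omega>\<bar> \<le> \<kappa> * n * (max s (K * rate n)) ^ 3)"
    using noise_kink_peeling[OF \<eta> pos(1) d] by blast
  note E3 = band_occupation[OF \<eta>(1) \<eta>' K(1) d, of up]
  have E7: "\<forall>\<^sub>F n in sequentially. likely P d (\<lambda>\<omega>. \<forall>i\<in>UNIV. \<forall>s\<in>{0..S}. \<bar>noise_sum n (\<lambda>v. v $ i) (band up j g s) \<omega>\<bar> \<le> \<kappa>' * n)"
    by (rule likely_all_components[where \<Phi> = "\<lambda>i n \<omega>. \<forall>s\<in>{0..S}. \<bar>noise_sum n (\<lambda>v. v $ i) (band up j g s) \<omega>\<bar> \<le> \<kappa>' * n",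
         OF noise_sum_uniform_lln[OF vec_nth_measurable eps_x_int4 eps_int no_atoms pos(3,2)] d])
  define T where "T = max T\<^sub>1 T\<^sub>2"
  have T: "1 \<le> T" using T1 T2 unfolding T_def by simp
  have "\<forall>\<^sub>F n in sequentially. likely P e (regular up \<eta> \<kappa> \<kappa>' S T K n)"
    using E1 E2 E3 T1(2) T2(2) K(2) E7
  proof eventually_elim
    case (elim n)
    have 4: "likely P d (\<lambda>\<omega>. \<forall>i\<in>UNIV. \<bar>noise_sum n (\<lambda>v. v $ i) (base up j g) \<omega>\<bar> \<le> T * sqrt n)"
      by (rule likely_mono[OF elim(4) order_refl])
         (use mT[of T\<^sub>1 T n] in \<open>auto simp: T_def intro: order_trans\<close>)
    have 5: "likely P d (\<lambda>\<omega>. \<forall>i\<in>UNIV. \<forall>s\<in>{0..\<eta>}. \<bar>noise_sum n (\<lambda>v. v $ i) (band up j g s) \<omega>\<bar> \<le> T * sqrt n)"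
      by (rule likely_mono[OF elim(5) order_refl])
         (use mT[of T\<^sub>2 T n] in \<open>auto simp: T_def intro: order_trans\<close>)
    have "likely P (d + (d + (d + (d + (d + (d + d)))))) (regular up \<eta> \<kappa> \<kappa>' S T K n)"
      unfolding regular_def[abs_def]
      by (intro likely_conj elim(1-3) 4 5 elim(6,7))
    then show ?case by (simp add: d_def)
  qed
  then show ?thesis using T K(1) by blast
qed

lemma regular_likely:
  assumes \<eta>: "0 < \<eta>" "2 * \<eta> \<le> h\<^sub>0"
    and small: "\<And>up. (\<integral>\<omega>. (norm (x 0 \<omega>))\<^sup>2 * indicator (band up j g \<eta>) (x 0 \<omega>) \<partial>P) \<le> c\<^sub>1 / 12"
    and pos: "0 < \<kappa>" "0 < \<kappa>'" "0 < S" "0 < e"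
  shows "\<exists>T\<ge>1. \<exists>K\<ge>1. \<forall>\<^sub>F n in sequentially. likely P e (\<lambda>\<omega>. \<forall>up. regular up \<eta> \<kappa> \<kappa>' S T K n \<omega>)"
proof -
  have e2: "0 < e / 2" using pos by simp
  obtain T\<^sub>1 K\<^sub>1 where 1: "1 \<le> T\<^sub>1" "1 \<le> K\<^sub>1" "\<forall>\<^sub>F n in sequentially. likely P (e / 2) (regular True \<eta> \<kappa> \<kappa>' S T\<^sub>1 K\<^sub>1 n)"
    using regular_likely_one_side[OF \<eta> small pos(1-3) e2] by blast
  obtain T\<^sub>2 K\<^sub>2 where 2: "1 \<le> T\<^sub>2" "1 \<le> K\<^sub>2" "\<forall>\<^sub>F n in sequentially. likely P (e / 2) (regular False \<eta> \<kappa> \<kappa>' S T\<^sub>2 K\<^sub>2 n)"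
    using regular_likely_one_side[OF \<eta> small pos(1-3) e2] by blast
  define T K where "T = max T\<^sub>1 T\<^sub>2" and "K = max K\<^sub>1 K\<^sub>2"
  have "\<forall>\<^sub>F n in sequentially. likely P e (\<lambda>\<omega>. \<forall>up. regular up \<eta> \<kappa> \<kappa>' S T K n \<omega>)"
    using 1(3) 2(3)
  proof eventually_elim
    case (elim n)
    have "likely P (e / 2 + e / 2) (\<lambda>\<omega>. regular True \<eta> \<kappa> \<kappa>' S T\<^sub>1 K\<^sub>1 n \<omega> \<and> regular False \<eta> \<kappa> \<kappa>' S T\<^sub>2 K\<^sub>2 n \<omega>)"
      by (rule likely_conj) (use elim in auto)
    then show ?case
    proof (rule likely_mono)
      fix \<omega> assume H: "regular True \<eta> \<kappa> \<kappa>' S T\<^sub>1 K\<^sub>1 n \<omega> \<and> regular False \<eta> \<kappa> \<kappa>' S T\<^sub>2 K\<^sub>2 n \<omega>"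
      show "\<forall>up. regular up \<eta> \<kappa> \<kappa>' S T K n \<omega>"
      proof
        fix up
        show "regular up \<eta> \<kappa> \<kappa>' S T K n \<omega>"
          using regular_mono[OF conjunct1[OF H], of T K] regular_mono[OF conjunct2[OF H], of T K] 1 2 pos
          by (cases up) (auto simp: T_def K_def)
      qed
    qed simp
  qed
  moreover have "1 \<le> T" "1 \<le> K" using 1 2 by (auto simp: T_def K_def)
  ultimately show ?thesis by blast
qed

section \<open>From regular samples to the rates\<close>

text \<open>The fitted minus the true regression function, when the threshold is off by \<open>s\<close>. On the band one of
  the two has switched regime and the other has not; by the kink restriction they then differ by
  \<open>\<tau> (q - g)\<close>, with \<open>\<tau>\<close> the change of slope up to sign.\<close>

definition discrepancy :: "bool \<Rightarrow> real^'k \<Rightarrow> real^'k \<Rightarrow> real \<Rightarrow> real \<Rightarrow> real^'k \<Rightarrow> real" where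
  "discrepancy up p r \<tau> s v =
     (if v \<in> base up j g then p \<bullet> v else if v \<in> band up j g s then p \<bullet> v - \<tau> * (v $ j - g) else r \<bullet> v)"

lemma inner_square_le: "(p \<bullet> v)\<^sup>2 \<le> (norm p)\<^sup>2 * (norm (v :: real^'k))\<^sup>2"
proof -
  have "\<bar>p \<bullet> v\<bar>\<^sup>2 \<le> (norm p * norm v)\<^sup>2" by (rule power_mono[OF Cauchy_Schwarz_ineq2]) simp
  then show ?thesis by (simp add: power_mult_distrib)
qed

lemma square_diff_ge: "b\<^sup>2 / 2 - a\<^sup>2 \<le> (a - b)\<^sup>2" for a b :: real
  using zero_le_power2[of "2 * a - b"] by (simp add: power2_eq_square algebra_simps)

text \<open>On the band \<open>(a - b)\<^sup>2 \<ge> b\<^sup>2 / 2 - a\<^sup>2\<close> separates the kink from the coefficients. The loss is charged to the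
  fixed band of width \<open>\<eta>\<close>, where the regressors are negligible.\<close>

lemma discrepancy_square_near:
  assumes "s \<le> \<eta>"
  shows "(p \<bullet> v)\<^sup>2 * indicator (base up j g) v + \<tau>\<^sup>2 / 2 * ((v $ j - g)\<^sup>2 * indicator (band up j g s) v)
     + (r \<bullet> v)\<^sup>2 * indicator (base (\<not> up) j g) v
     - ((norm p)\<^sup>2 + (norm r)\<^sup>2) * ((norm v)\<^sup>2 * indicator (band up j g \<eta>) v) \<le> (discrepancy up p r \<tau> s v)\<^sup>2"
proof -
  have sq: "\<tau>\<^sup>2 / 2 * (v $ j - g)\<^sup>2 - (p \<bullet> v)\<^sup>2 \<le> (p \<bullet> v - \<tau> * (v $ j - g))\<^sup>2"
    using square_diff_ge[of "\<tau> * (v $ j - g)" "p \<bullet> v"] by (simp add: power_mult_distrib)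
  have nb: "v \<in> base up j g \<Longrightarrow> v \<notin> band up j g s'" for s' using band_base[of up j g s'] by blast
  have mono: "v \<in> band up j g s \<Longrightarrow> v \<in> band up j g \<eta>" using band_mono[OF assms, of up j g] by blast
  show ?thesis
    using sq nb mono inner_square_le[of p v] inner_square_le[of r v]
    by (auto simp: discrepancy_def base_compl indicator_def algebra_simps)
qed

text \<open>For a distant threshold the band of width \<open>\<eta>\<close> alone is used; the region beyond is discarded.\<close>

lemma discrepancy_square_far:
  assumes "\<eta> \<le> s"
  shows "(p \<bullet> v)\<^sup>2 * indicator (base up j g) v + \<tau>\<^sup>2 / 2 * ((v $ j - g)\<^sup>2 * indicator (band up j g \<eta>) v)
     - (norm p)\<^sup>2 * ((norm v)\<^sup>2 * indicator (band up j g \<eta>) v) \<le> (discrepancy up p r \<tau> s v)\<^sup>2"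
proof -
  have sq: "\<tau>\<^sup>2 / 2 * (v $ j - g)\<^sup>2 - (p \<bullet> v)\<^sup>2 \<le> (p \<bullet> v - \<tau> * (v $ j - g))\<^sup>2"
    using square_diff_ge[of "\<tau> * (v $ j - g)" "p \<bullet> v"] by (simp add: power_mult_distrib)
  have nb: "v \<in> base up j g \<Longrightarrow> v \<notin> band up j g s'" for s' using band_base[of up j g s'] by blast
  have mono: "v \<in> band up j g \<eta> \<Longrightarrow> v \<in> band up j g s" using band_mono[OF assms, of up j g] by blast
  show ?thesis
    using sq nb mono inner_square_le[of p v]
    by (auto simp: discrepancy_def indicator_def algebra_simps)
qed

lemma noise_sum_inner:
  "(\<Sum>t\<in>{1..int n}. \<epsilon> t \<omega> * ((p \<bullet> x t \<omega>) * indicator A (x t \<omega>))) = (\<Sum>i\<in>UNIV. p $ i * noise_sum n (\<lambda>v. v $ i) A \<omega>)"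
  unfolding noise_sum_def sum_distrib_left
  by (subst sum.swap) (simp add: inner_vec_def sum_distrib_left sum_distrib_right mult_ac)

lemma noise_discrepancy:
  "(\<Sum>t\<in>{1..int n}. \<epsilon> t \<omega> * discrepancy up p r \<tau> s (x t \<omega>))
     = (\<Sum>i\<in>UNIV. p $ i * noise_sum n (\<lambda>v. v $ i) (base up j g) \<omega>)
     + (\<Sum>i\<in>UNIV. r $ i * noise_sum n (\<lambda>v. v $ i) (base (\<not> up) j g) \<omega>)
     + (\<Sum>i\<in>UNIV. (p - r) $ i * noise_sum n (\<lambda>v. v $ i) (band up j g s) \<omega>)
     - \<tau> * noise_sum n (\<lambda>v. v $ j - g) (band up j g s) \<omega>"
proof -
  have nb: "v \<in> base up j g \<Longrightarrow> v \<notin> band up j g s" for v using band_base[of up j g s] by blast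
  have split: "discrepancy up p r \<tau> s v = (p \<bullet> v) * indicator (base up j g) v + (r \<bullet> v) * indicator (base (\<not> up) j g) v
     + ((p - r) \<bullet> v) * indicator (band up j g s) v - \<tau> * ((v $ j - g) * indicator (band up j g s) v)" for v
    using nb[of v] by (auto simp: discrepancy_def base_compl indicator_def inner_diff_left)
  have "(\<Sum>t\<in>{1..int n}. \<epsilon> t \<omega> * discrepancy up p r \<tau> s (x t \<omega>))
    = (\<Sum>t\<in>{1..int n}. \<epsilon> t \<omega> * ((p \<bullet> x t \<omega>) * indicator (base up j g) (x t \<omega>)))
    + (\<Sum>t\<in>{1..int n}. \<epsilon> t \<omega> * ((r \<bullet> x t \<omega>) * indicator (base (\<not> up) j g) (x t \<omega>)))
    + (\<Sum>t\<in>{1..int n}. \<epsilon> t \<omega> * (((p - r) \<bullet> x t \<omega>) * indicator (band up j g s) (x t \<omega>)))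
    - \<tau> * noise_sum n (\<lambda>v. v $ j - g) (band up j g s) \<omega>"
    unfolding split noise_sum_def sum_distrib_left sum.distrib[symmetric] sum_subtractf[symmetric]
    by (intro sum.cong) (simp_all add: algebra_simps)
  then show ?thesis unfolding noise_sum_inner .
qed

lemma component_sum_le:
  fixes p :: "real^'k"
  assumes "\<And>i. \<bar>N i\<bar> \<le> B"
  shows "\<bar>\<Sum>i\<in>UNIV. p $ i * N i\<bar> \<le> CARD('k) * norm p * B"
proof -
  have "\<bar>\<Sum>i\<in>UNIV. p $ i * N i\<bar> \<le> (\<Sum>i\<in>(UNIV :: 'k set). norm p * B)"
  proof (rule order_trans[OF sum_abs], rule sum_mono)
    fix i
    show "\<bar>p $ i * N i\<bar> \<le> norm p * B"
      unfolding abs_mult by (rule mult_mono[OF component_le_norm_cart assms]) auto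
  qed
  then show ?thesis by simp
qed

lemma kink_noise_split:
  assumes "\<omega> \<in> space P"
  shows "noise_sum n (\<lambda>v. v $ j - g) A \<omega> = noise_sum n (\<lambda>v. v $ j) A \<omega> - g * noise_sum n (\<lambda>v. v $ c) A \<omega>"
  unfolding noise_sum_def sum_distrib_left sum_subtractf[symmetric]
  by (intro sum.cong) (simp_all add: const[OF assms] algebra_simps)

text \<open>Consistency of the threshold, with no prior knowledge of the coefficients: wrongly placed by more than
  \<open>\<eta>\<close>, the threshold leaves an error of order \<open>n \<eta>\<^sup>3\<close> on the band of width \<open>\<eta>\<close>, which no choice of \<open>p\<close>
  compensates and which exceeds the noise that bounded coefficients can pick up.\<close>

lemma regular_not_far:
  fixes B T K Q :: real
  assumes good: "\<And>up. regular up \<eta> \<kappa> \<kappa>' S T K n \<omega>" and \<omega>: "\<omega> \<in> space P" and n: "0 < n"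
    and \<eta>: "0 < \<eta>" and s: "s \<le> S" "\<eta> \<le> s" and B: "norm p \<le> B" "norm r \<le> B" and K: "K * rate n \<le> \<eta>"
    and \<tau>: "\<tau> \<noteq> 0" and \<kappa>': "0 \<le> \<kappa>'"
    and basic: "(\<Sum>t\<in>{1..int n}. (discrepancy up p r \<tau> s (x t \<omega>))\<^sup>2)
       \<le> 2 * (\<Sum>t\<in>{1..int n}. \<epsilon> t \<omega> * discrepancy up p r \<tau> s (x t \<omega>))"
    and Q: "Q = \<tau>\<^sup>2 * c\<^sub>0 * \<eta> ^ 3 / 2048"
    and T_small: "2 * real CARD('k) * B * (T * sqrt n) \<le> Q * n"
    and \<kappa>'_small: "(2 * real CARD('k) * B + \<bar>\<tau>\<bar> * (1 + \<bar>g\<bar>)) * \<kappa>' \<le> Q"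
  shows False
proof -
  have Q0: "0 < Q" unfolding Q using \<tau> c\<^sub>0 \<eta> by simp
  have B0: "0 \<le> B" using B(1) norm_ge_zero order_trans by blast
  have T0: "0 \<le> T * sqrt n"
    using good[of True] abs_ge_zero order_trans unfolding regular_def by blast
  have s0: "0 \<le> s" using s \<eta> by simp
  have q: "c\<^sub>1 / 2 * n * (norm p)\<^sup>2 \<le> (\<Sum>t\<in>{1..int n}. (p \<bullet> x t \<omega>)\<^sup>2 * indicator (base up j g) (x t \<omega>))"
    "(\<Sum>t\<in>{1..int n}. (norm (x t \<omega>))\<^sup>2 * indicator (band up j g \<eta>) (x t \<omega>)) \<le> c\<^sub>1 / 6 * n"
    "c\<^sub>0 / 128 * n * \<eta> ^ 3 \<le> (\<Sum>t\<in>{1..int n}. (x t \<omega> $ j - g)\<^sup>2 * indicator (band up j g \<eta>) (x t \<omega>))"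
    using good[of up] K unfolding regular_def by auto
  have "8 * Q * n = \<tau>\<^sup>2 / 2 * (c\<^sub>0 / 128 * n * \<eta> ^ 3)" unfolding Q by simp
  also have "\<dots> \<le> \<tau>\<^sup>2 / 2 * (\<Sum>t\<in>{1..int n}. (x t \<omega> $ j - g)\<^sup>2 * indicator (band up j g \<eta>) (x t \<omega>))"
    by (intro mult_left_mono q) auto
  also have "\<dots> \<le> \<tau>\<^sup>2 / 2 * (\<Sum>t\<in>{1..int n}. (x t \<omega> $ j - g)\<^sup>2 * indicator (band up j g \<eta>) (x t \<omega>))
      + (\<Sum>t\<in>{1..int n}. (p \<bullet> x t \<omega>)\<^sup>2 * indicator (base up j g) (x t \<omega>))
      - (norm p)\<^sup>2 * (\<Sum>t\<in>{1..int n}. (norm (x t \<omega>))\<^sup>2 * indicator (band up j g \<eta>) (x t \<omega>))"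
  proof -
    have "(norm p)\<^sup>2 * (\<Sum>t\<in>{1..int n}. (norm (x t \<omega>))\<^sup>2 * indicator (band up j g \<eta>) (x t \<omega>)) \<le> (norm p)\<^sup>2 * (c\<^sub>1 / 6 * n)"
      by (intro mult_left_mono q) auto
    also have "\<dots> = c\<^sub>1 / 6 * n * (norm p)\<^sup>2" by simp
    also have "\<dots> \<le> c\<^sub>1 / 2 * n * (norm p)\<^sup>2" using c\<^sub>1 by (intro mult_right_mono) auto
    finally show ?thesis using q(1) by linarith
  qed
  also have "\<dots> = (\<Sum>t\<in>{1..int n}. (p \<bullet> x t \<omega>)\<^sup>2 * indicator (base up j g) (x t \<omega>)
     + \<tau>\<^sup>2 / 2 * ((x t \<omega> $ j - g)\<^sup>2 * indicator (band up j g \<eta>) (x t \<omega>))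
     - (norm p)\<^sup>2 * ((norm (x t \<omega>))\<^sup>2 * indicator (band up j g \<eta>) (x t \<omega>)))"
    by (simp only: sum.distrib sum_subtractf sum_distrib_left add.commute)
  also have "\<dots> \<le> (\<Sum>t\<in>{1..int n}. (discrepancy up p r \<tau> s (x t \<omega>))\<^sup>2)"
    by (intro sum_mono discrepancy_square_far s)
  also note basic
  finally have lower: "8 * Q * n \<le> 2 * (\<Sum>t\<in>{1..int n}. \<epsilon> t \<omega> * discrepancy up p r \<tau> s (x t \<omega>))" .
  have base_b: "\<bar>noise_sum n (\<lambda>v. v $ i) (base u j g) \<omega>\<bar> \<le> T * sqrt n" for i u
    using good[of u] unfolding regular_def by blast
  have band_b: "\<bar>noise_sum n (\<lambda>v. v $ i) (band up j g s) \<omega>\<bar> \<le> \<kappa>' * n" for i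
    using good[of up] s s0 unfolding regular_def by auto
  have 1: "\<bar>\<Sum>i\<in>UNIV. p $ i * noise_sum n (\<lambda>v. v $ i) (base up j g) \<omega>\<bar> \<le> CARD('k) * B * (T * sqrt n)"
    by (rule order_trans[OF component_sum_le[OF base_b]]) (intro mult_right_mono mult_left_mono B T0, simp)
  have 2: "\<bar>\<Sum>i\<in>UNIV. r $ i * noise_sum n (\<lambda>v. v $ i) (base (\<not> up) j g) \<omega>\<bar> \<le> CARD('k) * B * (T * sqrt n)"
    by (rule order_trans[OF component_sum_le[OF base_b]]) (intro mult_right_mono mult_left_mono B T0, simp)
  have pr: "norm (p - r) \<le> 2 * B" using norm_triangle_ineq4[of p r] B by simp
  have 3: "\<bar>\<Sum>i\<in>UNIV. (p - r) $ i * noise_sum n (\<lambda>v. v $ i) (band up j g s) \<omega>\<bar> \<le> CARD('k) * (2 * B) * (\<kappa>' * n)"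
    by (rule order_trans[OF component_sum_le[OF band_b]]) (intro mult_right_mono mult_left_mono pr; simp add: \<kappa>')
  have 4: "\<bar>\<tau> * noise_sum n (\<lambda>v. v $ j - g) (band up j g s) \<omega>\<bar> \<le> \<bar>\<tau>\<bar> * ((1 + \<bar>g\<bar>) * (\<kappa>' * n))"
  proof -
    have "\<bar>noise_sum n (\<lambda>v. v $ j - g) (band up j g s) \<omega>\<bar>
       \<le> \<bar>noise_sum n (\<lambda>v. v $ j) (band up j g s) \<omega>\<bar> + \<bar>g\<bar> * \<bar>noise_sum n (\<lambda>v. v $ c) (band up j g s) \<omega>\<bar>"
      unfolding kink_noise_split[OF \<omega>] abs_mult[symmetric] by (rule abs_triangle_ineq4)
    also have "\<dots> \<le> \<kappa>' * n + \<bar>g\<bar> * (\<kappa>' * n)" by (intro add_mono band_b mult_left_mono) auto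
    finally have "\<bar>noise_sum n (\<lambda>v. v $ j - g) (band up j g s) \<omega>\<bar> \<le> (1 + \<bar>g\<bar>) * (\<kappa>' * n)" by (simp add: algebra_simps)
    then show ?thesis unfolding abs_mult by (intro mult_left_mono) auto
  qed
  have "(\<Sum>t\<in>{1..int n}. \<epsilon> t \<omega> * discrepancy up p r \<tau> s (x t \<omega>))
     \<le> CARD('k) * B * (T * sqrt n) + CARD('k) * B * (T * sqrt n) + CARD('k) * (2 * B) * (\<kappa>' * n) + \<bar>\<tau>\<bar> * ((1 + \<bar>g\<bar>) * (\<kappa>' * n))"
    unfolding noise_discrepancy using 1 2 3 4 by linarith
  also have "\<dots> = 2 * real CARD('k) * B * (T * sqrt n) + (2 * real CARD('k) * B + \<bar>\<tau>\<bar> * (1 + \<bar>g\<bar>)) * \<kappa>' * n"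
    by (simp add: algebra_simps)
  also have "\<dots> \<le> Q * n + Q * n" by (intro add_mono T_small mult_right_mono \<kappa>'_small) auto
  finally have "8 * Q * n \<le> 4 * Q * n" using lower by linarith
  moreover have "0 < Q * n" using Q0 n by simp
  ultimately show False by linarith
qed

text \<open>The signal is \<open>n (|p|\<^sup>2 + |r|\<^sup>2 + s\<^sup>3)\<close> up to constants. The noise is \<open>\<surd>n (|p| + |r|)\<close> plus a
  small fraction of \<open>n max(s, K rate n)\<^sup>3\<close>. Young's inequality absorbs the first part into the signal up to
  a constant, and the second is absorbed as well unless \<open>s\<close> is below \<open>K rate n\<close> anyway.\<close>

lemma regular_near:
  fixes T K R q :: real
  assumes good: "\<And>up. regular up \<eta> \<kappa> \<kappa>' S T K n \<omega>" and n: "0 < n"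
    and s: "0 \<le> s" "s \<le> \<eta>" and T: "0 \<le> T" and K: "0 \<le> K" and \<tau>: "\<tau> \<noteq> 0"
    and \<kappa>: "\<kappa> = \<bar>\<tau>\<bar> * c\<^sub>0 / 1024"
    and basic: "(\<Sum>t\<in>{1..int n}. (discrepancy up p r \<tau> s (x t \<omega>))\<^sup>2)
       \<le> 2 * (\<Sum>t\<in>{1..int n}. \<epsilon> t \<omega> * discrepancy up p r \<tau> s (x t \<omega>))"
    and q: "q = \<tau>\<^sup>2 * c\<^sub>0 / 512"
    and R: "R = 8 * (CARD('k) * T)\<^sup>2 / (c\<^sub>1 / 6) + q * K ^ 3"
  shows "c\<^sub>1 / 6 * n * (norm p)\<^sup>2 \<le> R" "c\<^sub>1 / 6 * n * (norm r)\<^sup>2 \<le> R" "s \<le> (K + 1 + R / q) * rate n"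
proof -
  define d where "d = c\<^sub>1 / 6"
  have d0: "0 < d" unfolding d_def using c\<^sub>1 by simp
  have q0: "0 < q" unfolding q using \<tau> c\<^sub>0 by simp
  define k where "k = real CARD('k)"
  define \<rho> where "\<rho> = K * rate n"
  have r0: "0 < rate n" by (rule rate_pos[OF n])
  have rho: "0 \<le> \<rho>" "n * \<rho> ^ 3 = K ^ 3"
    using K r0 rate_cube[OF n] unfolding \<rho>_def by (auto simp: power_mult_distrib)
  define Zs where "Zs = (\<Sum>t\<in>{1..int n}. (x t \<omega> $ j - g)\<^sup>2 * indicator (band up j g s) (x t \<omega>))"
  have Zs0: "0 \<le> Zs" unfolding Zs_def by (intro sum_nonneg) auto
  have g1: "3 * d * n * (norm p)\<^sup>2 \<le> (\<Sum>t\<in>{1..int n}. (p \<bullet> x t \<omega>)\<^sup>2 * indicator (base up j g) (x t \<omega>))"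
    "3 * d * n * (norm r)\<^sup>2 \<le> (\<Sum>t\<in>{1..int n}. (r \<bullet> x t \<omega>)\<^sup>2 * indicator (base (\<not> up) j g) (x t \<omega>))"
    using good[of up] good[of "\<not> up"] unfolding regular_def d_def by auto
  have g2: "(\<Sum>t\<in>{1..int n}. (norm (x t \<omega>))\<^sup>2 * indicator (band up j g \<eta>) (x t \<omega>)) \<le> d * n"
    using good[of up] unfolding regular_def d_def by auto
  define E where "E = (norm p)\<^sup>2 + (norm r)\<^sup>2"
  have "3 * d * n * (norm p)\<^sup>2 + \<tau>\<^sup>2 / 2 * Zs + 3 * d * n * (norm r)\<^sup>2 - E * (d * n)
     \<le> (\<Sum>t\<in>{1..int n}. (p \<bullet> x t \<omega>)\<^sup>2 * indicator (base up j g) (x t \<omega>)) + \<tau>\<^sup>2 / 2 * Zs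
      + (\<Sum>t\<in>{1..int n}. (r \<bullet> x t \<omega>)\<^sup>2 * indicator (base (\<not> up) j g) (x t \<omega>))
      - E * (\<Sum>t\<in>{1..int n}. (norm (x t \<omega>))\<^sup>2 * indicator (band up j g \<eta>) (x t \<omega>))"
    using g1 mult_left_mono[OF g2, of E] by (simp add: E_def)
  also have "\<dots> = (\<Sum>t\<in>{1..int n}. (p \<bullet> x t \<omega>)\<^sup>2 * indicator (base up j g) (x t \<omega>)
     + \<tau>\<^sup>2 / 2 * ((x t \<omega> $ j - g)\<^sup>2 * indicator (band up j g s) (x t \<omega>))
     + (r \<bullet> x t \<omega>)\<^sup>2 * indicator (base (\<not> up) j g) (x t \<omega>)
     - ((norm p)\<^sup>2 + (norm r)\<^sup>2) * ((norm (x t \<omega>))\<^sup>2 * indicator (band up j g \<eta>) (x t \<omega>)))"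
    by (simp only: sum.distrib sum_subtractf sum_distrib_left Zs_def E_def)
  also have "\<dots> \<le> (\<Sum>t\<in>{1..int n}. (discrepancy up p r \<tau> s (x t \<omega>))\<^sup>2)"
    by (intro sum_mono discrepancy_square_near s)
  also note basic
  finally have lower: "2 * (d * n * E) + \<tau>\<^sup>2 / 2 * Zs \<le> 2 * (\<Sum>t\<in>{1..int n}. \<epsilon> t \<omega> * discrepancy up p r \<tau> s (x t \<omega>))"
    by (simp add: E_def algebra_simps)
  have base_b: "\<bar>noise_sum n (\<lambda>v. v $ i) (base u j g) \<omega>\<bar> \<le> T * sqrt n" for i u
    using good[of u] unfolding regular_def by blast
  have band_b: "\<bar>noise_sum n (\<lambda>v. v $ i) (band up j g s) \<omega>\<bar> \<le> T * sqrt n" for i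
    using good[of up] s unfolding regular_def by auto
  note 1 = component_sum_le[of "\<lambda>i. noise_sum n (\<lambda>v. v $ i) (base up j g) \<omega>", OF base_b, of p]
  note 2 = component_sum_le[of "\<lambda>i. noise_sum n (\<lambda>v. v $ i) (base (\<not> up) j g) \<omega>", OF base_b, of r]
  have pr: "norm (p - r) \<le> norm p + norm r" by (rule norm_triangle_ineq4)
  have 3: "\<bar>\<Sum>i\<in>UNIV. (p - r) $ i * noise_sum n (\<lambda>v. v $ i) (band up j g s) \<omega>\<bar> \<le> CARD('k) * (norm p + norm r) * (T * sqrt n)"
    by (rule order_trans[OF component_sum_le[OF band_b]]) (intro mult_right_mono mult_left_mono pr; simp add: T)
  have 4: "\<bar>\<tau> * noise_sum n (\<lambda>v. v $ j - g) (band up j g s) \<omega>\<bar> \<le> \<bar>\<tau>\<bar> * (\<kappa> * n * (max s \<rho>) ^ 3)"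
    unfolding abs_mult \<rho>_def using good[of up] s unfolding regular_def by (intro mult_left_mono) auto
  have "2 * (\<Sum>t\<in>{1..int n}. \<epsilon> t \<omega> * discrepancy up p r \<tau> s (x t \<omega>))
     \<le> 4 * (k * (T * sqrt n)) * (norm p + norm r) + 2 * (\<bar>\<tau>\<bar> * (\<kappa> * n * (max s \<rho>) ^ 3))"
    unfolding noise_discrepancy using 1 2 3 4 by (simp add: k_def algebra_simps)
  \<comment> \<open>By the choice of \<open>\<kappa>\<close> the noise of the kink term is half of its signal.\<close>
  moreover have "2 * (\<bar>\<tau>\<bar> * (\<kappa> * n * (max s \<rho>) ^ 3)) = q * n * (max s \<rho>) ^ 3"
    unfolding \<kappa> q by (simp add: power2_eq_square)
  ultimately have upper: "2 * (d * n * E) + \<tau>\<^sup>2 / 2 * Zs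
      \<le> 4 * (k * (T * sqrt n)) * (norm p + norm r) + q * n * (max s \<rho>) ^ 3"
    using lower by linarith
  have young: "4 * (k * (T * sqrt n)) * a \<le> d * n * a\<^sup>2 + 4 * (k * T)\<^sup>2 / d" for a
  proof -
    have "0 \<le> (d * sqrt n * a - 2 * (k * T))\<^sup>2" by simp
    also have "\<dots> = d * (d * n * a\<^sup>2 + 4 * (k * T)\<^sup>2 / d - 4 * (k * (T * sqrt n)) * a)"
      using d0 by (simp add: power2_diff power_mult_distrib) (simp add: power2_eq_square algebra_simps)
    finally show ?thesis using d0 by (simp add: zero_le_mult_iff)
  qed
  have main: "d * n * E + \<tau>\<^sup>2 / 2 * Zs \<le> 8 * (k * T)\<^sup>2 / d + q * n * (max s \<rho>) ^ 3"
  proof -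
    have "4 * (k * (T * sqrt n)) * (norm p + norm r) \<le> d * n * E + 8 * (k * T)\<^sup>2 / d"
      using young[of "norm p"] young[of "norm r"] by (simp add: E_def algebra_simps)
    then show ?thesis using upper by linarith
  qed
  have *: "d * n * E \<le> R \<and> s \<le> (K + 1 + R / q) * rate n"
  proof (cases "s \<le> \<rho>")
    case True
    then have "max s \<rho> = \<rho>" by simp
    then have qK: "q * n * (max s \<rho>) ^ 3 = q * K ^ 3" using rho by (simp only: mult.assoc)
    have "0 \<le> \<tau>\<^sup>2 / 2 * Zs" using Zs0 by simp
    then have "d * n * E \<le> 8 * (k * T)\<^sup>2 / d + q * K ^ 3" using main qK by linarith
    then have E: "d * n * E \<le> R" unfolding R k_def d_def .
    have "0 \<le> R" 
    proof (rule order_trans[OF _ E])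
      show "0 \<le> d * n * E" using d0 unfolding E_def by simp
    qed
    then have "0 \<le> 1 + R / q" using q0 by simp
    then have "\<rho> \<le> (K + 1 + R / q) * rate n" using r0 unfolding \<rho>_def by (intro mult_right_mono) auto
    then show ?thesis using E True by simp
  next
    case False
    then have ms: "max s \<rho> = s" by simp
    have "c\<^sub>0 / 128 * n * s ^ 3 \<le> Zs"
      using good[of up] s False unfolding regular_def Zs_def \<rho>_def by auto
    then have "\<tau>\<^sup>2 / 2 * (c\<^sub>0 / 128 * n * s ^ 3) \<le> \<tau>\<^sup>2 / 2 * Zs" by (intro mult_left_mono) auto
    moreover have "\<tau>\<^sup>2 / 2 * (c\<^sub>0 / 128 * n * s ^ 3) = 2 * (q * n * s ^ 3)" unfolding q by simp
    ultimately have sum: "d * n * E + q * n * s ^ 3 \<le> 8 * (k * T)\<^sup>2 / d" using main unfolding ms by linarith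
    have "0 \<le> q * K ^ 3" using q0 K by simp
    then have R': "d * n * E + q * n * s ^ 3 \<le> R" using sum unfolding R d_def[symmetric] k_def by simp
    have E0: "0 \<le> d * n * E" using d0 unfolding E_def by simp
    have s3: "0 \<le> q * n * s ^ 3" using q0 s by simp
    have R0: "0 \<le> R" using R' E0 s3 by linarith
    define u where "u = s / rate n"
    have u0: "0 \<le> u" unfolding u_def using s r0 by simp
    have su: "s = u * rate n" unfolding u_def using r0 by simp
    have "q * u ^ 3 = q * n * s ^ 3"
      unfolding su power_mult_distrib using rate_cube[OF n] by (simp add: mult_ac)
    then have "u ^ 3 \<le> R / q" using R' E0 q0 by (simp add: pos_le_divide_eq mult.commute)
    have "u \<le> 1 + R / q"
    proof (cases "u \<le> 1")
      case True
      have "0 \<le> R / q" using R0 q0 by simp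
      then show ?thesis using True by linarith
    next
      case False
      then have "u \<le> u ^ 3" using power_increasing[of 1 3 u] by simp
      then show ?thesis using \<open>u ^ 3 \<le> R / q\<close> by linarith
    qed
    then have "u * rate n \<le> (K + 1 + R / q) * rate n" using K r0 by (intro mult_right_mono) auto
    then show ?thesis using su R' s3 by simp
  qed
  have "d * n * (norm p)\<^sup>2 \<le> d * n * E" "d * n * (norm r)\<^sup>2 \<le> d * n * E"
    using d0 by (auto simp: E_def intro!: mult_left_mono)
  then show "c\<^sub>1 / 6 * n * (norm p)\<^sup>2 \<le> R" "c\<^sub>1 / 6 * n * (norm r)\<^sup>2 \<le> R" "s \<le> (K + 1 + R / q) * rate n"
    using * unfolding d_def by auto
qed


lemma exists_small_band:
  "\<exists>\<eta>>0. 2 * \<eta> \<le> h\<^sub>0 \<and> (\<forall>up. (\<integral>\<omega>. (norm (x 0 \<omega>))\<^sup>2 * indicator (band up j g \<eta>) (x 0 \<omega>) \<partial>P) \<le> c\<^sub>1 / 12)"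
proof -
  define m where "m up s = (\<integral>\<omega>. (norm (x 0 \<omega>))\<^sup>2 * indicator (band up j g s) (x 0 \<omega>) \<partial>P)" for up s
  have int: "integrable P (\<lambda>\<omega>. (norm (x 0 \<omega>))\<^sup>2)"
    by (rule square_integrable_imp_integrable) (use x4 in simp_all)
  have "\<exists>d>0. \<forall>s\<in>{0..}. dist s 0 < d \<longrightarrow> dist (m up s) (m up 0) < c\<^sub>1 / 12" for up
  proof -
    have "continuous_on {0..} (m up)" unfolding m_def by (rule band_moment_continuous[OF int no_atoms])
    then have "\<forall>e>0. \<exists>d>0. \<forall>s\<in>{0..}. dist s 0 < d \<longrightarrow> dist (m up s) (m up 0) < e"
      unfolding continuous_on_iff by (rule bspec) simp
    moreover have "0 < c\<^sub>1 / 12" using c\<^sub>1 by simp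
    ultimately show ?thesis by blast
  qed
  then obtain d where d: "\<And>up. 0 < d up" "\<And>up s. 0 \<le> s \<Longrightarrow> s < d up \<Longrightarrow> \<bar>m up s - m up 0\<bar> < c\<^sub>1 / 12"
    unfolding dist_real_def by (metis abs_of_nonneg atLeast_iff diff_zero)
  have m0: "m up 0 = 0" for up unfolding m_def band_0 by simp
  define \<eta> where "\<eta> = min (h\<^sub>0 / 2) (min (d True / 2) (d False / 2))"
  have \<eta>: "0 < \<eta>" "2 * \<eta> \<le> h\<^sub>0" unfolding \<eta>_def using h\<^sub>0 d(1) by auto
  have "\<eta> < d up" for up using d(1)[of True] d(1)[of False] by (cases up) (auto simp: \<eta>_def min_def)
  then have "m up \<eta> \<le> c\<^sub>1 / 12" for up using d(2)[of \<eta> up] \<eta> m0[of up] by (simp add: abs_less_iff less_imp_le)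
  then show ?thesis using \<eta> unfolding m_def by blast
qed

text \<open>Quantifying over all discrepancies that satisfy the basic inequality makes the event independent of the
  choice of a minimizer.\<close>

definition accurate :: "real \<Rightarrow> real \<Rightarrow> real \<Rightarrow> real \<Rightarrow> nat \<Rightarrow> 'w \<Rightarrow> bool" where
  "accurate \<tau>\<^sub>0 S B A n \<omega> \<longleftrightarrow> (\<forall>up p r \<tau> s.
     \<bar>\<tau>\<bar> = \<tau>\<^sub>0 \<and> 0 \<le> s \<and> s \<le> S \<and> norm p \<le> B \<and> norm r \<le> B \<and>
     (\<Sum>t\<in>{1..int n}. (discrepancy up p r \<tau> s (x t \<omega>))\<^sup>2)
       \<le> 2 * (\<Sum>t\<in>{1..int n}. \<epsilon> t \<omega> * discrepancy up p r \<tau> s (x t \<omega>))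
     \<longrightarrow> norm p \<le> A * real n powr (- 1 / 2) \<and> norm r \<le> A * real n powr (- 1 / 2) \<and> s \<le> A * rate n)"

text \<open>The order in which the constants are chosen: \<open>\<eta>\<close> depends on the distribution only, \<open>\<kappa>\<close> on the kink too,
  \<open>\<kappa>'\<close> on \<open>\<eta>\<close>, the kink and the bound on the coefficients, and only \<open>T\<close> and \<open>K\<close>, hence \<open>A\<close>, on the
  admitted probability of failure.\<close>

theorem discrepancy_rates:
  fixes \<tau>\<^sub>0 S B e :: real
  assumes pos: "0 < \<tau>\<^sub>0" "0 < S" "0 \<le> B" "0 < e"
  shows "\<exists>A. \<forall>\<^sub>F n in sequentially. likely P e (accurate \<tau>\<^sub>0 S B A n)"
proof -
  obtain \<eta> where \<eta>: "0 < \<eta>" "2 * \<eta> \<le> h\<^sub>0"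
    "\<And>up. (\<integral>\<omega>. (norm (x 0 \<omega>))\<^sup>2 * indicator (band up j g \<eta>) (x 0 \<omega>) \<partial>P) \<le> c\<^sub>1 / 12"
    using exists_small_band by blast
  define k where "k = real CARD('k)"
  define Q where "Q = \<tau>\<^sub>0\<^sup>2 * c\<^sub>0 * \<eta> ^ 3 / 2048"
  have Q: "0 < Q" unfolding Q_def using pos c\<^sub>0 \<eta> by simp
  \<comment> \<open>The factor of \<open>\<kappa>'\<close> in the noise at far thresholds, by the bounds B on the
    coefficients.\<close>
  define M where "M = 2 * k * B + \<tau>\<^sub>0 * (1 + \<bar>g\<bar>)"
  have M: "0 < M" unfolding M_def k_def using pos by (intro add_nonneg_pos) auto
  define \<kappa> \<kappa>' where "\<kappa> = \<tau>\<^sub>0 * c\<^sub>0 / 1024" and "\<kappa>' = Q / M"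
  have \<kappa>: "0 < \<kappa>" "0 < \<kappa>'" unfolding \<kappa>_def \<kappa>'_def using pos c\<^sub>0 Q M by auto
  obtain T K where TK: "1 \<le> T" "1 \<le> K" "\<forall>\<^sub>F n in sequentially. likely P e (\<lambda>\<omega>. \<forall>up. regular up \<eta> \<kappa> \<kappa>' S T K n \<omega>)"
    using regular_likely[OF \<eta> \<kappa> pos(2,4)] by blast
  define q where "q = \<tau>\<^sub>0\<^sup>2 * c\<^sub>0 / 512"
  define R where "R = 8 * (k * T)\<^sup>2 / (c\<^sub>1 / 6) + q * K ^ 3"
  have q: "0 < q" unfolding q_def using pos c\<^sub>0 by simp
  have R: "0 \<le> R" unfolding R_def using q TK c\<^sub>1 by simp
  define A where "A = sqrt (R / (c\<^sub>1 / 6)) + (K + 1 + R / q)"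
  have A: "sqrt (R / (c\<^sub>1 / 6)) \<le> A" "K + 1 + R / q \<le> A"
  proof -
    have "0 \<le> R / q" "0 \<le> R / (c\<^sub>1 / 6)" using q R c\<^sub>1 by auto
    then show "sqrt (R / (c\<^sub>1 / 6)) \<le> A" "K + 1 + R / q \<le> A" unfolding A_def using TK by auto
  qed
  have ev1: "\<forall>\<^sub>F n in sequentially. K * rate n \<le> \<eta>" by (rule eventually_rate_le) fact
  have ev2: "\<forall>\<^sub>F n in sequentially. (2 * k * B * T) * sqrt (real n) \<le> Q * n" by (rule eventually_sqrt_le) fact
  have "\<forall>\<^sub>F n in sequentially. likely P e (accurate \<tau>\<^sub>0 S B A n)"
    using TK(3) ev1 ev2 eventually_gt_at_top[of 0]
  proof eventually_elim
    case (elim n)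
    have n: "0 < n" by (rule elim(4))
    show ?case
    proof (rule likely_mono[OF elim(1) order_refl], unfold accurate_def, intro allI impI)
      fix \<omega> up p r \<tau> s
      assume \<omega>: "\<omega> \<in> space P" and good: "\<forall>up. regular up \<eta> \<kappa> \<kappa>' S T K n \<omega>"
      assume H: "\<bar>\<tau>\<bar> = \<tau>\<^sub>0 \<and> 0 \<le> s \<and> s \<le> S \<and> norm p \<le> B \<and> norm r \<le> B \<and>
       (\<Sum>t\<in>{1..int n}. (discrepancy up p r \<tau> s (x t \<omega>))\<^sup>2)
         \<le> 2 * (\<Sum>t\<in>{1..int n}. \<epsilon> t \<omega> * discrepancy up p r \<tau> s (x t \<omega>))"
      then have \<tau>: "\<tau> \<noteq> 0" "\<tau>\<^sub>0 = \<bar>\<tau>\<bar>" "\<tau>\<^sub>0\<^sup>2 = \<tau>\<^sup>2" using pos by auto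
      note good' = good[rule_format]
      have near: "s \<le> \<eta>"
      proof (rule ccontr)
        assume "\<not> s \<le> \<eta>"
        then have s: "\<eta> \<le> s" by simp
        show False
        proof (rule regular_not_far[where up = up and p = p and r = r, OF good' \<omega> n \<eta>(1) _ s _ _ elim(2) \<tau>(1)])
          show "2 * real CARD('k) * B * (T * sqrt n) \<le> Q * n" using elim(3) unfolding k_def by (simp add: mult_ac)
          have "M * \<kappa>' = Q" unfolding \<kappa>'_def using M by simp
          then show "(2 * real CARD('k) * B + \<bar>\<tau>\<bar> * (1 + \<bar>g\<bar>)) * \<kappa>' \<le> Q"
            unfolding M_def k_def \<tau>(2) by simp
          show "Q = \<tau>\<^sup>2 * c\<^sub>0 * \<eta> ^ 3 / 2048" unfolding Q_def \<tau>(3) ..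
        qed (use H \<kappa> in auto)
      qed
      have \<kappa>_eq: "\<kappa> = \<bar>\<tau>\<bar> * c\<^sub>0 / 1024" unfolding \<kappa>_def \<tau>(2) ..
      have q_eq: "q = \<tau>\<^sup>2 * c\<^sub>0 / 512" unfolding q_def \<tau>(3) ..
      have R_eq: "R = 8 * (real CARD('k) * T)\<^sup>2 / (c\<^sub>1 / 6) + q * K ^ 3" unfolding R_def k_def ..
      have T0: "0 \<le> T" "0 \<le> K" using TK by auto
      have s0: "0 \<le> s" and basic: "(\<Sum>t\<in>{1..int n}. (discrepancy up p r \<tau> s (x t \<omega>))\<^sup>2)
         \<le> 2 * (\<Sum>t\<in>{1..int n}. \<epsilon> t \<omega> * discrepancy up p r \<tau> s (x t \<omega>))" using H by auto
      note bounds = regular_near[OF good' n s0 near T0 \<tau>(1) \<kappa>_eq basic q_eq R_eq]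
      have root: "norm u \<le> A * real n powr (- 1 / 2)" if "c\<^sub>1 / 6 * n * (norm u)\<^sup>2 \<le> R" for u :: "real^'k"
      proof -
        have "n * (norm u)\<^sup>2 \<le> R / (c\<^sub>1 / 6)" using that c\<^sub>1 by (simp add: field_simps)
        then have "sqrt (n * (norm u)\<^sup>2) \<le> sqrt (R / (c\<^sub>1 / 6))" by (rule real_sqrt_le_mono)
        then have "sqrt n * norm u \<le> A" using A(1) by (simp add: real_sqrt_mult)
        then have "norm u \<le> A * (1 / sqrt n)" using n by (simp add: pos_le_divide_eq mult.commute)
        moreover have "real n powr (- 1 / 2) = 1 / sqrt n"
          using n by (simp add: powr_minus powr_half_sqrt inverse_eq_divide minus_divide_left[symmetric])
        ultimately show ?thesis by simp
      qed
      have "(K + 1 + R / q) * rate n \<le> A * rate n"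
        using A(2) rate_pos[OF n] by (intro mult_right_mono) auto
      then show "norm p \<le> A * real n powr (- 1 / 2) \<and> norm r \<le> A * real n powr (- 1 / 2) \<and> s \<le> A * rate n"
        using root[OF bounds(1)] root[OF bounds(2)] bounds(3) by linarith
    qed
  qed
  then show ?thesis by blast
qed

end

section \<open>The threshold regression model\<close>

lemma inner_stack: "stack b d \<bullet> stack b' d' = b \<bullet> b' + d \<bullet> (d' :: real^'k)"
proof -
  have "stack b d \<bullet> stack b' d' = (\<Sum>s\<in>UNIV <+> UNIV. stack b d $ s * stack b' d' $ s)"
    by (simp add: inner_vec_def UNIV_Plus_UNIV)
  also have "\<dots> = b \<bullet> b' + d \<bullet> d'"
    by (subst sum.Plus) (auto simp: stack_def inner_vec_def)
  finally show ?thesis .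
qed

lemma norm_stack: "(norm (stack b (d :: real^'k)))\<^sup>2 = (norm b)\<^sup>2 + (norm d)\<^sup>2"
  by (simp add: power2_norm_eq_inner inner_stack)

lemma norm_stack_ge: "norm b \<le> norm (stack b (d :: real^'k))" "norm d \<le> norm (stack b d)"
  by (rule power2_le_imp_le; simp add: norm_stack)+

lemma norm_stack_le: "norm (stack b (d :: real^'k)) \<le> norm b + norm d"
  by (rule power2_le_imp_le) (simp_all add: norm_stack power2_sum)

lemma stack_diff: "stack b d - stack b' d' = stack (b - b') (d - d' :: real^'k)"
  unfolding stack_def vec_eq_iff by (auto split: sum.split)

lemma stack_components:
  obtains b d :: "real^'k" where "\<alpha> = stack b d"
proof -
  have "\<alpha> = stack (\<chi> i. \<alpha> $ Inl i) (\<chi> i. \<alpha> $ Inr i)"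
    unfolding stack_def vec_eq_iff by (auto split: sum.split)
  then show ?thesis using that by blast
qed

lemma inner_thr_regressor:
  "stack b d \<bullet> thr_regressor j v \<gamma> = b \<bullet> v + (d \<bullet> v) * of_bool (v $ j > \<gamma>)" for v :: "real^'k"
  unfolding thr_regressor_def inner_stack by simp

lemma inner_outer_square: "v \<bullet> (outer_square u *v v) = (v \<bullet> u)\<^sup>2" for u v :: "real^'n"
proof -
  have "outer_square u *v v = (u \<bullet> v) *\<^sub>R u"
    by (simp add: vec_eq_iff outer_square_def matrix_vector_mult_def inner_vec_def sum_distrib_left mult_ac)
  then show ?thesis by (simp add: power2_eq_square inner_commute)
qed

text \<open>The Bochner integral of a non-integrable matrix is 0, which is not positive definite; so integrability
  comes with the hypothesis.\<close>

lemma pos_def_second_moment: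
  fixes X :: "'w \<Rightarrow> real^'n"
  assumes "pos_def (\<integral>\<omega>. outer_square (X \<omega>) \<partial>P)" "v \<noteq> 0"
  shows "0 < (\<integral>\<omega>. (v \<bullet> X \<omega>)\<^sup>2 \<partial>P)"
proof -
  let ?q = "\<lambda>A :: real^'n^'n. v \<bullet> (A *v v)"
  have pos: "0 < ?q (\<integral>\<omega>. outer_square (X \<omega>) \<partial>P)" using assms unfolding pos_def_block_def by blast
  have int: "integrable P (\<lambda>\<omega>. outer_square (X \<omega>))"
  proof (rule ccontr)
    assume "\<not> integrable P (\<lambda>\<omega>. outer_square (X \<omega>))"
    then have "(\<integral>\<omega>. outer_square (X \<omega>) \<partial>P) = 0" by (rule not_integrable_integral_eq)
    then show False using pos by simp
  qed
  have "linear ?q"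
    by (rule linearI) (simp_all add: matrix_vector_mult_add_rdistrib inner_add_right scaleR_matrix_vector_assoc[symmetric])
  then have "bounded_linear ?q" by (simp add: linear_conv_bounded_linear)
  from integral_bounded_linear[OF this int] pos show ?thesis unfolding inner_outer_square by simp
qed

text \<open>By homogeneity the minimum over the unit sphere serves as the constant.\<close>

lemma quadratic_form_bounded_below:
  fixes m :: "'k::finite \<Rightarrow> 'k \<Rightarrow> real" and q :: "real^'k \<Rightarrow> real"
  assumes q: "\<And>p. q p = (\<Sum>a\<in>UNIV. \<Sum>b\<in>UNIV. p $ a * p $ b * m a b)" and pos: "\<And>p. p \<noteq> 0 \<Longrightarrow> 0 < q p"
  shows "\<exists>c>0. \<forall>p. c * (norm p)\<^sup>2 \<le> q p"
proof -
  let ?S = "sphere (0 :: real^'k) 1"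
  have "continuous_on ?S q" unfolding q by (intro continuous_intros)
  moreover have "axis undefined 1 \<in> ?S" by simp
  ultimately obtain u where u: "u \<in> ?S" "\<And>p. p \<in> ?S \<Longrightarrow> q u \<le> q p"
    using continuous_attains_inf[of ?S q] by auto
  have "q u * (norm p)\<^sup>2 \<le> q p" for p
  proof (cases "p = 0")
    case True
    then show ?thesis by (simp add: q)
  next
    case False
    have scale: "q (s *\<^sub>R p) = s\<^sup>2 * q p" for s
      unfolding q by (simp add: sum_distrib_left power2_eq_square mult_ac)
    have "(1 / norm p) *\<^sub>R p \<in> ?S" using False by simp
    from u(2)[OF this] have "q u \<le> q p / (norm p)\<^sup>2" unfolding scale by (simp add: power_divide)
    then show ?thesis using False by (simp add: field_simps)
  qed
  moreover have "0 < q u" using u(1) by (intro pos) auto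
  ultimately show ?thesis by blast
qed

text \<open>Positive definiteness of \<open>M\<close>, tested on \<open>(p, -p)\<close> and \<open>(0, p)\<close>, gives nondegeneracy in each regime
  separately.\<close>

lemma base_moment_positive:
  fixes X :: "'w \<Rightarrow> real^'k"
  assumes pd: "pos_def (\<integral>\<omega>. outer_square (thr_regressor j (X \<omega>) g) \<partial>P)" and "p \<noteq> 0"
  shows "0 < (\<integral>\<omega>. (p \<bullet> X \<omega>)\<^sup>2 * indicator (base up j g) (X \<omega>) \<partial>P)"
proof -
  define v where "v = (if up then stack p (- p) else stack 0 p)"
  have "norm p \<le> norm v" unfolding v_def by (simp add: norm_stack_ge)
  then have "v \<noteq> 0" using \<open>p \<noteq> 0\<close> by auto
  have sq: "(v \<bullet> thr_regressor j u g)\<^sup>2 = (p \<bullet> u)\<^sup>2 * indicator (base up j g) u" for u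
    unfolding v_def by (simp add: inner_thr_regressor base_def indicator_def)
  from pos_def_second_moment[OF pd \<open>v \<noteq> 0\<close>] show ?thesis unfolding sq .
qed

lemma base_moment_bounded_below:
  fixes X :: "'w \<Rightarrow> real^'k"
  assumes [measurable]: "X \<in> borel_measurable P" and int: "integrable P (\<lambda>\<omega>. (norm (X \<omega>))\<^sup>2)"
    and pd: "pos_def (\<integral>\<omega>. outer_square (thr_regressor j (X \<omega>) g) \<partial>P)"
  shows "\<exists>c>0. \<forall>up p. c * (norm p)\<^sup>2 \<le> (\<integral>\<omega>. (p \<bullet> X \<omega>)\<^sup>2 * indicator (base up j g) (X \<omega>) \<partial>P)"
proof -
  have "\<exists>c>0. \<forall>p. c * (norm p)\<^sup>2 \<le> (\<integral>\<omega>. (p \<bullet> X \<omega>)\<^sup>2 * indicator (base up j g) (X \<omega>) \<partial>P)" for up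
  proof (rule quadratic_form_bounded_below)
    fix p
    have "integrable P (\<lambda>\<omega>. X \<omega> $ a * X \<omega> $ b * indicator (base up j g) (X \<omega>))" for a b
    proof (rule Bochner_Integration.integrable_bound[OF int])
      have "\<bar>X \<omega> $ a * X \<omega> $ b\<bar> \<le> norm (X \<omega>) * norm (X \<omega>)" for \<omega>
        unfolding abs_mult by (intro mult_mono component_le_norm_cart) auto
      then show "AE \<omega> in P. norm (X \<omega> $ a * X \<omega> $ b * indicator (base up j g) (X \<omega>)) \<le> norm ((norm (X \<omega>))\<^sup>2)"
        by (intro AE_I2) (auto simp: indicator_def power2_eq_square)
    qed measurable
    moreover have "(p \<bullet> X \<omega>)\<^sup>2 * indicator (base up j g) (X \<omega>)
       = (\<Sum>a\<in>UNIV. \<Sum>b\<in>UNIV. p $ a * p $ b * (X \<omega> $ a * X \<omega> $ b * indicator (base up j g) (X \<omega>)))" for \<omega>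
    proof -
      have "(p \<bullet> X \<omega>)\<^sup>2 = (\<Sum>a\<in>UNIV. \<Sum>b\<in>UNIV. (p $ a * X \<omega> $ a) * (p $ b * X \<omega> $ b))"
        by (simp add: power2_eq_square inner_vec_def sum_product)
      then show ?thesis
        unfolding sum_distrib_right by (simp only: sum_distrib_right) (intro sum.cong, simp_all add: mult_ac)
    qed
    ultimately show "(\<integral>\<omega>. (p \<bullet> X \<omega>)\<^sup>2 * indicator (base up j g) (X \<omega>) \<partial>P)
       = (\<Sum>a\<in>UNIV. \<Sum>b\<in>UNIV. p $ a * p $ b * (\<integral>\<omega>. X \<omega> $ a * X \<omega> $ b * indicator (base up j g) (X \<omega>) \<partial>P))"
      by simp
  qed (rule base_moment_positive[OF pd])
  then obtain c where c: "\<And>up. 0 < c up"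
    "\<And>up p. c up * (norm p)\<^sup>2 \<le> (\<integral>\<omega>. (p \<bullet> X \<omega>)\<^sup>2 * indicator (base up j g) (X \<omega>) \<partial>P)" by metis
  have "min (c True) (c False) * (norm p)\<^sup>2 \<le> c up * (norm p)\<^sup>2" for up p
    by (cases up) (auto intro: mult_right_mono)
  from order_trans[OF this c(2)]
  have "\<forall>up p. min (c True) (c False) * (norm p)\<^sup>2 \<le> (\<integral>\<omega>. (p \<bullet> X \<omega>)\<^sup>2 * indicator (base up j g) (X \<omega>) \<partial>P)"
    by blast
  moreover have "0 < min (c True) (c False)" using c(1) by simp
  ultimately show ?thesis by blast
qed

lemma (in prob_space) strip_probability:
  fixes X :: "'a \<Rightarrow> real^'k" and f :: "real \<Rightarrow> real"
  assumes d: "distributed M lborel (\<lambda>\<omega>. X \<omega> $ j) (\<lambda>r. ennreal (f r))" and "a \<le> b"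
    and bounds: "\<And>r. a < r \<Longrightarrow> r \<le> b \<Longrightarrow> l \<le> f r \<and> f r \<le> u" and "0 \<le> l" "0 \<le> u"
  shows "l * (b - a) \<le> expectation (\<lambda>\<omega>. indicator (strip j a b) (X \<omega>))"
    and "expectation (\<lambda>\<omega>. indicator (strip j a b) (X \<omega>)) \<le> u * (b - a)"
proof -
  have [measurable]: "(\<lambda>\<omega>. X \<omega> $ j) \<in> borel_measurable M" using distributed_measurable[OF d] by simp
  define A where "A = (\<lambda>\<omega>. X \<omega> $ j) -` {a<..b} \<inter> space M"
  have A: "A \<in> sets M" unfolding A_def by measurable
  have "expectation (\<lambda>\<omega>. indicator (strip j a b) (X \<omega>)) = expectation (indicator A :: 'a \<Rightarrow> real)"
    by (rule Bochner_Integration.integral_cong) (auto simp: A_def strip_def indicator_def)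
  then have E: "expectation (\<lambda>\<omega>. indicator (strip j a b) (X \<omega>)) = prob A" using A by simp
  have em: "ennreal (prob A) = (\<integral>\<^sup>+r. ennreal (f r) * indicator {a<..b} r \<partial>lborel)"
    using distributed_emeasure[OF d, of "{a<..b}"] by (simp add: A_def emeasure_eq_measure)
  have const: "(\<integral>\<^sup>+r. ennreal k * indicator {a<..b} r \<partial>lborel) = ennreal (k * (b - a))" if "0 \<le> k" for k
    using \<open>a \<le> b\<close> that by (simp add: nn_integral_cmult ennreal_mult)
  have "ennreal (l * (b - a)) \<le> ennreal (prob A)"
    unfolding em const[OF \<open>0 \<le> l\<close>, symmetric]
    by (intro nn_integral_mono) (use bounds in \<open>auto simp: indicator_def intro: ennreal_leI\<close>)
  then show "l * (b - a) \<le> expectation (\<lambda>\<omega>. indicator (strip j a b) (X \<omega>))" unfolding E by simp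
  have "ennreal (prob A) \<le> ennreal (u * (b - a))"
    unfolding em const[OF \<open>0 \<le> u\<close>, symmetric]
    by (intro nn_integral_mono) (use bounds in \<open>auto simp: indicator_def intro: ennreal_leI\<close>)
  then show "expectation (\<lambda>\<omega>. indicator (strip j a b) (X \<omega>)) \<le> u * (b - a)"
    unfolding E using \<open>a \<le> b\<close> \<open>0 \<le> u\<close> by simp
qed

lemma (in prob_space) distributed_no_atoms:
  fixes q :: "'a \<Rightarrow> real"
  assumes d: "distributed M lborel q (\<lambda>r. ennreal (f r))"
  shows "prob {\<omega>\<in>space M. q \<omega> = r} = 0"
proof -
  have "emeasure M (q -` {r} \<inter> space M) = (\<integral>\<^sup>+s. ennreal (f s) * indicator {r} s \<partial>lborel)"
    by (rule distributed_emeasure[OF d]) simp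
  also have "\<dots> = 0"
  proof -
    have "AE s in lborel. s \<noteq> r" by (rule AE_lborel_singleton)
    then have "(\<integral>\<^sup>+s. ennreal (f s) * indicator {r} s \<partial>lborel) = (\<integral>\<^sup>+s. 0 \<partial>(lborel :: real measure))"
      by (intro nn_integral_cong_AE) (auto elim: eventually_mono)
    then show ?thesis by simp
  qed
  also have "q -` {r} \<inter> space M = {\<omega>\<in>space M. q \<omega> = r}" by auto
  finally show ?thesis by (simp add: emeasure_eq_measure)
qed

text \<open>Condition on \<open>q\<close>, which determines the indicator of the strip.\<close>

lemma (in prob_space) strip_conditional_bound:
  fixes X :: "'a \<Rightarrow> real^'k"
  assumes [measurable]: "X \<in> borel_measurable M" and Y: "integrable M Y"
    and ce: "cond_exp_given M (\<lambda>\<omega>. X \<omega> $ j) Y m"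
    and bound: "\<And>r. a < r \<Longrightarrow> r \<le> b \<Longrightarrow> m r \<le> C"
  shows "expectation (\<lambda>\<omega>. Y \<omega> * indicator (strip j a b) (X \<omega>)) \<le> C * expectation (\<lambda>\<omega>. indicator (strip j a b) (X \<omega>))"
proof -
  let ?q = "\<lambda>\<omega>. X \<omega> $ j"
  define G where "G = vimage_algebra (space M) ?q borel"
  have q: "?q \<in> borel_measurable M" by measurable
  have "subalgebra M G"
    unfolding subalgebra_def G_def using measurable_sets[OF q]
    by (auto simp: sets_vimage_algebra2)
  then interpret finite_measure_subalgebra M G by unfold_locales
  let ?I = "\<lambda>\<omega>. indicator {a<..b} (?q \<omega>) :: real"
  have qG: "?q \<in> measurable G borel" unfolding G_def by (rule measurable_vimage_algebra1) simp
  have IG: "?I \<in> borel_measurable G" using qG by measurable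
  have I: "?I \<omega> = indicator (strip j a b) (X \<omega>)" for \<omega> by (simp add: strip_def indicator_def)
  have [measurable]: "Y \<in> borel_measurable M" using Y by auto
  have int: "integrable M (\<lambda>\<omega>. ?I \<omega> * Y \<omega>)"
    by (rule Bochner_Integration.integrable_bound[OF Y]) (measurable, auto simp: indicator_def)
  note ceI = real_cond_exp_intg[OF int IG]
  have AE: "AE \<omega> in M. real_cond_exp M G Y \<omega> = m (?q \<omega>)"
    using ce unfolding cond_exp_given_def G_def by blast
  have "expectation (\<lambda>\<omega>. Y \<omega> * indicator (strip j a b) (X \<omega>)) = expectation (\<lambda>\<omega>. ?I \<omega> * Y \<omega>)"
    by (simp add: I mult.commute)
  also have "\<dots> = expectation (\<lambda>\<omega>. ?I \<omega> * real_cond_exp M G Y \<omega>)" by (rule ceI(2)[symmetric]) simp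
  also have "\<dots> \<le> expectation (\<lambda>\<omega>. C * ?I \<omega>)"
  proof (rule integral_mono_AE)
    show "integrable M (\<lambda>\<omega>. ?I \<omega> * real_cond_exp M G Y \<omega>)" by (rule ceI(1)) simp
    show "integrable M (\<lambda>\<omega>. C * ?I \<omega>)"
      by (intro integrable_mult_right integrable_const_bound[where B = 1]) (auto simp: indicator_def)
    show "AE \<omega> in M. ?I \<omega> * real_cond_exp M G Y \<omega> \<le> C * ?I \<omega>"
      using AE by eventually_elim (use bound in \<open>auto simp: indicator_def\<close>)
  qed
  also have "\<dots> = C * expectation (\<lambda>\<omega>. indicator (strip j a b) (X \<omega>))" by (simp add: I)
  finally show ?thesis .
qed

lemma kink_inner:
  fixes \<delta>\<^sub>0 v :: "real^'k"
  assumes "assumption_C c j \<delta>\<^sub>0 \<gamma>\<^sub>0" "c \<noteq> j" "v $ c = 1"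
  shows "\<delta>\<^sub>0 \<bullet> v = \<delta>\<^sub>0 $ j * (v $ j - \<gamma>\<^sub>0)"
proof -
  have z: "\<delta>\<^sub>0 $ i = 0" if "i \<notin> {c, j}" for i using assms(1) that unfolding assumption_C_def by blast
  have "\<delta>\<^sub>0 \<bullet> v = (\<Sum>i\<in>{c, j}. \<delta>\<^sub>0 $ i * v $ i)"
    unfolding inner_vec_def by (simp, rule sum.mono_neutral_right) (use z in auto)
  also have "\<dots> = \<delta>\<^sub>0 $ c + \<delta>\<^sub>0 $ j * v $ j" using assms(2,3) by simp
  also have "\<delta>\<^sub>0 $ c = - (\<delta>\<^sub>0 $ j * \<gamma>\<^sub>0)" using assms(1) unfolding assumption_C_def by linarith
  finally show ?thesis by (simp add: algebra_simps)
qed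

text \<open>Compare the criterion at the minimizer and at the true parameter.\<close>

lemma basic_inequality:
  assumes model: "threshold_model P c j y x \<epsilon> \<beta>\<^sub>0 \<delta>\<^sub>0 \<gamma>\<^sub>0" and \<omega>: "\<omega> \<in> space P" and "n \<ge> 1"
    and min: "is_arg_min (ls_criterion j y x n \<omega>) (\<lambda>\<theta>. \<theta> \<in> \<Theta>) (\<alpha>, \<gamma>)" and "(stack \<beta>\<^sub>0 \<delta>\<^sub>0, \<gamma>\<^sub>0) \<in> \<Theta>"
  defines "h \<equiv> \<lambda>t. \<alpha> \<bullet> thr_regressor j (x t \<omega>) \<gamma> - stack \<beta>\<^sub>0 \<delta>\<^sub>0 \<bullet> thr_regressor j (x t \<omega>) \<gamma>\<^sub>0"
  shows "(\<Sum>t\<in>{1..int n}. (h t)\<^sup>2) \<le> 2 * (\<Sum>t\<in>{1..int n}. \<epsilon> t \<omega> * h t)"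
proof -
  have y: "y t \<omega> = stack \<beta>\<^sub>0 \<delta>\<^sub>0 \<bullet> thr_regressor j (x t \<omega>) \<gamma>\<^sub>0 + \<epsilon> t \<omega>" for t
    using model \<omega> unfolding threshold_model_def inner_thr_regressor by simp
  have "ls_criterion j y x n \<omega> (\<alpha>, \<gamma>) \<le> ls_criterion j y x n \<omega> (stack \<beta>\<^sub>0 \<delta>\<^sub>0, \<gamma>\<^sub>0)"
    using min assms(5) unfolding is_arg_min_def by (meson not_le)
  then have "(\<Sum>t\<in>{1..int n}. (y t \<omega> - \<alpha> \<bullet> thr_regressor j (x t \<omega>) \<gamma>)\<^sup>2)
     \<le> (\<Sum>t\<in>{1..int n}. (y t \<omega> - stack \<beta>\<^sub>0 \<delta>\<^sub>0 \<bullet> thr_regressor j (x t \<omega>) \<gamma>\<^sub>0)\<^sup>2)"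
    using \<open>n \<ge> 1\<close> unfolding ls_criterion_def by (simp add: divide_le_cancel)
  also have "\<dots> = (\<Sum>t\<in>{1..int n}. (\<epsilon> t \<omega>)\<^sup>2)" unfolding y by simp
  finally have "(\<Sum>t\<in>{1..int n}. (\<epsilon> t \<omega> - h t)\<^sup>2) \<le> (\<Sum>t\<in>{1..int n}. (\<epsilon> t \<omega>)\<^sup>2)"
    unfolding y h_def by (simp add: algebra_simps)
  moreover have "(\<Sum>t\<in>{1..int n}. (\<epsilon> t \<omega> - h t)\<^sup>2)
     = (\<Sum>t\<in>{1..int n}. (\<epsilon> t \<omega>)\<^sup>2) + (\<Sum>t\<in>{1..int n}. (h t)\<^sup>2) - 2 * (\<Sum>t\<in>{1..int n}. \<epsilon> t \<omega> * h t)"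
    by (simp add: power2_diff sum.distrib sum_subtractf sum_distrib_left mult.assoc)
  ultimately show ?thesis by linarith
qed

lemma (in prob_space) bounded_in_probI:
  assumes "\<And>e. 0 < e \<Longrightarrow> \<exists>A. \<forall>\<^sub>F n in sequentially. likely M e (\<lambda>\<omega>. norm (X n \<omega>) \<le> A * r n)"
  shows "bounded_in_prob M X r"
  unfolding bounded_in_prob_def
proof (intro allI impI)
  fix e :: real assume "0 < e"
  then obtain A where "\<forall>\<^sub>F n in sequentially. likely M (e / 2) (\<lambda>\<omega>. norm (X n \<omega>) \<le> A * r n)"
    using assms[of "e / 2"] by auto
  then have "\<forall>\<^sub>F n in sequentially. measure M {\<omega>\<in>space M. norm (X n \<omega>) > A * r n} < e"
  proof eventually_elim
    case (elim n)
    have "measure M {\<omega>\<in>space M. norm (X n \<omega>) > A * r n} \<le> e / 2"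
      by (rule prob_le_of_likely[OF elim]) simp
    then show ?case using \<open>0 < e\<close> by simp
  qed
  then show "\<exists>K. \<forall>\<^sub>F n in sequentially. measure M {\<omega>\<in>space M. norm (X n \<omega>) > K * r n} < e" by blast
qed

theorem proposition1:
  fixes P :: "'w measure"
    and F :: "int \<Rightarrow> 'w measure"
    and c j :: "'k::finite"
    and y \<epsilon> :: "int \<Rightarrow> 'w \<Rightarrow> real"
    and x :: "int \<Rightarrow> 'w \<Rightarrow> real^'k"
    and \<beta>\<^sub>0 \<delta>\<^sub>0 :: "real^'k"
    and \<gamma>\<^sub>0 :: real
    and \<Lambda> :: "(real^('k + 'k)) set"
    and \<Gamma> :: "real set"
    and f m\<^sub>4 w\<^sub>4 :: "real \<Rightarrow> real"
    and D V :: "real \<Rightarrow> real^'k^'k"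
    and \<alpha>_hat :: "nat \<Rightarrow> 'w \<Rightarrow> real^('k + 'k)"
    and \<gamma>_hat :: "nat \<Rightarrow> 'w \<Rightarrow> real"
  assumes "prob_space P"
    and "threshold_model P c j y x \<epsilon> \<beta>\<^sub>0 \<delta>\<^sub>0 \<gamma>\<^sub>0"
    and "compact (\<Lambda> \<times> \<Gamma>)"
    and "\<Gamma> \<subseteq> interior (rv_support P (\<lambda>\<omega>. x 0 \<omega> $ j))"
    and "(stack \<beta>\<^sub>0 \<delta>\<^sub>0, \<gamma>\<^sub>0) \<in> \<Lambda> \<times> \<Gamma>"
    and "assumption_C c j \<delta>\<^sub>0 \<gamma>\<^sub>0"
    and "assumption_Z P F j x \<epsilon> \<gamma>\<^sub>0"
    and "assumption_Q P c j x \<epsilon> \<gamma>\<^sub>0 \<Gamma> f D V m\<^sub>4 w\<^sub>4"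
    and "\<And>n. \<alpha>_hat n \<in> borel_measurable P" and "\<And>n. \<gamma>_hat n \<in> borel_measurable P"
    and "\<And>n \<omega>. n \<ge> 1 \<Longrightarrow> \<omega> \<in> space P \<Longrightarrow>
           is_arg_min (ls_criterion j y x n \<omega>) (\<lambda>\<theta>. \<theta> \<in> \<Lambda> \<times> \<Gamma>) (\<alpha>_hat n \<omega>, \<gamma>_hat n \<omega>)"
  shows "bounded_in_prob P (\<lambda>n \<omega>. \<alpha>_hat n \<omega> - stack \<beta>\<^sub>0 \<delta>\<^sub>0) (\<lambda>n. real n powr (- 1 / 2)) \<and>
         bounded_in_prob P (\<lambda>n \<omega>. \<gamma>_hat n \<omega> - \<gamma>\<^sub>0) (\<lambda>n. real n powr (- 1 / 3))"
proof -
  interpret prob_space P by fact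
  note model = assms(2)[unfolded threshold_model_def]
  note observed = model[THEN conjunct2]
  have cj: "c \<noteq> j" by (rule conjunct1[OF model])
  have const: "x t \<omega> $ c = 1" if "\<omega> \<in> space P" for t \<omega>
    by (rule conjunct1[OF bspec[OF spec[OF conjunct2[OF observed]] that]])
  note Z = assms(7)[unfolded assumption_Z_def Let_def]
  note Q = assms(8)[unfolded assumption_Q_def Let_def]
  note adapted = spec[OF Z[THEN conjunct2, THEN conjunct2, THEN conjunct2, THEN conjunct2, THEN conjunct1]]
  interpret mixing_noise P F x \<epsilon>
  proof (intro mixing_noise.intro mixing_noise_axioms.intro)
    show "prob_space P" by fact
    fix t
    note meas = spec[OF conjunct1[OF observed], of t]
    show "x t \<in> borel_measurable P" by (rule conjunct1[OF meas])
    show "\<epsilon> t \<in> borel_measurable P" by (rule conjunct2[OF meas])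
    show "strictly_stationary P (\<lambda>t \<omega>. (x t \<omega>, \<epsilon> t \<omega>))" by (rule Z[THEN conjunct1])
    show "summable (\<lambda>m. sqrt (rho_mixing P (\<lambda>t \<omega>. (x t \<omega>, \<epsilon> t \<omega>)) (Suc m)))" by (rule Z[THEN conjunct2, THEN conjunct2, THEN conjunct1])
    show "filtration (space P) (\<lambda>i::nat. F (int i))" by (rule Z[THEN conjunct2, THEN conjunct2, THEN conjunct2, THEN conjunct1])
    show "subalgebra P (F t)" by (rule conjunct1[OF adapted])
    show "\<epsilon> t \<in> borel_measurable (F t)" by (rule conjunct1[OF conjunct2[OF adapted]])
    show "x t \<in> borel_measurable (F (t - 1))" by (rule conjunct2[OF conjunct2[OF adapted]])
    show "AE \<omega> in P. real_cond_exp P (F (t - 1)) (\<epsilon> t) \<omega> = 0" by (rule spec[OF Z[THEN conjunct2, THEN conjunct2, THEN conjunct2, THEN conjunct2, THEN conjunct2, THEN conjunct1]])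
  qed
  have pd: "pos_def (\<integral>\<omega>. outer_square (thr_regressor j (x 0 \<omega>) \<gamma>\<^sub>0) \<partial>P)" by (rule Z[THEN conjunct2, THEN conjunct2, THEN conjunct2, THEN conjunct2, THEN conjunct2, THEN conjunct2, THEN conjunct1])
  have x4: "integrable P (\<lambda>\<omega>. norm (x 0 \<omega>) ^ 4)" by (rule Z[THEN conjunct2, THEN conjunct2, THEN conjunct2, THEN conjunct2, THEN conjunct2, THEN conjunct2, THEN conjunct2, THEN conjunct2, THEN conjunct1])
  have ex4: "integrable P (\<lambda>\<omega>. norm (\<epsilon> 0 \<omega> *\<^sub>R x 0 \<omega>) ^ 4)" by (rule Z[THEN conjunct2, THEN conjunct2, THEN conjunct2, THEN conjunct2, THEN conjunct2, THEN conjunct2, THEN conjunct2, THEN conjunct2, THEN conjunct2, THEN conjunct1])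
  have dens: "distributed P lborel (\<lambda>\<omega>. x 0 \<omega> $ j) (\<lambda>r. ennreal (f r))" by (rule Q[THEN conjunct2, THEN conjunct1])
  have condV: "cond_exp_given_mat P (\<lambda>\<omega>. x 0 \<omega> $ j) (\<lambda>\<omega>. (\<epsilon> 0 \<omega>)\<^sup>2 *\<^sub>R outer_square (x 0 \<omega>)) V" by (rule Q[THEN conjunct2, THEN conjunct2, THEN conjunct2, THEN conjunct1])
  have contf: "isCont f \<gamma>\<^sub>0" by (rule Q[THEN conjunct2, THEN conjunct2, THEN conjunct2, THEN conjunct2, THEN conjunct2, THEN conjunct2, THEN conjunct1])
  have contV: "isCont V \<gamma>\<^sub>0" by (rule Q[THEN conjunct2, THEN conjunct2, THEN conjunct2, THEN conjunct2, THEN conjunct2, THEN conjunct2, THEN conjunct2, THEN conjunct1])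
  have fpos: "0 < f \<gamma>" if "\<gamma> \<in> \<Gamma>" for \<gamma> by (rule conjunct1[OF bspec[OF Q[THEN conjunct2, THEN conjunct2, THEN conjunct2, THEN conjunct2, THEN conjunct2, THEN conjunct2, THEN conjunct2, THEN conjunct2, THEN conjunct2, THEN conjunct1] that]])
  have \<gamma>\<^sub>0: "\<gamma>\<^sub>0 \<in> \<Gamma>" and \<Theta>\<^sub>0: "(stack \<beta>\<^sub>0 \<delta>\<^sub>0, \<gamma>\<^sub>0) \<in> \<Lambda> \<times> \<Gamma>" using assms(5) by auto
  define f\<^sub>0 where "f\<^sub>0 = f \<gamma>\<^sub>0"
  have f\<^sub>0: "0 < f\<^sub>0" unfolding f\<^sub>0_def by (rule fpos[OF \<gamma>\<^sub>0])
  define W where "W i = \<bar>V \<gamma>\<^sub>0 $ i $ i\<bar> + 1" for i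
  have W: "0 \<le> W i" for i unfolding W_def by simp
  have "\<forall>\<^sub>F r in nhds \<gamma>\<^sub>0. f\<^sub>0 / 2 < f r"
    using contf f\<^sub>0 unfolding isCont_def tendsto_at_iff_tendsto_nhds f\<^sub>0_def by (intro order_tendstoD(1)) auto
  moreover have "\<forall>\<^sub>F r in nhds \<gamma>\<^sub>0. f r < 2 * f\<^sub>0"
    using contf f\<^sub>0 unfolding isCont_def tendsto_at_iff_tendsto_nhds f\<^sub>0_def by (intro order_tendstoD(2)) auto
  moreover have "\<forall>\<^sub>F r in nhds \<gamma>\<^sub>0. \<forall>i\<in>UNIV. V r $ i $ i < W i"
  proof (intro eventually_ball_finite ballI)
    fix i
    have "((\<lambda>r. V r $ i $ i) \<longlongrightarrow> V \<gamma>\<^sub>0 $ i $ i) (nhds \<gamma>\<^sub>0)"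
      using contV unfolding isCont_def tendsto_at_iff_tendsto_nhds by (intro tendsto_vec_nth)
    then show "\<forall>\<^sub>F r in nhds \<gamma>\<^sub>0. V r $ i $ i < W i" by (rule order_tendstoD(2)) (simp add: W_def)
  qed simp
  ultimately have "\<forall>\<^sub>F r in nhds \<gamma>\<^sub>0. f\<^sub>0 / 2 < f r \<and> f r < 2 * f\<^sub>0 \<and> (\<forall>i\<in>UNIV. V r $ i $ i < W i)"
    by eventually_elim blast
  then obtain d where d: "0 < d" "\<And>r. dist r \<gamma>\<^sub>0 < d \<Longrightarrow> f\<^sub>0 / 2 < f r \<and> f r < 2 * f\<^sub>0 \<and> (\<forall>i\<in>UNIV. V r $ i $ i < W i)"
    unfolding eventually_nhds_metric by blast
  \<comment> \<open>On a neighbourhood of the kink, continuity at \<open>\<gamma>\<^sub>0\<close> bounds the density from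
    both sides and V from above.\<close>
  define h\<^sub>0 where "h\<^sub>0 = min (d / 2) 1"
  have h\<^sub>0: "0 < h\<^sub>0" "h\<^sub>0 \<le> 1" "h\<^sub>0 < d" using d(1) by (auto simp: h\<^sub>0_def min_def)
  have local: "f\<^sub>0 / 2 \<le> f r \<and> f r \<le> 2 * f\<^sub>0 \<and> V r $ i $ i \<le> W i"
    if "\<gamma>\<^sub>0 - h\<^sub>0 \<le> a" "a < r" "r \<le> b" "b \<le> \<gamma>\<^sub>0 + h\<^sub>0" for r i a b
  proof -
    have "dist r \<gamma>\<^sub>0 < d" using that h\<^sub>0 by (auto simp: dist_real_def abs_less_iff)
    from d(2)[OF this] show ?thesis by (auto intro: less_imp_le)
  qed
  define C\<^sub>0 where "C\<^sub>0 = 2 * f\<^sub>0 * (1 + (\<Sum>i\<in>UNIV. W i))"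
  have C\<^sub>0: "0 \<le> C\<^sub>0" "2 * f\<^sub>0 \<le> C\<^sub>0" "W i * (2 * f\<^sub>0) \<le> C\<^sub>0" for i
  proof -
    have s: "W i \<le> (\<Sum>i\<in>UNIV. W i)" by (rule member_le_sum) (use W in auto)
    have s0: "0 \<le> (\<Sum>i\<in>UNIV. W i)" by (rule sum_nonneg) (rule W)
    show "0 \<le> C\<^sub>0" unfolding C\<^sub>0_def using f\<^sub>0 s0 by simp
    show "2 * f\<^sub>0 \<le> C\<^sub>0" unfolding C\<^sub>0_def using f\<^sub>0 s0 by simp
    have "2 * f\<^sub>0 * W i \<le> 2 * f\<^sub>0 * (1 + (\<Sum>i\<in>UNIV. W i))" using f\<^sub>0 s by (intro mult_left_mono) auto
    then show "W i * (2 * f\<^sub>0) \<le> C\<^sub>0" unfolding C\<^sub>0_def by (simp add: mult.commute)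
  qed
  have x2: "integrable P (\<lambda>\<omega>. (norm (x 0 \<omega>))\<^sup>2)"
    by (rule square_integrable_imp_integrable) (use x4 in simp_all)
  obtain c\<^sub>1 where c\<^sub>1: "0 < c\<^sub>1" "\<And>up p. c\<^sub>1 * (norm p)\<^sup>2 \<le> (\<integral>\<omega>. (p \<bullet> x 0 \<omega>)\<^sup>2 * indicator (base up j \<gamma>\<^sub>0) (x 0 \<omega>) \<partial>P)"
    using base_moment_bounded_below[OF x_measurable x2 pd] by blast
  have strips: "f\<^sub>0 / 2 * (b - a) \<le> (\<integral>\<omega>. indicator (strip j a b) (x 0 \<omega>) \<partial>P)"
    "(\<integral>\<omega>. indicator (strip j a b) (x 0 \<omega>) \<partial>P) \<le> 2 * f\<^sub>0 * (b - a)"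
    if ab: "\<gamma>\<^sub>0 - h\<^sub>0 \<le> a" "a \<le> b" "b \<le> \<gamma>\<^sub>0 + h\<^sub>0" for a b
    using strip_probability[OF dens ab(2), of "f\<^sub>0 / 2" "2 * f\<^sub>0"] local[OF ab(1) _ _ ab(3)] f\<^sub>0 by auto
  interpret kink_sample P F x \<epsilon> c j \<gamma>\<^sub>0 h\<^sub>0 "f\<^sub>0 / 2" C\<^sub>0 c\<^sub>1
  proof (intro kink_sample.intro kink_sample_axioms.intro)
    show "mixing_noise P F x \<epsilon>" by (rule mixing_noise_axioms)
    fix a b assume ab: "\<gamma>\<^sub>0 - h\<^sub>0 \<le> a" "a \<le> b" "b \<le> \<gamma>\<^sub>0 + h\<^sub>0"
    show "f\<^sub>0 / 2 * (b - a) \<le> (\<integral>\<omega>. indicator (strip j a b) (x 0 \<omega>) \<partial>P)" by (rule strips(1)[OF ab])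
    show "(\<integral>\<omega>. indicator (strip j a b) (x 0 \<omega>) \<partial>P) \<le> C\<^sub>0 * (b - a)"
      by (rule order_trans[OF strips(2)[OF ab]]) (use C\<^sub>0(2) ab in \<open>intro mult_right_mono; simp\<close>)
    fix i
    have Y: "integrable P (\<lambda>\<omega>. (\<epsilon> 0 \<omega> * x 0 \<omega> $ i)\<^sup>2)"
    proof (rule square_integrable_imp_integrable)
      show "integrable P (\<lambda>\<omega>. ((\<epsilon> 0 \<omega> * x 0 \<omega> $ i)\<^sup>2)\<^sup>2)"
      proof (rule Bochner_Integration.integrable_bound[OF ex4])
        have "\<bar>\<epsilon> 0 \<omega> * x 0 \<omega> $ i\<bar> \<le> norm (\<epsilon> 0 \<omega> *\<^sub>R x 0 \<omega>)" for \<omega>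
          unfolding abs_mult by (simp add: mult_left_mono component_le_norm_cart)
        from power_mono[OF this abs_ge_zero, of _ 4]
        show "AE \<omega> in P. norm (((\<epsilon> 0 \<omega> * x 0 \<omega> $ i)\<^sup>2)\<^sup>2) \<le> norm (norm (\<epsilon> 0 \<omega> *\<^sub>R x 0 \<omega>) ^ 4)"
          by (intro AE_I2) simp
      qed measurable
    qed measurable
    have "cond_exp_given P (\<lambda>\<omega>. x 0 \<omega> $ j) (\<lambda>\<omega>. ((\<epsilon> 0 \<omega>)\<^sup>2 *\<^sub>R outer_square (x 0 \<omega>)) $ i $ i) (\<lambda>r. V r $ i $ i)"
      using condV unfolding cond_exp_given_mat_def by blast
    then have ce: "cond_exp_given P (\<lambda>\<omega>. x 0 \<omega> $ j) (\<lambda>\<omega>. (\<epsilon> 0 \<omega> * x 0 \<omega> $ i)\<^sup>2) (\<lambda>r. V r $ i $ i)"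
      by (simp add: outer_square_def power2_eq_square mult_ac)
    have "(\<integral>\<omega>. (\<epsilon> 0 \<omega> * x 0 \<omega> $ i)\<^sup>2 * indicator (strip j a b) (x 0 \<omega>) \<partial>P)
       \<le> W i * (\<integral>\<omega>. indicator (strip j a b) (x 0 \<omega>) \<partial>P)"
      by (rule strip_conditional_bound[OF x_measurable Y ce]) (use local[OF ab(1) _ _ ab(3)] in blast)
    also have "\<dots> \<le> W i * (2 * f\<^sub>0 * (b - a))" by (rule mult_left_mono[OF strips(2)[OF ab] W])
    also have "\<dots> = W i * (2 * f\<^sub>0) * (b - a)" by simp
    also have "\<dots> \<le> C\<^sub>0 * (b - a)" using C\<^sub>0(3) ab by (intro mult_right_mono) auto
    finally show "(\<integral>\<omega>. (\<epsilon> 0 \<omega> * x 0 \<omega> $ i)\<^sup>2 * indicator (strip j a b) (x 0 \<omega>) \<partial>P) \<le> C\<^sub>0 * (b - a)" .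
  qed (use const x4 ex4 h\<^sub>0 f\<^sub>0 C\<^sub>0(1) c\<^sub>1 distributed_no_atoms[OF dens] in auto)
  obtain M where M: "\<And>\<theta>. \<theta> \<in> \<Lambda> \<times> \<Gamma> \<Longrightarrow> norm \<theta> \<le> M"
    using compact_imp_bounded[OF assms(3)] unfolding bounded_iff by blast
  have M_bounds: "norm b \<le> M" "norm d \<le> M" "\<bar>\<gamma>\<bar> \<le> M" if "(stack b d, \<gamma>) \<in> \<Lambda> \<times> \<Gamma>" for b d :: "real^'k" and \<gamma>
    using M[OF that] norm_fst_le[of "stack b d" \<gamma>] norm_snd_le[of \<gamma> "stack b d"]
      norm_stack_ge(1)[of b d] norm_stack_ge(2)[of d b] by auto
  have M0: "0 \<le> M" using M_bounds(3)[OF \<Theta>\<^sub>0] by linarith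
  define \<tau>\<^sub>0 where "\<tau>\<^sub>0 = \<bar>\<delta>\<^sub>0 $ j\<bar>"
  have \<tau>\<^sub>0: "0 < \<tau>\<^sub>0" using assms(6) unfolding \<tau>\<^sub>0_def assumption_C_def by simp
  have rates: "\<exists>A. \<forall>\<^sub>F n in sequentially. likely P e (\<lambda>\<omega>. norm (\<alpha>_hat n \<omega> - stack \<beta>\<^sub>0 \<delta>\<^sub>0) \<le> 4 * A * real n powr (- 1 / 2)
      \<and> norm (\<gamma>_hat n \<omega> - \<gamma>\<^sub>0) \<le> A * rate n)" if "0 < e" for e
  proof -
    have S: "0 < 2 * M + 1" "0 \<le> 4 * M" using M0 by auto
    obtain A where A: "\<forall>\<^sub>F n in sequentially. likely P e (accurate \<tau>\<^sub>0 (2 * M + 1) (4 * M) A n)"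
      using discrepancy_rates[OF \<tau>\<^sub>0 S \<open>0 < e\<close>] by blast
    have "\<forall>\<^sub>F n in sequentially. likely P e (\<lambda>\<omega>. norm (\<alpha>_hat n \<omega> - stack \<beta>\<^sub>0 \<delta>\<^sub>0) \<le> 4 * A * real n powr (- 1 / 2)
      \<and> norm (\<gamma>_hat n \<omega> - \<gamma>\<^sub>0) \<le> A * rate n)"
      using A eventually_ge_at_top[of 1]
    proof eventually_elim
      case (elim n)
      show ?case
      proof (rule likely_mono[OF elim(1) order_refl])
        fix \<omega> assume \<omega>: "\<omega> \<in> space P"
        assume H: "accurate \<tau>\<^sub>0 (2 * M + 1) (4 * M) A n \<omega>"
        define \<gamma> where "\<gamma> = \<gamma>_hat n \<omega>"
        obtain b d where bd: "\<alpha>_hat n \<omega> = stack b d" by (rule stack_components)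
        note argmin = assms(11)[OF elim(2) \<omega>, folded \<gamma>_def, unfolded bd]
        have in\<Theta>: "(stack b d, \<gamma>) \<in> \<Lambda> \<times> \<Gamma>" using argmin unfolding is_arg_min_def by blast
        define u v where "u = b - \<beta>\<^sub>0" and "v = b + d - (\<beta>\<^sub>0 + \<delta>\<^sub>0)"
        \<comment> \<open>The regime that holds on the half-space away from the band contributes p, the other one r. Moving
          down exchanges the regimes and the sign of the kink.\<close>
        define up where "up = (\<gamma>\<^sub>0 \<le> \<gamma>)"
        define p r \<tau> where "p = (if up then u else v)" and "r = (if up then v else u)"
          and "\<tau> = (if up then \<delta>\<^sub>0 $ j else - (\<delta>\<^sub>0 $ j))"
        define s where "s = \<bar>\<gamma> - \<gamma>\<^sub>0\<bar>"
        have disc: "stack b d \<bullet> thr_regressor j (x t \<omega>) \<gamma> - stack \<beta>\<^sub>0 \<delta>\<^sub>0 \<bullet> thr_regressor j (x t \<omega>) \<gamma>\<^sub>0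
            = discrepancy up p r \<tau> s (x t \<omega>)" for t
          using kink_inner[OF assms(6) cj const[OF \<omega>], of t]
          by (auto simp: inner_thr_regressor discrepancy_def base_def band_def strip_def s_def p_def r_def \<tau>_def
              u_def v_def up_def inner_diff_left inner_add_left algebra_simps)
        have basic: "(\<Sum>t\<in>{1..int n}. (discrepancy up p r \<tau> s (x t \<omega>))\<^sup>2)
            \<le> 2 * (\<Sum>t\<in>{1..int n}. \<epsilon> t \<omega> * discrepancy up p r \<tau> s (x t \<omega>))"
          using basic_inequality[OF assms(2) \<omega> elim(2) argmin \<Theta>\<^sub>0] unfolding disc .
        \<comment> \<open>u and v are differences of two, respectively four, vectors of norm at most M.\<close>
        have "norm u \<le> 2 * M" unfolding u_def
          using norm_triangle_ineq4[of b \<beta>\<^sub>0] M_bounds(1)[OF in\<Theta>] M_bounds(1)[OF \<Theta>\<^sub>0] by linarith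
        moreover have "norm v \<le> 4 * M" unfolding v_def
          using norm_triangle_ineq4[of "b + d" "\<beta>\<^sub>0 + \<delta>\<^sub>0"] norm_triangle_ineq[of b d] norm_triangle_ineq[of \<beta>\<^sub>0 \<delta>\<^sub>0]
            M_bounds(1,2)[OF in\<Theta>] M_bounds(1,2)[OF \<Theta>\<^sub>0] by linarith
        ultimately have pr: "norm p \<le> 4 * M" "norm r \<le> 4 * M" using M0 unfolding p_def r_def by auto
        have s: "0 \<le> s" "s \<le> 2 * M + 1" unfolding s_def
          using M_bounds(3)[OF in\<Theta>] M_bounds(3)[OF \<Theta>\<^sub>0] by auto
        have \<tau>: "\<bar>\<tau>\<bar> = \<tau>\<^sub>0" unfolding \<tau>_def \<tau>\<^sub>0_def by simp
        have bounds: "norm p \<le> A * real n powr (- 1 / 2)" "norm r \<le> A * real n powr (- 1 / 2)" "s \<le> A * rate n"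
          using H \<tau> s pr basic unfolding accurate_def by blast+
        then have uv: "norm u \<le> A * real n powr (- 1 / 2)" "norm v \<le> A * real n powr (- 1 / 2)"
          unfolding p_def r_def by (auto split: if_splits)
        have "\<alpha>_hat n \<omega> - stack \<beta>\<^sub>0 \<delta>\<^sub>0 = stack u (v - u)"
          unfolding bd stack_diff u_def v_def by (simp add: algebra_simps)
        then have "norm (\<alpha>_hat n \<omega> - stack \<beta>\<^sub>0 \<delta>\<^sub>0) \<le> norm u + norm (v - u)" using norm_stack_le[of u "v - u"] by simp
        also have "\<dots> \<le> norm u + (norm v + norm u)" by (intro add_left_mono norm_triangle_ineq4)
        also have "\<dots> \<le> 4 * A * real n powr (- 1 / 2)" using uv norm_ge_zero[of u] by linarith
        finally have "norm (\<alpha>_hat n \<omega> - stack \<beta>\<^sub>0 \<delta>\<^sub>0) \<le> 4 * A * real n powr (- 1 / 2)" .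
        moreover have "norm (\<gamma>_hat n \<omega> - \<gamma>\<^sub>0) \<le> A * rate n" using bounds(3) unfolding s_def \<gamma>_def by simp
        ultimately show "norm (\<alpha>_hat n \<omega> - stack \<beta>\<^sub>0 \<delta>\<^sub>0) \<le> 4 * A * real n powr (- 1 / 2)
          \<and> norm (\<gamma>_hat n \<omega> - \<gamma>\<^sub>0) \<le> A * rate n" by blast
      qed
    qed
    then show ?thesis by blast
  qed
  show ?thesis
  proof
    show "bounded_in_prob P (\<lambda>n \<omega>. \<alpha>_hat n \<omega> - stack \<beta>\<^sub>0 \<delta>\<^sub>0) (\<lambda>n. real n powr (- 1 / 2))"
    proof (rule bounded_in_probI)
      fix e :: real assume "0 < e"
      from rates[OF this] obtain A where "\<forall>\<^sub>F n in sequentially. likely P e (\<lambda>\<omega>.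
        norm (\<alpha>_hat n \<omega> - stack \<beta>\<^sub>0 \<delta>\<^sub>0) \<le> 4 * A * real n powr (- 1 / 2) \<and> norm (\<gamma>_hat n \<omega> - \<gamma>\<^sub>0) \<le> A * rate n)" by blast
      then have "\<forall>\<^sub>F n in sequentially. likely P e (\<lambda>\<omega>. norm (\<alpha>_hat n \<omega> - stack \<beta>\<^sub>0 \<delta>\<^sub>0) \<le> 4 * A * real n powr (- 1 / 2))"
        by (rule eventually_mono) (erule likely_mono[OF _ order_refl], blast)
      then show "\<exists>A. \<forall>\<^sub>F n in sequentially. likely P e (\<lambda>\<omega>. norm (\<alpha>_hat n \<omega> - stack \<beta>\<^sub>0 \<delta>\<^sub>0) \<le> A * real n powr (- 1 / 2))"
        by blast
    qed
    show "bounded_in_prob P (\<lambda>n \<omega>. \<gamma>_hat n \<omega> - \<gamma>\<^sub>0) (\<lambda>n. real n powr (- 1 / 3))"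
    proof (rule bounded_in_probI)
      fix e :: real assume "0 < e"
      from rates[OF this] obtain A where "\<forall>\<^sub>F n in sequentially. likely P e (\<lambda>\<omega>.
        norm (\<alpha>_hat n \<omega> - stack \<beta>\<^sub>0 \<delta>\<^sub>0) \<le> 4 * A * real n powr (- 1 / 2) \<and> norm (\<gamma>_hat n \<omega> - \<gamma>\<^sub>0) \<le> A * rate n)" by blast
      then have "\<forall>\<^sub>F n in sequentially. likely P e (\<lambda>\<omega>. norm (\<gamma>_hat n \<omega> - \<gamma>\<^sub>0) \<le> A * real n powr (- 1 / 3))"
        unfolding rate_def by (rule eventually_mono) (erule likely_mono[OF _ order_refl], blast)
      then show "\<exists>A. \<forall>\<^sub>F n in sequentially. likely P e (\<lambda>\<omega>. norm (\<gamma>_hat n \<omega> - \<gamma>\<^sub>0) \<le> A * real n powr (- 1 / 3))"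
        by blast
    qed
  qed
qed

end
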